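(* Let $W$ be the $2|1$-dimensional $\mathbb Z_2$-graded vector space over the ground field $\mathbb K=\mathbb C$ with basis $w_1$ (odd), $w_2,w_3$ (even), and let $d_\sharp=\psi^{1,1,0}_2+\psi^{1,1,0}_3+\psi^{1,0,1}_3$. Let $t_1,t_2,t_3$ be even and $\theta_1,\theta_2$ odd parameters. Then $$d^2=d_\sharp+\psi^{1,0,0}_2t_1+\psi^{1,0,0}_3t_2+\varphi^{0,1,0}_3\theta_1+(\varphi^{0,1,0}_2+\varphi^{0,0,1}_3)\theta_2+\psi^{1,0,1}_2t_3-\varphi^{0,0,1}_2t_3\theta_1$$ is a miniversal deformation of $d_\sharp$. The relations on its base are $$t_1\theta_1+t_2\theta_2=0,\qquad -t_1\theta_2+t_2t_3\theta_1=0,$$ so the base is $$\mathcal A=\mathbb K[[t_1,t_2,t_3,\theta_1,\theta_2]]/(t_1\theta_1+t_2\theta_2,\ -t_1\theta_2+t_2t_3\theta_1).$$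
   Context: All spaces are $\mathbb Z_2$-graded over $\mathbb K$. $S(W)=\bigoplus_{n\ge1}S^n(W)$ is the symmetric coalgebra of $W$ (so $w_1^2=0$). $L_n=\mathrm{Hom}(S^n(W),W)$, and $L=\prod_{n\ge1}L_n$ is identified with the coderivations of $S(W)$, a $\mathbb Z_2$-graded Lie algebra under the graded commutator. An $L_\infty$ structure (codifferential) is an odd $d\in L$ with $[d,d]=0$. For a multi-index $I=(i_1,i_2,i_3)$ with $i_1\in\{0,1\}$, $i_2,i_3\ge0$, put $w_I=w_1^{i_1}w_2^{i_2}w_3^{i_3}$, $I!=i_1!i_2!i_3!$, and let $\varphi^I_j(w_J)=I!\,\delta^I_J\,w_j$, an element of $L_{|I|}$ with $|I|=i_1+i_2+i_3$; when odd it is written $\psi^I_j$. Rings are $\mathbb Z_2$-graded commutative (even parameters commute, odd parameters anticommute and square to zero). For an augmented local ring $\mathcal A$ with maximal ideal $\mathfrak m$ and augmentation $\epsilon:\mathcal A\to\mathbb K$: $\mathcal A$ is an infinitesimal base if $\mathfrak m^2=0$, and a formal base if $\mathcal A=\varprojlim_n\mathcal A/\mathfrak m^n$. A deformation of $d$ with base $\mathcal A$ is an $\mathcal A$-linear $L_\infty$ structure $\tilde d$ on an appropriate completion $W\hat\otimes\mathcal A$ of $W\otimes\mathcal A$ such that $(1\otimes\epsilon)(\tilde d)=d$. It is infinitesimal (formal) if $\mathcal A$ is an infinitesimal (formal) base. Two deformations with base $\mathcal A$ are equivalent ($\sim$) if they are conjugate by an $\mathcal A$-linear coalgebra automorphism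 that reduces to the identity under $\epsilon$. A homomorphism $f:\mathcal A\to\mathcal B$ of bases induces $f_*=1\otimes f$ on deformations. A deformation $d^\infty$ with formal base $\mathcal A$ is versal if for every formal deformation $\tilde d$ with base $\mathcal B$ there is $f:\mathcal A\to\mathcal B$ with $f_*(d^\infty)\sim\tilde d$; it is miniversal if moreover $f$ is unique whenever $\mathcal B$ is infinitesimal.
   Formalization: The term ψ^{1,0,1}_2 t_3 in d^2 is taken with a minus sign: with the printed plus sign [d^2,d^2] contains a nonzero multiple of t_3θ_1, which does not vanish in the stated base, so d^2 would not be a codifferential. The relations and the base are as printed. *)

theory Defs
  imports
    "HOL-Computational_Algebra.Formal_Power_Series"
    "HOL-Library.Poly_Mapping"
    "HOL-Library.Z2"
begin

section \<open>Graded commutative augmented local algebras over the complex numbers\<close>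

text \<open>
  The ring structure is that of the type; the record carries the unit map of the
  \<open>\<complex>\<close>-algebra, the homogeneous parts (parities are elements of the two-element
  field \<^typ>\<open>bit\<close>) and the augmentation.
\<close>

record 'a base =
  scal :: "complex \<Rightarrow> 'a"
  homog :: "bit \<Rightarrow> 'a set"
  aug :: "'a \<Rightarrow> complex"

definition ksign :: "bit \<Rightarrow> 'a::ring_1" where
  "ksign p = (if p = 1 then - 1 else 1)"

definition max_ideal :: "('a, 'm) base_scheme \<Rightarrow> 'a set" where
  "max_ideal B = {x. aug B x = 0}"

locale augmented_local_algebra =
  fixes B :: "('a::ring_1) base"
  assumes scal_one: "scal B 1 = 1"
    and scal_add: "\<And>y z. scal B (y + z) = scal B y + scal B z"
    and scal_mult: "\<And>y z. scal B (y * z) = scal B y * scal B z"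
    and scal_even: "\<And>z. scal B z \<in> homog B 0"
    and homog_zero: "\<And>p. 0 \<in> homog B p"
    and homog_add: "\<And>p x y. x \<in> homog B p \<Longrightarrow> y \<in> homog B p \<Longrightarrow> x + y \<in> homog B p"
    and homog_uminus: "\<And>p x. x \<in> homog B p \<Longrightarrow> - x \<in> homog B p"
    and homog_direct_sum: "\<And>x. \<exists>!y. y \<in> homog B 0 \<and> x - y \<in> homog B 1"
    and homog_mult: "\<And>p q x y. x \<in> homog B p \<Longrightarrow> y \<in> homog B q \<Longrightarrow> x * y \<in> homog B (p + q)"
    and graded_commute:
      "\<And>p q x y. x \<in> homog B p \<Longrightarrow> y \<in> homog B q \<Longrightarrow> x * y = ksign (p * q) * (y * x)"
    and aug_add: "\<And>x y. aug B (x + y) = aug B x + aug B y"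
    and aug_mult: "\<And>x y. aug B (x * y) = aug B x * aug B y"
    and aug_scal: "\<And>z. aug B (scal B z) = z"
    and aug_odd: "\<And>x. x \<in> homog B 1 \<Longrightarrow> aug B x = 0"
    and local_ring: "{x. \<not> (\<exists>y. x * y = 1 \<and> y * x = 1)} = max_ideal B"

primrec ideal_power :: "'a::ring_1 set \<Rightarrow> nat \<Rightarrow> 'a set" where
  "ideal_power M 0 = UNIV"
| "ideal_power M (Suc n) =
     {\<Sum>i<k. x i * y i |(k::nat) x y. (\<forall>i<k. x i \<in> ideal_power M n \<and> y i \<in> M)}"

definition infinitesimal_base :: "('a::ring_1) base \<Rightarrow> bool" where
  "infinitesimal_base B \<longleftrightarrow>
     augmented_local_algebra B \<and> ideal_power (max_ideal B) 2 = {0}"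

text \<open>
  The last two conjuncts say that the canonical map from the algebra to the inverse limit of
  its quotients by the powers of the maximal ideal is injective and surjective; a point of the
  limit is given by representatives \<open>s n\<close> of its components.
\<close>

definition formal_base :: "('a::ring_1) base \<Rightarrow> bool" where
  "formal_base B \<longleftrightarrow>
     augmented_local_algebra B \<and>
     (\<Inter>n. ideal_power (max_ideal B) n) = {0} \<and>
     (\<forall>s. (\<forall>n. s (Suc n) - s n \<in> ideal_power (max_ideal B) n) \<longrightarrow>
          (\<exists>x. \<forall>n. x - s n \<in> ideal_power (max_ideal B) n))"

definition base_hom :: "('a::ring_1) base \<Rightarrow> ('b::ring_1) base \<Rightarrow> ('a \<Rightarrow> 'b) \<Rightarrow> bool" where
  "base_hom A B f \<longleftrightarrow>
     f 1 = 1 \<and>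
     (\<forall>x y. f (x + y) = f x + f y) \<and>
     (\<forall>x y. f (x * y) = f x * f y) \<and>
     (\<forall>z. f (scal A z) = scal B z) \<and>
     (\<forall>p. \<forall>x\<in>homog A p. f x \<in> homog B p) \<and>
     (\<forall>x. aug B (f x) = aug A x)"

definition field_base :: "complex base" where
  "field_base = \<lparr>scal = id, homog = (\<lambda>p. if p = 0 then UNIV else {0}), aug = id\<rparr>"

text \<open>\<open>twist B p x\<close> is \<open>(-1)\<^bsup>p |x|\<^esup> x\<close>, extended additively to inhomogeneous \<open>x\<close>.\<close>

definition twist :: "('a::ring_1) base \<Rightarrow> bit \<Rightarrow> 'a \<Rightarrow> 'a" where
  "twist B p x =
     (THE z. \<exists>y0\<in>homog B 0. \<exists>y1\<in>homog B 1. x = y0 + y1 \<and> z = y0 + ksign p * y1)"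


section \<open>The symmetric coalgebra of the 2|1-dimensional space\<close>

text \<open>
  The multi-index \<open>(i\<^sub>1, i\<^sub>2, i\<^sub>3)\<close> stands for the monomial \<open>w\<^sub>1\<^bsup>i\<^sub>1\<^esup> w\<^sub>2\<^bsup>i\<^sub>2\<^esup> w\<^sub>3\<^bsup>i\<^sub>3\<^esup>\<close>,
  with \<open>w\<^sub>1\<close> odd and \<open>w\<^sub>2, w\<^sub>3\<close> even. The zero multi-index is excluded because \<open>S(W)\<close> starts
  in degree one.
\<close>

typedef midx = "{(i1 :: nat, i2 :: nat, i3 :: nat). i1 \<le> 1 \<and> 1 \<le> i1 + i2 + i3}"
  morphisms exps mk_midx
  by (rule exI[of _ "(1, 0, 0)"]) simp

definition mi :: "nat \<Rightarrow> nat \<Rightarrow> nat \<Rightarrow> midx" where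
  "mi i1 i2 i3 = mk_midx (i1, i2, i3)"

definition midx_length :: "midx \<Rightarrow> nat" where
  "midx_length I = (case exps I of (i1, i2, i3) \<Rightarrow> i1 + i2 + i3)"

definition midx_parity :: "midx \<Rightarrow> bit" where
  "midx_parity I = (case exps I of (i1, i2, i3) \<Rightarrow> of_nat i1)"

definition midx_fact :: "midx \<Rightarrow> nat" where
  "midx_fact I = (case exps I of (i1, i2, i3) \<Rightarrow> fact i1 * fact i2 * fact i3)"

definition midx_choose :: "midx \<Rightarrow> midx \<Rightarrow> nat" where
  "midx_choose I J =
     (case (exps I, exps J) of ((i1, i2, i3), (j1, j2, j3)) \<Rightarrow>
        (i1 choose j1) * (i2 choose j2) * (i3 choose j3))"

definition midx_splits :: "midx \<Rightarrow> (midx \<times> midx) set" where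
  "midx_splits I =
     {(J, K). case (exps I, exps J, exps K) of ((i1, i2, i3), (j1, j2, j3), (k1, k2, k3)) \<Rightarrow>
        j1 + k1 = i1 \<and> j2 + k2 = i2 \<and> j3 + k3 = i3}"

datatype gen = W1 | W2 | W3

fun gen_idx :: "gen \<Rightarrow> midx" where
  "gen_idx W1 = mi 1 0 0"
| "gen_idx W2 = mi 0 1 0"
| "gen_idx W3 = mi 0 0 1"

text \<open>
  The extension of \<open>S(W)\<close> to a base \<open>\<A>\<close> is the free right \<open>\<A>\<close>-module on the monomials: an
  element is \<open>\<Sum> w\<^sub>I a\<^sub>I\<close>, with coefficients on the right. As \<open>W\<close> is finite-dimensional and formal
  bases are complete, \<open>W \<otimes> \<A>\<close> is its own completion.
\<close>

type_synonym 'a sym = "midx \<Rightarrow>\<^sub>0 'a"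

definition smul :: "('k \<Rightarrow>\<^sub>0 'a::ring_1) \<Rightarrow> 'a \<Rightarrow> ('k \<Rightarrow>\<^sub>0 'a)" where
  "smul x a = Poly_Mapping.map (\<lambda>b. b * a) x"

definition right_linear :: "(('k \<Rightarrow>\<^sub>0 'a::ring_1) \<Rightarrow> ('l \<Rightarrow>\<^sub>0 'a)) \<Rightarrow> bool" where
  "right_linear F \<longleftrightarrow>
     (\<forall>x y. F (x + y) = F x + F y) \<and> (\<forall>x a. F (smul x a) = smul (F x) a)"

definition monom_w :: "midx \<Rightarrow> 'a::ring_1 sym" where
  "monom_w I = Poly_Mapping.single I 1"

definition sym_homog :: "('a::ring_1) base \<Rightarrow> bit \<Rightarrow> 'a sym set" where
  "sym_homog B p = {x. \<forall>I. Poly_Mapping.lookup x I \<in> homog B (p + midx_parity I)}"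

definition has_parity :: "('a::ring_1) base \<Rightarrow> bit \<Rightarrow> ('a sym \<Rightarrow> 'a sym) \<Rightarrow> bool" where
  "has_parity B p F \<longleftrightarrow> (\<forall>q. \<forall>x\<in>sym_homog B q. F x \<in> sym_homog B (p + q))"

text \<open>
  The tensor square over \<open>\<A>\<close> is the free right module on pairs of monomials. The comultiplication
  is the (reduced) unshuffle comultiplication. It has no signs: a monomial contains at most one
  odd factor, so only even factors are ever moved past each other or past \<open>w\<^sub>1\<close>.
\<close>

definition comult :: "'a::ring_1 sym \<Rightarrow> (midx \<times> midx \<Rightarrow>\<^sub>0 'a)" where
  "comult x =
     (\<Sum>I\<in>Poly_Mapping.keys x. \<Sum>(J, K)\<in>midx_splits I.
        Poly_Mapping.single (J, K) (of_nat (midx_choose I J) * Poly_Mapping.lookup x I))"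

text \<open>\<open>w\<^sub>P a \<otimes> w\<^sub>Q b = (-1)\<^bsup>|a| |w\<^sub>Q|\<^esup> (w\<^sub>P \<otimes> w\<^sub>Q) a b\<close>\<close>

definition tens :: "('a::ring_1) base \<Rightarrow> 'a sym \<Rightarrow> 'a sym \<Rightarrow> (midx \<times> midx \<Rightarrow>\<^sub>0 'a)" where
  "tens B x y =
     (\<Sum>P\<in>Poly_Mapping.keys x. \<Sum>Q\<in>Poly_Mapping.keys y.
        Poly_Mapping.single (P, Q)
          (twist B (midx_parity Q) (Poly_Mapping.lookup x P) * Poly_Mapping.lookup y Q))"

text \<open>
  \<open>(F \<otimes> G) (w\<^sub>J \<otimes> w\<^sub>K) = (-1)\<^bsup>q |w\<^sub>J|\<^esup> F w\<^sub>J \<otimes> G w\<^sub>K\<close> for right linear maps \<open>F\<close> and \<open>G\<close>,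
  where \<open>q\<close> is the parity of \<open>G\<close>.
\<close>

definition tens_map ::
  "('a::ring_1) base \<Rightarrow> bit \<Rightarrow> ('a sym \<Rightarrow> 'a sym) \<Rightarrow> ('a sym \<Rightarrow> 'a sym) \<Rightarrow>
   (midx \<times> midx \<Rightarrow>\<^sub>0 'a) \<Rightarrow> (midx \<times> midx \<Rightarrow>\<^sub>0 'a)" where
  "tens_map B q F G z =
     (\<Sum>(J, K)\<in>Poly_Mapping.keys z.
        smul (tens B (F (monom_w J)) (G (monom_w K)))
          (ksign (q * midx_parity J) * Poly_Mapping.lookup z (J, K)))"

definition coderivation :: "('a::ring_1) base \<Rightarrow> bit \<Rightarrow> ('a sym \<Rightarrow> 'a sym) \<Rightarrow> bool" where
  "coderivation B p D \<longleftrightarrow>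
     right_linear D \<and> has_parity B p D \<and>
     (\<forall>x. comult (D x) = tens_map B 0 D id (comult x) + tens_map B p id D (comult x))"

definition coalgebra_aut :: "('a::ring_1) base \<Rightarrow> ('a sym \<Rightarrow> 'a sym) \<Rightarrow> bool" where
  "coalgebra_aut B L \<longleftrightarrow>
     right_linear L \<and> has_parity B 0 L \<and> bij L \<and>
     (\<forall>x. comult (L x) = tens_map B 0 L L (comult x))"


section \<open>L-infinity structures and their deformations\<close>

definition graded_commutator ::
  "bit \<Rightarrow> bit \<Rightarrow> ('a::ring_1 sym \<Rightarrow> 'a sym) \<Rightarrow> ('a sym \<Rightarrow> 'a sym) \<Rightarrow> ('a sym \<Rightarrow> 'a sym)" where
  "graded_commutator p q F G = (\<lambda>x. F (G x) - smul (G (F x)) (ksign (p * q)))"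

definition linf_structure :: "('a::ring_1) base \<Rightarrow> ('a sym \<Rightarrow> 'a sym) \<Rightarrow> bool" where
  "linf_structure B D \<longleftrightarrow> coderivation B 1 D \<and> graded_commutator 1 1 D D = (\<lambda>x. 0)"

text \<open>
  The base change \<open>1 \<otimes> f\<close>: the right linear map with
  \<open>w\<^sub>I \<mapsto> \<Sum> w\<^sub>J f(a\<^sub>I\<^sub>J)\<close> if \<open>F\<close> maps \<open>w\<^sub>I\<close> to \<open>\<Sum> w\<^sub>J a\<^sub>I\<^sub>J\<close>.
\<close>

definition push ::
  "('a::ring_1 \<Rightarrow> 'b::ring_1) \<Rightarrow> ('a sym \<Rightarrow> 'a sym) \<Rightarrow> ('b sym \<Rightarrow> 'b sym)" where
  "push f F x =
     (\<Sum>I\<in>Poly_Mapping.keys x.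
        smul (Poly_Mapping.map f (F (monom_w I))) (Poly_Mapping.lookup x I))"

definition deformation ::
  "('a::ring_1) base \<Rightarrow> (complex sym \<Rightarrow> complex sym) \<Rightarrow> ('a sym \<Rightarrow> 'a sym) \<Rightarrow> bool" where
  "deformation B d D \<longleftrightarrow> linf_structure B D \<and> push (aug B) D = d"

definition equivalent ::
  "('a::ring_1) base \<Rightarrow> ('a sym \<Rightarrow> 'a sym) \<Rightarrow> ('a sym \<Rightarrow> 'a sym) \<Rightarrow> bool" where
  "equivalent B D D' \<longleftrightarrow>
     (\<exists>L. coalgebra_aut B L \<and> push (aug B) L = id \<and> D' = L \<circ> D \<circ> inv L)"

text \<open>
  The type argument is the type of the elements of the test bases \<open>B\<close>; a theorem in which it is
  a free type variable covers all of them.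
\<close>

definition versal ::
  "('b::ring_1) itself \<Rightarrow> ('a::ring_1) base \<Rightarrow> (complex sym \<Rightarrow> complex sym) \<Rightarrow>
   ('a sym \<Rightarrow> 'a sym) \<Rightarrow> bool" where
  "versal T A d D \<longleftrightarrow>
     formal_base A \<and> deformation A d D \<and>
     (\<forall>(B::'b base) D'. formal_base B \<and> deformation B d D' \<longrightarrow>
        (\<exists>f. base_hom A B f \<and> equivalent B (push f D) D'))"

definition miniversal ::
  "('b::ring_1) itself \<Rightarrow> ('a::ring_1) base \<Rightarrow> (complex sym \<Rightarrow> complex sym) \<Rightarrow>
   ('a sym \<Rightarrow> 'a sym) \<Rightarrow> bool" where
  "miniversal T A d D \<longleftrightarrow>
     versal T A d D \<and>
     (\<forall>(B::'b base) D'. infinitesimal_base B \<and> deformation B d D' \<longrightarrow>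
        (\<forall>f g. base_hom A B f \<and> equivalent B (push f D) D' \<and>
               base_hom A B g \<and> equivalent B (push g D) D' \<longrightarrow> f = g))"

text \<open>
  \<open>cochain B I j a\<close> is \<open>\<phi>\<^sup>I\<^sub>j a\<close> (written \<open>\<psi>\<^sup>I\<^sub>j a\<close> when \<open>\<phi>\<^sup>I\<^sub>j\<close> is odd). With the coefficient standing
  between the map and its argument,
  \<open>(\<phi>\<^sup>I\<^sub>j a)(w\<^sub>I b) = (-1)\<^bsup>|a| |w\<^sub>I|\<^esup> \<phi>\<^sup>I\<^sub>j(w\<^sub>I) a b = (-1)\<^bsup>|a| |w\<^sub>I|\<^esup> I! w\<^sub>j a b\<close>.
\<close>

definition cochain :: "('a::ring_1) base \<Rightarrow> midx \<Rightarrow> gen \<Rightarrow> 'a \<Rightarrow> 'a sym \<Rightarrow> 'a sym" where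
  "cochain B I j a x =
     Poly_Mapping.single (gen_idx j)
       (of_nat (midx_fact I) * twist B (midx_parity I) a * Poly_Mapping.lookup x I)"

definition corestrict :: "('a::ring_1 sym \<Rightarrow> 'a sym) \<Rightarrow> ('a sym \<Rightarrow> 'a sym)" where
  "corestrict F x =
     (\<Sum>I\<in>{I \<in> Poly_Mapping.keys (F x). midx_length I = 1}.
        Poly_Mapping.single I (Poly_Mapping.lookup (F x) I))"

text \<open>The identification of \<open>L\<close> with the coderivations: the coderivation with given corestriction.\<close>

definition coder :: "('a::ring_1) base \<Rightarrow> bit \<Rightarrow> ('a sym \<Rightarrow> 'a sym) \<Rightarrow> ('a sym \<Rightarrow> 'a sym)" where
  "coder B p l = (THE D. coderivation B p D \<and> corestrict D = l)"


section \<open>The base of the miniversal deformation\<close>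

text \<open>\<open>Gr a b c e\<close> stands for \<open>a + b \<theta>\<^sub>1 + c \<theta>\<^sub>2 + e \<theta>\<^sub>1 \<theta>\<^sub>2\<close>.\<close>

datatype 'r gr = Gr (co_1: 'r) (co_\<theta>1: 'r) (co_\<theta>2: 'r) (co_\<theta>12: 'r)

instantiation gr :: (comm_ring_1) ring_1
begin

definition "0 = Gr 0 0 0 0"
definition "1 = Gr 1 0 0 0"
definition "x + y =
  Gr (co_1 x + co_1 y) (co_\<theta>1 x + co_\<theta>1 y) (co_\<theta>2 x + co_\<theta>2 y) (co_\<theta>12 x + co_\<theta>12 y)"
definition "- x = Gr (- co_1 x) (- co_\<theta>1 x) (- co_\<theta>2 x) (- co_\<theta>12 x)"
definition "x - y =
  Gr (co_1 x - co_1 y) (co_\<theta>1 x - co_\<theta>1 y) (co_\<theta>2 x - co_\<theta>2 y) (co_\<theta>12 x - co_\<theta>12 y)"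
definition "x * y =
  Gr (co_1 x * co_1 y)
     (co_1 x * co_\<theta>1 y + co_\<theta>1 x * co_1 y)
     (co_1 x * co_\<theta>2 y + co_\<theta>2 x * co_1 y)
     (co_1 x * co_\<theta>12 y + co_\<theta>12 x * co_1 y + co_\<theta>1 x * co_\<theta>2 y - co_\<theta>2 x * co_\<theta>1 y)"

instance
  by standard
    (auto simp: zero_gr_def one_gr_def plus_gr_def uminus_gr_def minus_gr_def times_gr_def
      algebra_simps)

end

text \<open>The ring \<open>\<complex>[[t\<^sub>1, t\<^sub>2, t\<^sub>3, \<theta>\<^sub>1, \<theta>\<^sub>2]]\<close>, as the exterior algebra on \<open>\<theta>\<^sub>1, \<theta>\<^sub>2\<close> over
  \<open>\<complex>[[t\<^sub>1]][[t\<^sub>2]][[t\<^sub>3]]\<close>.\<close>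

type_synonym pser = "complex fps fps fps gr"

definition ps_scal :: "complex \<Rightarrow> pser" where
  "ps_scal z = Gr (fps_const (fps_const (fps_const z))) 0 0 0"

definition ps_homog :: "bit \<Rightarrow> pser set" where
  "ps_homog p = (if p = 0 then {x. co_\<theta>1 x = 0 \<and> co_\<theta>2 x = 0} else {x. co_1 x = 0 \<and> co_\<theta>12 x = 0})"

definition ps_aug :: "pser \<Rightarrow> complex" where
  "ps_aug x = fps_nth (fps_nth (fps_nth (co_1 x) 0) 0) 0"

definition ps_t1 :: pser where "ps_t1 = Gr (fps_const (fps_const fps_X)) 0 0 0"
definition ps_t2 :: pser where "ps_t2 = Gr (fps_const fps_X) 0 0 0"
definition ps_t3 :: pser where "ps_t3 = Gr fps_X 0 0 0"
definition ps_\<theta>1 :: pser where "ps_\<theta>1 = Gr 0 1 0 0"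
definition ps_\<theta>2 :: pser where "ps_\<theta>2 = Gr 0 0 1 0"

definition two_sided_ideal :: "'a::ring_1 set \<Rightarrow> bool" where
  "two_sided_ideal I \<longleftrightarrow>
     0 \<in> I \<and> (\<forall>x\<in>I. \<forall>y\<in>I. x + y \<in> I) \<and> (\<forall>x\<in>I. \<forall>a. a * x \<in> I \<and> x * a \<in> I)"

definition ideal_generated :: "'a::ring_1 set \<Rightarrow> 'a set" where
  "ideal_generated S = \<Inter>{I. two_sided_ideal I \<and> S \<subseteq> I}"

definition relation_ideal :: "pser set" where
  "relation_ideal =
     ideal_generated
       {ps_t1 * ps_\<theta>1 + ps_t2 * ps_\<theta>2, - (ps_t1 * ps_\<theta>2) + ps_t2 * ps_t3 * ps_\<theta>1}"

definition relation_rel :: "pser \<Rightarrow> pser \<Rightarrow> bool" where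
  "relation_rel x y \<longleftrightarrow> x - y \<in> relation_ideal"

lemma two_sided_ideal_generated: "two_sided_ideal (ideal_generated S)"
  by (auto simp: ideal_generated_def two_sided_ideal_def)

lemma relation_ideal_zero: "0 \<in> relation_ideal"
  and relation_ideal_add: "x \<in> relation_ideal \<Longrightarrow> y \<in> relation_ideal \<Longrightarrow> x + y \<in> relation_ideal"
  and relation_ideal_left: "x \<in> relation_ideal \<Longrightarrow> a * x \<in> relation_ideal"
  and relation_ideal_right: "x \<in> relation_ideal \<Longrightarrow> x * a \<in> relation_ideal"
  using two_sided_ideal_generated unfolding relation_ideal_def two_sided_ideal_def by blast+

lemma relation_ideal_uminus: "x \<in> relation_ideal \<Longrightarrow> - x \<in> relation_ideal"
  using relation_ideal_left[of x "- 1"] by simp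

lemma ps_aug_relation_ideal:
  assumes "x \<in> relation_ideal"
  shows "ps_aug x = 0"
proof -
  have "two_sided_ideal {x. ps_aug x = 0}"
    by (auto simp: two_sided_ideal_def ps_aug_def zero_gr_def plus_gr_def times_gr_def)
  moreover have "ps_aug (ps_t1 * ps_\<theta>1 + ps_t2 * ps_\<theta>2) = 0"
    "ps_aug (- (ps_t1 * ps_\<theta>2) + ps_t2 * ps_t3 * ps_\<theta>1) = 0"
    by (simp_all add: ps_aug_def plus_gr_def times_gr_def uminus_gr_def
        ps_t1_def ps_t2_def ps_t3_def ps_\<theta>1_def ps_\<theta>2_def)
  ultimately show ?thesis
    using assms unfolding relation_ideal_def ideal_generated_def by blast
qed

lemma equivp_relation_rel: "equivp relation_rel"
proof (rule equivpI)
  show "reflp relation_rel"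
    by (rule reflpI) (simp add: relation_rel_def relation_ideal_zero)
  show "symp relation_rel"
  proof (rule sympI)
    fix x y
    assume "relation_rel x y"
    then have "- (x - y) \<in> relation_ideal"
      unfolding relation_rel_def by (rule relation_ideal_uminus)
    then show "relation_rel y x"
      by (simp add: relation_rel_def)
  qed
  show "transp relation_rel"
  proof (rule transpI)
    fix x y z
    assume "relation_rel x y" "relation_rel y z"
    then have "(x - y) + (y - z) \<in> relation_ideal"
      unfolding relation_rel_def by (rule relation_ideal_add)
    then show "relation_rel x z"
      by (simp add: relation_rel_def)
  qed
qed

quotient_type base_alg = pser / relation_rel
  morphisms rep_base_alg cls
  by (rule equivp_relation_rel)

instantiation base_alg :: ring_1
begin

lift_definition zero_base_alg :: base_alg is 0 .
lift_definition one_base_alg :: base_alg is 1 .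

lift_definition plus_base_alg :: "base_alg \<Rightarrow> base_alg \<Rightarrow> base_alg" is "(+)"
proof -
  fix a b c d
  assume "relation_rel a b" "relation_rel c d"
  then have "(a - b) + (c - d) \<in> relation_ideal"
    unfolding relation_rel_def by (rule relation_ideal_add)
  then show "relation_rel (a + c) (b + d)"
    unfolding relation_rel_def by (simp add: algebra_simps)
qed

lift_definition uminus_base_alg :: "base_alg \<Rightarrow> base_alg" is uminus
proof -
  fix a b
  assume "relation_rel a b"
  then have "- (a - b) \<in> relation_ideal"
    unfolding relation_rel_def by (rule relation_ideal_uminus)
  then show "relation_rel (- a) (- b)"
    unfolding relation_rel_def by (simp add: algebra_simps)
qed

lift_definition minus_base_alg :: "base_alg \<Rightarrow> base_alg \<Rightarrow> base_alg" is "(-)"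
proof -
  fix a b c d
  assume "relation_rel a b" "relation_rel c d"
  then have "(a - b) + - (c - d) \<in> relation_ideal"
    unfolding relation_rel_def by (intro relation_ideal_add relation_ideal_uminus)
  then show "relation_rel (a - c) (b - d)"
    unfolding relation_rel_def by (simp add: algebra_simps)
qed

lift_definition times_base_alg :: "base_alg \<Rightarrow> base_alg \<Rightarrow> base_alg" is "(*)"
proof -
  fix a b c d
  assume "relation_rel a b" "relation_rel c d"
  then have "(a - b) * c + b * (c - d) \<in> relation_ideal"
    unfolding relation_rel_def
    by (intro relation_ideal_add relation_ideal_left relation_ideal_right)
  then show "relation_rel (a * c) (b * d)"
    unfolding relation_rel_def by (simp add: algebra_simps)
qed

instance
proof
  show "(0::base_alg) \<noteq> 1"
  proof transfer
    have "ps_aug (0 - 1) \<noteq> 0"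
      by (simp add: ps_aug_def minus_gr_def zero_gr_def one_gr_def)
    then show "\<not> relation_rel 0 1"
      unfolding relation_rel_def using ps_aug_relation_ideal by blast
  qed
qed (transfer; simp add: relation_rel_def relation_ideal_zero algebra_simps)+

end

lift_definition base_alg_aug :: "base_alg \<Rightarrow> complex" is ps_aug
proof -
  fix x y
  assume "relation_rel x y"
  then have "ps_aug (x - y) = 0"
    unfolding relation_rel_def by (rule ps_aug_relation_ideal)
  then show "ps_aug x = ps_aug y"
    by (simp add: ps_aug_def minus_gr_def)
qed

definition base_A :: "base_alg base" where
  "base_A = \<lparr>scal = (\<lambda>z. cls (ps_scal z)), homog = (\<lambda>p. cls ` ps_homog p), aug = base_alg_aug\<rparr>"

definition t1 :: base_alg where "t1 = cls ps_t1"
definition t2 :: base_alg where "t2 = cls ps_t2"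
definition t3 :: base_alg where "t3 = cls ps_t3"
definition \<theta>1 :: base_alg where "\<theta>1 = cls ps_\<theta>1"
definition \<theta>2 :: base_alg where "\<theta>2 = cls ps_\<theta>2"


section \<open>The codifferential and its deformation\<close>

definition sharp_cochain :: "('a::ring_1) base \<Rightarrow> 'a sym \<Rightarrow> 'a sym" where
  "sharp_cochain B x =
     cochain B (mi 1 1 0) W2 1 x + cochain B (mi 1 1 0) W3 1 x + cochain B (mi 1 0 1) W3 1 x"

definition d_sharp :: "complex sym \<Rightarrow> complex sym" where
  "d_sharp = coder field_base 1 (sharp_cochain field_base)"

text \<open>
  The term \<open>\<psi>\<^sup>1\<^sup>0\<^sup>1\<^sub>2 t\<^sub>3\<close> has a minus sign, which is forced by the sign of \<open>- \<phi>\<^sup>0\<^sup>0\<^sup>1\<^sub>2 t\<^sub>3 \<theta>\<^sub>1\<close> and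
  the relations. With the plus sign printed in the source, the square of the coderivation would
  have corestriction \<open>w\<^sub>1 w\<^sub>2 \<mapsto> - 2 w\<^sub>2 t\<^sub>3 \<theta>\<^sub>1\<close>, and \<open>t\<^sub>3 \<theta>\<^sub>1\<close> is not zero in the base. Reversing
  the sign of \<open>t\<^sub>3\<close> gives the equivalent form with \<open>+ \<psi>\<^sup>1\<^sup>0\<^sup>1\<^sub>2 t\<^sub>3 + \<phi>\<^sup>0\<^sup>0\<^sup>1\<^sub>2 t\<^sub>3 \<theta>\<^sub>1\<close> and second relation
  \<open>t\<^sub>1 \<theta>\<^sub>2 + t\<^sub>2 t\<^sub>3 \<theta>\<^sub>1 = 0\<close>.
\<close>

definition d2_cochain :: "base_alg sym \<Rightarrow> base_alg sym" where
  "d2_cochain x =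
     sharp_cochain base_A x
     + cochain base_A (mi 1 0 0) W2 t1 x
     + cochain base_A (mi 1 0 0) W3 t2 x
     + cochain base_A (mi 0 1 0) W3 \<theta>1 x
     + (cochain base_A (mi 0 1 0) W2 \<theta>2 x + cochain base_A (mi 0 0 1) W3 \<theta>2 x)
     - cochain base_A (mi 1 0 1) W2 t3 x
     - cochain base_A (mi 0 0 1) W2 (t3 * \<theta>1) x"

definition d2 :: "base_alg sym \<Rightarrow> base_alg sym" where
  "d2 = coder base_A 1 d2_cochain"

end

(*
  Dually, a deformation of d_sharp is an odd vector field of square zero on the formal superspace
  with even coordinates x, y and one odd coordinate, and d_sharp itself is the odd coordinate times
  the vector field x d/dx + (x + y) d/dy.  A linear field with the single eigenvalue 1 has no
  resonances in degrees at least two, so a change of the even coordinates, found by successive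
  approximation in the m-adic topology, brings the deformed even field into the linear form
  (x + t1 - t3 y) d/dx + (x + y + t2) d/dy up to a rescaling of the odd coordinate.  The equation
  D^2 = 0 then forces the remaining components of D to be those of d2, up to a change of the odd
  coordinate, and its terms of lowest degree are the two relations.  Over a base with m^2 = 0 the
  parameters can be read off from matrix entries of low degree, which gives uniqueness.
*)

theory Submission
  imports Defs "HOL-Library.Product_Plus" "HOL-Library.Product_Order"
begin

text \<open>Factorials are divided out of the matrix of a map, so that its row at P becomes the
  pullback of the monomial x^P. A coderivation is then a derivation, fixed by three rows, and a
  coalgebra morphism is a substitution. With one odd coordinate xi, every row is a pair f0 + f1 xi
  of series in x and y. The coefficients are only graded commutative and live in a
  \<open>ring_1\<close>, so products keep their order and are exchanged by parity. S(W) has no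
  degree zero, hence coordinate changes fix the origin: a translation would remove t1 and t2, but
  none is available. After subtracting the eigenvalue, the weight of degree n is n - 1. It vanishes
  in degree one, where only the nilpotent part x d/dy acts; there the equations are solved by hand,
  and a factor 1/2 appears. Elements of S(W) are finite sums, so limits must stay inside a finite
  set of monomials; this works because coordinate changes without constant terms never decrease the
  order. That the base is separated is a further point: the ideal of relations has to be closed,
  which rests on an order estimate for the two relations.\<close>

declare add_bit_eq_xor [simp del] mult_bit_eq_and [simp del]
  ideal_power.simps(2) [simp del]

section \<open>Graded commutative algebras\<close>

lemma bit_add_self [simp]: "p + p = (0::bit)"
  by (cases p) (simp_all add: add_bit_eq_xor)

lemma bit_add_self_left [simp]: "p + (p + q) = (q::bit)"
  by (simp add: add.assoc [symmetric])

lemma ksign_0 [simp]: "ksign 0 = 1" and ksign_1 [simp]: "ksign 1 = - 1"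
  by (simp_all add: ksign_def)

lemma ksign_add: "ksign (p + q) = (ksign p * ksign q :: 'a::ring_1)"
  by (cases p; cases q) (simp_all add: ksign_def)

lemma ksign_commute: "ksign p * x = x * (ksign p :: 'a::ring_1)"
  by (simp add: ksign_def)

lemma ksign_ksign [simp]: "ksign p * ksign p = (1 :: 'a::ring_1)"
  by (simp add: ksign_def)

section \<open>Homogeneous parts, Koszul signs and the augmentation\<close>

context augmented_local_algebra
begin

lemma homog_diff: "x \<in> homog B p \<Longrightarrow> y \<in> homog B p \<Longrightarrow> x - y \<in> homog B p"
  using homog_add [of x p "- y"] homog_uminus by simp

lemma homog_sum: "(\<And>i. i \<in> S \<Longrightarrow> f i \<in> homog B p) \<Longrightarrow> sum f S \<in> homog B p"
  by (induction S rule: infinite_finite_induct) (auto intro: homog_add homog_zero)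

lemma homog_one [simp]: "1 \<in> homog B 0"
  using scal_even [of 1] by (simp add: scal_one)

lemma scal_zero [simp]: "scal B 0 = 0"
  using scal_add [of 0 0] by simp

lemma scal_of_nat [simp]: "scal B (of_nat n) = of_nat n"
  by (induction n) (simp_all add: scal_add scal_one)

lemma homog_of_nat [simp]: "of_nat n \<in> homog B 0"
  using scal_even [of "of_nat n"] by simp

lemma homog_ksign [simp]: "ksign p \<in> homog B 0"
  by (simp add: ksign_def homog_uminus)

lemma homog_split:
  obtains y0 y1 where "y0 \<in> homog B 0" "y1 \<in> homog B 1" "x = y0 + y1"
  using homog_direct_sum [of x] by (metis add.commute diff_add_cancel)

lemma homog_split_unique:
  assumes "y0 \<in> homog B 0" "y1 \<in> homog B 1" "z0 \<in> homog B 0" "z1 \<in> homog B 1"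
    and "y0 + y1 = z0 + z1"
  shows "y0 = z0" "y1 = z1"
proof -
  have "y0 + y1 - z0 \<in> homog B 1" "y0 + y1 - y0 \<in> homog B 1"
    using assms(2,4) by (simp_all add: assms(5)) (simp flip: assms(5))
  then show "y0 = z0" using homog_direct_sum [of "y0 + y1"] assms by blast
  then show "y1 = z1" using assms by simp
qed

lemma homog_disjoint: "x \<in> homog B 0 \<Longrightarrow> x \<in> homog B 1 \<Longrightarrow> x = 0"
  using homog_split_unique [of x 0 0 x] homog_zero by simp

lemma twist_split:
  assumes "y0 \<in> homog B 0" "y1 \<in> homog B 1"
  shows "twist B p (y0 + y1) = y0 + ksign p * y1"
  unfolding twist_def
  by (rule the_equality) (use assms homog_split_unique in blast)+

lemma twist_homog: "x \<in> homog B q \<Longrightarrow> twist B p x = ksign (p * q) * x"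
  using twist_split [of x 0 p] twist_split [of 0 x p] homog_zero
  by (cases q) simp_all

lemma twist_even: "x \<in> homog B 0 \<Longrightarrow> twist B p x = x"
  by (simp add: twist_homog)

lemma twist_zero_parity [simp]: "twist B 0 x = x"
  by (metis homog_split ksign_0 mult_1 twist_split)

lemma twist_0 [simp]: "twist B p 0 = 0"
  using homog_zero by (simp add: twist_homog)

lemma twist_add: "twist B p (x + y) = twist B p x + twist B p y"
proof -
  obtain x0 x1 where x: "x0 \<in> homog B 0" "x1 \<in> homog B 1" "x = x0 + x1" by (rule homog_split)
  obtain y0 y1 where y: "y0 \<in> homog B 0" "y1 \<in> homog B 1" "y = y0 + y1" by (rule homog_split)
  have "x + y = (x0 + y0) + (x1 + y1)" using x y by (simp add: algebra_simps)
  then have "twist B p (x + y) = (x0 + y0) + ksign p * (x1 + y1)"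
    using twist_split [of "x0 + y0" "x1 + y1"] x y by (metis homog_add)
  then show ?thesis using x y by (simp add: twist_split algebra_simps)
qed

lemma twist_sum: "twist B p (sum f S) = (\<Sum>i\<in>S. twist B p (f i))"
  by (induction S rule: infinite_finite_induct) (simp_all add: twist_add)

lemma twist_mult: "twist B p (x * y) = twist B p x * twist B p y"
proof -
  obtain x0 x1 where x: "x0 \<in> homog B 0" "x1 \<in> homog B 1" "x = x0 + x1" by (rule homog_split)
  obtain y0 y1 where y: "y0 \<in> homog B 0" "y1 \<in> homog B 1" "y = y0 + y1" by (rule homog_split)
  have h: "x0 * y0 \<in> homog B 0" "x1 * y1 \<in> homog B 0" "x0 * y1 \<in> homog B 1" "x1 * y0 \<in> homog B 1"
    using homog_mult [of x0 0 y0 0] homog_mult [of x1 1 y1 1] homog_mult [of x0 0 y1 1]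
      homog_mult [of x1 1 y0 0] x y by simp_all
  have "x * y = (x0 * y0 + x1 * y1) + (x0 * y1 + x1 * y0)" using x y by (simp add: algebra_simps)
  then have "twist B p (x * y) = (x0 * y0 + x1 * y1) + ksign p * (x0 * y1 + x1 * y0)"
    using twist_split [of "x0 * y0 + x1 * y1" "x0 * y1 + x1 * y0"] h by (metis homog_add)
  then show ?thesis using x y by (cases p) (simp_all add: twist_split algebra_simps)
qed

lemma twist_twist: "twist B p (twist B q x) = twist B (p + q) x"
proof -
  obtain x0 x1 where x: "x0 \<in> homog B 0" "x1 \<in> homog B 1" "x = x0 + x1" by (rule homog_split)
  have "ksign q * x1 \<in> homog B 1"
    using homog_mult [of "ksign q" 0 x1 1] x by simp
  then show ?thesis using x by (simp add: twist_split ksign_add mult.assoc)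
qed

text \<open>The Koszul rule when only one factor is homogeneous: passing \<open>x\<close> changes
  the sign of the odd part of \<open>y\<close> exactly if \<open>x\<close> is odd, and that is the
  effect of \<open>twist\<close>. It is the source of the later exchanges of coefficients.\<close>

lemma twist_commute:
  assumes "x \<in> homog B p"
  shows "x * y = twist B p y * x"
proof -
  obtain y0 y1 where y: "y0 \<in> homog B 0" "y1 \<in> homog B 1" "y = y0 + y1" by (rule homog_split)
  have "x * y0 = y0 * x" "x * y1 = ksign p * (y1 * x)"
    using graded_commute [OF assms y(1)] graded_commute [OF assms y(2)] by simp_all
  then show ?thesis using y by (simp add: twist_split algebra_simps mult.assoc)
qed

lemma even_commute: "x \<in> homog B 0 \<Longrightarrow> x * y = y * x"
  using twist_commute [of x 0 y] by simp

lemma scal_commute: "scal B z * x = x * scal B z"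
  by (rule even_commute) (rule scal_even)

lemma scal_inverse: "z \<noteq> 0 \<Longrightarrow> scal B (inverse z) * (scal B z * x) = x"
  by (simp add: mult.assoc [symmetric] scal_mult [symmetric] scal_one)

lemma scal_cancel: "z \<noteq> 0 \<Longrightarrow> scal B z * x = scal B z * y \<longleftrightarrow> x = y"
  by (metis scal_inverse)

lemma of_nat_cancel: "n \<noteq> 0 \<Longrightarrow> of_nat n * x = of_nat n * y \<longleftrightarrow> x = (y :: 'a)"
  using scal_cancel [of "of_nat n" x y] by simp

text \<open>The complex scalars make 2 invertible. This is what turns graded commutativity into the
  vanishing of odd squares.\<close>

lemma double_zero: "x + x = 0 \<Longrightarrow> x = (0 :: 'a)"
  using of_nat_cancel [of 2 x 0] by (simp add: mult_2)

lemma odd_square: "x \<in> homog B 1 \<Longrightarrow> x * x = 0"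
  using graded_commute [of x 1 x 1] double_zero [of "x * x"] by (simp add: eq_neg_iff_add_eq_0)

lemma aug_zero [simp]: "aug B 0 = 0"
  using aug_add [of 0 0] by simp

lemma aug_one [simp]: "aug B 1 = 1"
  using aug_scal [of 1] by (simp add: scal_one)

lemma aug_uminus: "aug B (- x) = - aug B x"
  using aug_add [of x "- x"] by (simp add: eq_neg_iff_add_eq_0 add.commute)

lemma aug_diff: "aug B (x - y) = aug B x - aug B y"
  using aug_add [of x "- y"] by (simp add: aug_uminus)

lemma aug_twist: "aug B (twist B p x) = aug B x"
proof -
  obtain x0 x1 where x: "x0 \<in> homog B 0" "x1 \<in> homog B 1" "x = x0 + x1" by (rule homog_split)
  then show ?thesis by (simp add: twist_split aug_add aug_mult aug_odd)
qed

section \<open>Powers of the maximal ideal\<close>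

abbreviation mp :: "nat \<Rightarrow> 'a set" where
  "mp n \<equiv> ideal_power (max_ideal B) n"

lemma max_ideal_iff: "x \<in> max_ideal B \<longleftrightarrow> aug B x = 0"
  by (simp add: max_ideal_def)

lemma mp_zero [simp]: "0 \<in> mp n"
proof (cases n)
  case (Suc k)
  show ?thesis unfolding Suc ideal_power.simps
    by (intro CollectI exI [of _ 0]) simp
qed simp

lemma mp_Suc_mult:
  assumes "x \<in> mp n" "y \<in> max_ideal B"
  shows "x * y \<in> mp (Suc n)"
proof -
  have "x * y = (\<Sum>i<(1::nat). x * y)" by simp
  then show ?thesis unfolding ideal_power.simps using assms
    by (intro CollectI exI [of _ 1] exI [of _ "\<lambda>_. x"] exI [of _ "\<lambda>_. y"]) auto
qed

lemma mp_add:
  assumes "x \<in> mp n" "y \<in> mp n"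
  shows "x + y \<in> mp n"
proof (cases n)
  case (Suc l)
  obtain k :: nat and a b where x: "x = (\<Sum>i<k. a i * b i)" "\<forall>i<k. a i \<in> mp l \<and> b i \<in> max_ideal B"
    using assms(1) unfolding Suc ideal_power.simps by blast
  obtain k' :: nat and a' b' where y: "y = (\<Sum>i<k'. a' i * b' i)" "\<forall>i<k'. a' i \<in> mp l \<and> b' i \<in> max_ideal B"
    using assms(2) unfolding Suc ideal_power.simps by blast
  define c where "c i = (if i < k then a i else a' (i - k))" for i
  define d where "d i = (if i < k then b i else b' (i - k))" for i
  have "(\<Sum>i<k+k'. c i * d i) = (\<Sum>i<k. c i * d i) + (\<Sum>i<k'. c (k + i) * d (k + i))"
    by (induction k') (simp_all add: add.assoc)
  also have "\<dots> = x + y" by (simp add: x y c_def d_def)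
  finally have "x + y = (\<Sum>i<k+k'. c i * d i)" ..
  moreover have "\<forall>i<k+k'. c i \<in> mp l \<and> d i \<in> max_ideal B"
    using x(2) y(2) by (auto simp: c_def d_def)
  ultimately show ?thesis unfolding Suc ideal_power.simps by blast
qed simp

lemma mp_sum: "(\<And>i. i \<in> S \<Longrightarrow> f i \<in> mp n) \<Longrightarrow> sum f S \<in> mp n"
  by (induction S rule: infinite_finite_induct) (auto intro: mp_add)

lemma mp_induct [consumes 1, case_names zero add mult]:
  assumes "x \<in> mp (Suc n)" "P 0" "\<And>x y. P x \<Longrightarrow> P y \<Longrightarrow> P (x + y)"
    and "\<And>x y. x \<in> mp n \<Longrightarrow> y \<in> max_ideal B \<Longrightarrow> P (x * y)"
  shows "P x"
proof -
  obtain k :: nat and a b where x: "x = (\<Sum>i<k. a i * b i)" "\<forall>i<k. a i \<in> mp n \<and> b i \<in> max_ideal B"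
    using assms(1) unfolding ideal_power.simps by blast
  have "k' \<le> k \<Longrightarrow> P (\<Sum>i<k'. a i * b i)" for k'
  proof (induction k')
    case (Suc k')
    then have "P (a k' * b k')" using x(2) assms(4) by simp
    then show ?case using Suc assms(3) by simp
  qed (simp add: assms(2))
  then show ?thesis using x by blast
qed

lemma mp_left: "x \<in> mp n \<Longrightarrow> a * x \<in> mp n"
proof (induction n arbitrary: x)
  case (Suc n)
  from Suc.prems show ?case
  proof (induction x rule: mp_induct)
    case (mult x y)
    then show ?case using mp_Suc_mult [of "a * x" n y] Suc.IH by (simp add: mult.assoc)
  qed (simp_all only: mult_zero_right mp_zero distrib_left mp_add)
qed simp

lemma mp_right: "x \<in> mp n \<Longrightarrow> x * a \<in> mp n"
proof (cases n)
  case (Suc k)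
  assume "x \<in> mp n"
  then show ?thesis unfolding Suc
  proof (induction x rule: mp_induct)
    case (mult x y)
    then have "y * a \<in> max_ideal B" by (simp add: max_ideal_iff aug_mult)
    then show ?case using mp_Suc_mult [of x k "y * a"] mult by (simp add: mult.assoc)
  qed (simp_all only: mult_zero_left mp_zero distrib_right mp_add)
qed simp

lemma mp_uminus: "x \<in> mp n \<Longrightarrow> - x \<in> mp n"
  using mp_left [of x n "- 1"] by simp

lemma mp_uminus_iff [simp]: "- x \<in> mp n \<longleftrightarrow> x \<in> mp n"
  using mp_uminus by fastforce

lemma mp_diff: "x \<in> mp n \<Longrightarrow> y \<in> mp n \<Longrightarrow> x - y \<in> mp n"
  using mp_add [of x n "- y"] by simp

lemma mp_twist: "x \<in> mp n \<Longrightarrow> twist B p x \<in> mp n"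
proof (induction n arbitrary: x)
  case (Suc n)
  from Suc.prems show ?case
  proof (induction x rule: mp_induct)
    case (mult x y)
    then show ?case unfolding twist_mult
      by (intro mp_Suc_mult Suc.IH) (simp_all add: max_ideal_iff aug_twist)
  qed (simp_all only: twist_0 mp_zero twist_add mp_add)
qed simp

lemma mp_1 [simp]: "mp (Suc 0) = max_ideal B"
proof
  show "mp (Suc 0) \<subseteq> max_ideal B"
  proof
    fix x assume "x \<in> mp (Suc 0)"
    then show "x \<in> max_ideal B"
      by (induction x rule: mp_induct) (simp_all add: max_ideal_iff aug_add aug_mult)
  qed
  show "max_ideal B \<subseteq> mp (Suc 0)"
    using mp_Suc_mult [of 1 0] by auto
qed

text \<open>\<open>ideal_power\<close> puts the new factor on the right. A factor on the left is
  moved there part by part, at the cost of a \<open>twist\<close>, which preserves the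
  powers.\<close>

lemma mp_Suc_mult_left:
  assumes "x \<in> mp n" "y \<in> max_ideal B"
  shows "y * x \<in> mp (Suc n)"
proof -
  obtain y0 y1 where y: "y0 \<in> homog B 0" "y1 \<in> homog B 1" "y = y0 + y1" by (rule homog_split)
  have m: "aug B y1 = 0" "aug B y0 = 0"
    using assms y aug_odd by (simp_all add: max_ideal_iff aug_add)
  have "y * x = x * y0 + twist B 1 x * y1"
    using y even_commute [of y0 x] twist_commute [of y1 1 x] by (simp add: algebra_simps)
  then show ?thesis
    using m assms by (simp add: mp_add mp_Suc_mult mp_twist max_ideal_iff)
qed

lemma mp_Suc_subset: "mp (Suc n) \<subseteq> mp n"
proof
  fix x assume "x \<in> mp (Suc n)"
  then show "x \<in> mp n" by (induction x rule: mp_induct) (simp_all add: mp_add mp_right)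
qed

lemma mp_of_nat_cancel:
  assumes "n \<noteq> 0" "of_nat n * x \<in> mp k" shows "x \<in> mp k"
  using mp_left [OF assms(2), of "scal B (inverse (of_nat n))"] scal_inverse [of "of_nat n" x] assms(1)
  by simp

text \<open>The powers of the maximal ideal are graded: \<open>twist\<close> by the odd parity is
  the automorphism y0 + y1 to y0 - y1 and preserves them, so half the sum of an element and its
  image is again in the power.\<close>

lemma mp_odd_part:
  assumes "y0 \<in> homog B 0" "y1 \<in> homog B 1" "y0 + y1 \<in> mp n"
  shows "y0 \<in> mp n" "y1 \<in> mp n"
proof -
  have "y0 - y1 \<in> mp n"
    using mp_twist [OF assms(3), of 1] twist_split [OF assms(1,2), of 1] by simp
  then have "of_nat 2 * y0 \<in> mp n"
    using mp_add [OF assms(3), of "y0 - y1"] by (simp add: mult_2)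
  then show "y0 \<in> mp n" by (rule mp_of_nat_cancel [rotated]) simp
  then show "y1 \<in> mp n" using mp_diff [OF assms(3)] by fastforce
qed

end

lemma field_base_algebra: "augmented_local_algebra field_base"
proof
  have "(\<exists>y. x * y = 1 \<and> y * x = 1) \<longleftrightarrow> x \<noteq> 0" for x :: complex
    using right_inverse [of x] left_inverse [of x] by fastforce
  then show "{x. \<not> (\<exists>y. x * y = 1 \<and> y * x = 1)} = max_ideal field_base"
    by (simp add: field_base_def max_ideal_def)
qed (auto simp: field_base_def ksign_def split: if_splits)

section \<open>Complete algebras and fixed points in the m-adic topology\<close>

locale formal_algebra = augmented_local_algebra +
  assumes separated: "(\<Inter>n. ideal_power (max_ideal B) n) = {0}"
    and complete: "\<And>s. (\<And>n. s (Suc n) - s n \<in> ideal_power (max_ideal B) n) \<Longrightarrow>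
      \<exists>x. \<forall>n. x - s n \<in> ideal_power (max_ideal B) n"
begin

lemma mp_all_zero: "(\<And>n. x \<in> mp n) \<Longrightarrow> x = 0"
  using separated by blast

text \<open>Subtracting an approximant of parity \<open>p\<close> leaves the part of the other
  parity unchanged, so that part lies in every power of the maximal ideal and vanishes by
  separation.\<close>

lemma homog_closed:
  assumes "\<And>n. \<exists>y\<in>homog B p. x - y \<in> mp n"
  shows "x \<in> homog B p"
proof -
  obtain x0 x1 where x: "x0 \<in> homog B 0" "x1 \<in> homog B 1" "x = x0 + x1" by (rule homog_split)
  show ?thesis
  proof (cases "p = 0")
    case True
    have "x1 \<in> mp n" for n
    proof -
      obtain y where y: "y \<in> homog B 0" "x - y \<in> mp n" using assms [of n] True by blast
      then show ?thesis using mp_odd_part [of "x0 - y" x1 n] x homog_diff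
        by (simp add: algebra_simps)
    qed
    then show ?thesis using mp_all_zero [of x1] x True by simp
  next
    case False
    have "x0 \<in> mp n" for n
    proof -
      obtain y where y: "y \<in> homog B 1" "x - y \<in> mp n" using assms [of n] False by auto
      then show ?thesis using mp_odd_part [of x0 "x1 - y" n] x homog_diff
        by (simp add: algebra_simps)
    qed
    then show ?thesis using mp_all_zero [of x0] x False by simp
  qed
qed

text \<open>Banach's fixed point theorem in the m-adic topology, for families with prescribed
  parities. The hypothesis is uniform in the index, so one iteration started at zero converges in
  all coordinates; parities survive the limit by \<open>homog_closed\<close>.\<close>

lemma contraction_fixpoint:
  fixes T :: "('i \<Rightarrow> 'a) \<Rightarrow> 'i \<Rightarrow> 'a" and par :: "'i \<Rightarrow> bit"
  defines "K \<equiv> {s. \<forall>i. s i \<in> homog B (par i) \<and> s i \<in> max_ideal B}"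
  assumes maps: "\<And>s. s \<in> K \<Longrightarrow> T s \<in> K"
    and contr: "\<And>s s' n. s \<in> K \<Longrightarrow> s' \<in> K \<Longrightarrow> (\<And>i. s i - s' i \<in> mp n) \<Longrightarrow>
      (\<And>i. T s i - T s' i \<in> mp (Suc n))"
  obtains s where "s \<in> K" "T s = s"
proof -
  define q where "q n = (T ^^ n) (\<lambda>_. 0)" for n
  have q_Suc: "q (Suc n) = T (q n)" for n by (simp add: q_def)
  have qK: "q n \<in> K" for n
  proof (induction n)
    case 0
    show ?case by (simp add: q_def K_def homog_zero max_ideal_iff)
  qed (simp add: q_Suc maps)
  have step: "q (Suc n) i - q n i \<in> mp n" for n i
  proof (induction n arbitrary: i)
    case (Suc n)
    then show ?case using contr [OF qK qK, of "Suc n" n n i] by (simp add: q_Suc)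
  qed simp
  have "\<exists>x. \<forall>n. x - q n i \<in> mp n" for i
    by (rule complete) (rule step)
  then obtain s where s: "\<And>i n. s i - q n i \<in> mp n" by metis
  have sK: "s \<in> K"
  proof -
    have "s i \<in> homog B (par i)" for i
      using s [of i] qK unfolding K_def by (intro homog_closed) blast
    moreover have "s i \<in> max_ideal B" for i
      using s [of i 1] qK [of 1] by (simp add: K_def max_ideal_iff aug_diff)
    ultimately show ?thesis by (simp add: K_def)
  qed
  have "T s i - s i = 0" for i
  proof (rule mp_all_zero)
    fix n
    have "T s i - q (Suc n) i \<in> mp (Suc n)"
      unfolding q_Suc by (rule contr [OF sK qK s])
    moreover have "s i - q (Suc n) i \<in> mp (Suc n)" by (rule s)
    ultimately have "(T s i - q (Suc n) i) - (s i - q (Suc n) i) \<in> mp (Suc n)"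
      by (rule mp_diff)
    then show "T s i - s i \<in> mp n" using mp_Suc_subset by auto
  qed
  then have "T s = s" by auto
  with sK show ?thesis by (rule that)
qed

end

lemma formal_base_iff: "formal_base B \<longleftrightarrow> formal_algebra B"
  by (auto simp: formal_base_def formal_algebra_def formal_algebra_axioms_def)

lemma infinitesimal_mult:
  assumes "infinitesimal_base B" "x \<in> max_ideal B" "y \<in> max_ideal B"
  shows "x * y = 0"
proof -
  interpret augmented_local_algebra B using assms(1) by (simp add: infinitesimal_base_def)
  have "x * y \<in> mp (Suc (Suc 0))" using mp_Suc_mult [of x "Suc 0" y] assms by simp
  then show ?thesis using assms(1) by (simp add: infinitesimal_base_def numeral_2_eq_2)
qed


section \<open>Right linear maps as matrices\<close>

definition ent :: "(('k \<Rightarrow>\<^sub>0 'a::ring_1) \<Rightarrow> ('l \<Rightarrow>\<^sub>0 'a)) \<Rightarrow> 'l \<Rightarrow> 'k \<Rightarrow> 'a" where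
  "ent F J I = Poly_Mapping.lookup (F (Poly_Mapping.single I 1)) J"

lemma lookup_smul [simp]: "Poly_Mapping.lookup (smul x a) k = Poly_Mapping.lookup x k * a"
  by (simp add: smul_def Poly_Mapping.map.rep_eq when_def)

lemma smul_simps [simp]: "smul x 0 = 0" "smul x 1 = x" "smul 0 a = 0"
    "smul (smul x a) b = smul x (a * b)"
  by (rule poly_mapping_eqI; simp add: mult.assoc)+

lemma smul_add: "smul (x + y) a = smul x a + smul y a"
  by (rule poly_mapping_eqI) (simp add: lookup_add distrib_right)

lemma right_linear_add: "right_linear F \<Longrightarrow> F (x + y) = F x + F y"
  and right_linear_smul: "right_linear F \<Longrightarrow> F (smul x a) = smul (F x) a"
  by (simp_all add: right_linear_def)

lemma right_linear_zero: "right_linear F \<Longrightarrow> F 0 = 0"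
  using right_linear_smul [of F 0 0] by simp

lemma right_linear_sum: "right_linear F \<Longrightarrow> F (sum f S) = (\<Sum>i\<in>S. F (f i))"
  by (induction S rule: infinite_finite_induct) (simp_all add: right_linear_zero right_linear_add)

lemma right_linear_comp: "right_linear F \<Longrightarrow> right_linear G \<Longrightarrow> right_linear (F \<circ> G)"
  by (simp add: right_linear_def)

lemma right_linear_id: "right_linear id"
  by (simp add: right_linear_def)

lemma poly_mapping_expand:
  "x = (\<Sum>I\<in>Poly_Mapping.keys x. smul (Poly_Mapping.single I 1) (Poly_Mapping.lookup x I))"
  by (rule poly_mapping_eqI)
    (auto simp: lookup_sum lookup_single when_def not_in_keys_iff_lookup_eq_zero if_distrib
      [where f = "\<lambda>z. z * _"] sum.delta' cong: if_cong)

lemma right_linear_lookup: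
  assumes "right_linear F" "finite S" "Poly_Mapping.keys x \<subseteq> S"
  shows "Poly_Mapping.lookup (F x) J = (\<Sum>I\<in>S. ent F J I * Poly_Mapping.lookup x I)"
proof -
  have "Poly_Mapping.lookup (F x) J =
      (\<Sum>I\<in>Poly_Mapping.keys x. ent F J I * Poly_Mapping.lookup x I)"
    by (subst poly_mapping_expand [of x])
      (simp add: right_linear_sum right_linear_smul assms lookup_sum ent_def)
  also have "\<dots> = (\<Sum>I\<in>S. ent F J I * Poly_Mapping.lookup x I)"
    using assms by (intro sum.mono_neutral_left) (auto simp: not_in_keys_iff_lookup_eq_zero)
  finally show ?thesis .
qed

text \<open>\<open>S\<close> may be any finite set containing the support, so that \<open>x\<close>,
  \<open>y\<close> and \<open>x + y\<close> can be expanded over one common set.\<close>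

lemma right_linearI:
  fixes F :: "('k \<Rightarrow>\<^sub>0 'a::ring_1) \<Rightarrow> ('l \<Rightarrow>\<^sub>0 'a)"
  assumes "\<And>x S J. finite S \<Longrightarrow> Poly_Mapping.keys x \<subseteq> S \<Longrightarrow>
    Poly_Mapping.lookup (F x) J = (\<Sum>I\<in>S. A J I * Poly_Mapping.lookup x I)"
  shows "right_linear F"
  unfolding right_linear_def
proof (intro conjI allI; rule poly_mapping_eqI)
  fix x y :: "'k \<Rightarrow>\<^sub>0 'a" and J
  let ?S = "Poly_Mapping.keys x \<union> Poly_Mapping.keys y"
  have "Poly_Mapping.keys (x + y) \<subseteq> ?S" by (rule Poly_Mapping.keys_add)
  then show "Poly_Mapping.lookup (F (x + y)) J = Poly_Mapping.lookup (F x + F y) J"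
    using assms [of ?S "x + y" J] assms [of ?S x J] assms [of ?S y J]
    by (simp add: lookup_add distrib_left sum.distrib)
next
  fix x :: "'k \<Rightarrow>\<^sub>0 'a" and a J
  have "Poly_Mapping.keys (smul x a) \<subseteq> Poly_Mapping.keys x"
    by (auto simp: in_keys_iff)
  then show "Poly_Mapping.lookup (F (smul x a)) J = Poly_Mapping.lookup (smul (F x) a) J"
    using assms [of "Poly_Mapping.keys x" "smul x a" J] assms [of "Poly_Mapping.keys x" x J]
    by (simp add: sum_distrib_right mult.assoc)
qed

lemma right_linear_ext:
  assumes "right_linear F" "right_linear G" "\<And>J I. ent F J I = ent G J I"
  shows "F = G"
proof (rule ext, rule poly_mapping_eqI)
  fix x J
  show "Poly_Mapping.lookup (F x) J = Poly_Mapping.lookup (G x) J"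
    using right_linear_lookup [OF assms(1), of "Poly_Mapping.keys x" x]
      right_linear_lookup [OF assms(2), of "Poly_Mapping.keys x" x] assms(3) by simp
qed

lemma ent_comp:
  assumes "right_linear F" "finite S" "Poly_Mapping.keys (G (Poly_Mapping.single I 1)) \<subseteq> S"
  shows "ent (F \<circ> G) J I = (\<Sum>K\<in>S. ent F J K * ent G K I)"
  using right_linear_lookup [OF assms] by (simp add: ent_def)

lemma ent_id: "ent id J I = (1 when I = J)"
  by (simp add: ent_def lookup_single)

definition mat_map :: "('l \<Rightarrow> 'k \<Rightarrow> 'a) \<Rightarrow> ('k \<Rightarrow>\<^sub>0 'a::ring_1) \<Rightarrow> ('l \<Rightarrow>\<^sub>0 'a)" where
  "mat_map A x =
     (\<Sum>I\<in>Poly_Mapping.keys x. smul (Abs_poly_mapping (\<lambda>J. A J I)) (Poly_Mapping.lookup x I))"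

lemma
  assumes "\<And>I. finite {J. A J I \<noteq> 0}"
  shows right_linear_mat_map: "right_linear (mat_map A)"
    and ent_mat_map: "ent (mat_map A) J I = A J I"
proof -
  have *: "Poly_Mapping.lookup (mat_map A x) J = (\<Sum>I\<in>S. A J I * Poly_Mapping.lookup x I)"
    if "finite S" "Poly_Mapping.keys x \<subseteq> S" for x S J
  proof -
    have "Poly_Mapping.lookup (mat_map A x) J =
        (\<Sum>I\<in>Poly_Mapping.keys x. A J I * Poly_Mapping.lookup x I)"
      by (simp add: mat_map_def lookup_sum lookup_Abs_poly_mapping assms)
    also have "\<dots> = (\<Sum>I\<in>S. A J I * Poly_Mapping.lookup x I)"
      using that by (intro sum.mono_neutral_left) (auto simp: not_in_keys_iff_lookup_eq_zero)
    finally show ?thesis .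
  qed
  then show "right_linear (mat_map A)" by (rule right_linearI)
  show "ent (mat_map A) J I = A J I"
    unfolding ent_def using * [of "{I}"] by simp
qed

lemma
  fixes f :: "'a::ring_1 \<Rightarrow> 'b::ring_1"
  shows right_linear_push: "right_linear (push f F)"
    and ent_push: "f 0 = 0 \<Longrightarrow> ent (push f F) J I = f (ent F J I)"
proof -
  show "right_linear (push f F)"
  proof (rule right_linearI)
    fix x :: "'b sym" and S :: "midx set" and J
    assume "finite S" "Poly_Mapping.keys x \<subseteq> S"
    then show "Poly_Mapping.lookup (push f F x) J =
      (\<Sum>I\<in>S. Poly_Mapping.lookup (Poly_Mapping.map f (F (monom_w I))) J * Poly_Mapping.lookup x I)"
      unfolding push_def lookup_sum lookup_smul
      by (intro sum.mono_neutral_left) (auto simp: not_in_keys_iff_lookup_eq_zero)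
  qed
  show "ent (push f F) J I = f (ent F J I)" if "f 0 = 0"
    using that by (simp add: ent_def push_def monom_w_def Poly_Mapping.map.rep_eq when_def)
qed

context augmented_local_algebra
begin

lemma has_parity_iff:
  assumes "right_linear F"
  shows "has_parity B p F \<longleftrightarrow> (\<forall>I J. ent F J I \<in> homog B (p + midx_parity I + midx_parity J))"
proof
  assume F: "has_parity B p F"
  show "\<forall>I J. ent F J I \<in> homog B (p + midx_parity I + midx_parity J)"
  proof (intro allI)
    fix I J
    have "Poly_Mapping.single I 1 \<in> sym_homog B (midx_parity I)"
      by (simp add: sym_homog_def lookup_single when_def homog_zero)
    then show "ent F J I \<in> homog B (p + midx_parity I + midx_parity J)"
      using F unfolding has_parity_def ent_def sym_homog_def by blast
  qed
next
  assume F: "\<forall>I J. ent F J I \<in> homog B (p + midx_parity I + midx_parity J)"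
  show "has_parity B p F"
    unfolding has_parity_def sym_homog_def
  proof (intro allI ballI CollectI)
    fix q x J
    assume x: "x \<in> {x. \<forall>I. Poly_Mapping.lookup x I \<in> homog B (q + midx_parity I)}"
    have "ent F J I * Poly_Mapping.lookup x I \<in> homog B (p + q + midx_parity J)" for I
    proof -
      have "ent F J I * Poly_Mapping.lookup x I \<in>
          homog B ((p + midx_parity I + midx_parity J) + (q + midx_parity I))"
        using F x by (intro homog_mult) auto
      moreover have "(p + midx_parity I + midx_parity J) + (q + midx_parity I) = p + q + midx_parity J"
        by (cases p; cases q; cases "midx_parity I"; cases "midx_parity J") simp_all
      ultimately show ?thesis by simp
    qed
    then show "Poly_Mapping.lookup (F x) J \<in> homog B (p + q + midx_parity J)"
      using right_linear_lookup [OF assms, of "Poly_Mapping.keys x" x]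
      by (simp add: homog_sum)
  qed
qed

lemma has_parityD: "has_parity B p F \<Longrightarrow> x \<in> sym_homog B q \<Longrightarrow> F x \<in> sym_homog B (p + q)"
  by (simp add: has_parity_def)

lemma has_parity_id: "has_parity B 0 id"
  by (simp add: has_parity_def)

lemma has_parity_comp: "has_parity B p F \<Longrightarrow> has_parity B q G \<Longrightarrow> has_parity B (p + q) (F \<circ> G)"
  by (auto simp: has_parity_def add.assoc)

end


section \<open>Monomials as triples of exponents\<close>

text \<open>Exponents are handled as plain triples, which can be added, subtracted and compared.
  \<open>valid\<close> singles out those that are monomials of S(W); the value of a coefficient at
  any other triple will be zero by convention.\<close>

definition valid :: "nat \<times> nat \<times> nat \<Rightarrow> bool" where
  "valid P \<longleftrightarrow> fst P \<le> 1 \<and> P \<noteq> 0"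

definition tpar :: "nat \<times> nat \<times> nat \<Rightarrow> bit" where
  "tpar P = of_nat (fst P)"

definition tfact :: "nat \<times> nat \<times> nat \<Rightarrow> nat" where
  "tfact P = fact (fst P) * fact (fst (snd P)) * fact (snd (snd P))"

lemma tfact_nonzero [simp]: "tfact P \<noteq> 0"
  by (simp add: tfact_def)

lemma tfact_simps [simp]: "tfact (Suc 0, 0, 0) = 1" "tfact (0, Suc 0, 0) = 1" "tfact (0, 0, Suc 0) = 1"
    "tfact (1, 0, 0) = 1" "tfact (0, 1, 0) = 1" "tfact (0, 0, 1) = 1"
  by (simp_all add: tfact_def)

lemma tpar_simps [simp]: "tpar (0, i, j) = 0" "tpar (Suc 0, i, j) = 1" "tpar (1, i, j) = 1"
  by (simp_all add: tpar_def)

lemma valid_iff: "valid (a, b, c) \<longleftrightarrow> a \<le> 1 \<and> 1 \<le> a + b + c"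
  by (auto simp: valid_def zero_prod_def)

lemma not_valid_0 [simp]: "\<not> valid 0"
  by (simp add: valid_def)

lemma valid_exps [simp]: "valid (exps I)"
proof -
  obtain a b c where "exps I = (a, b, c)" by (cases "exps I")
  then show ?thesis using exps [of I] by (simp add: valid_iff)
qed

lemma exps_mk [simp]: "valid P \<Longrightarrow> exps (mk_midx P) = P"
  by (cases P) (auto simp: valid_iff intro: mk_midx_inverse)

lemma mk_exps [simp]: "mk_midx (exps I) = I"
  by (rule exps_inverse)

lemma midx_parity_mk [simp]: "valid P \<Longrightarrow> midx_parity (mk_midx P) = tpar P"
  by (cases P) (simp add: midx_parity_def tpar_def)

lemma midx_parity_tpar: "midx_parity I = tpar (exps I)"
  by (cases "exps I") (simp add: midx_parity_def tpar_def)

lemma midx_choose_fact: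
  assumes "exps J + exps K = exps I"
  shows "of_nat (midx_choose I J) = (of_nat (tfact (exps I)) / (of_nat (tfact (exps J)) * of_nat (tfact (exps K))) :: complex)"
proof -
  obtain j1 j2 j3 where J: "exps J = (j1, j2, j3)" by (cases "exps J")
  obtain k1 k2 k3 where K: "exps K = (k1, k2, k3)" by (cases "exps K")
  have I: "exps I = (j1 + k1, j2 + k2, j3 + k3)" using assms J K by simp
  show ?thesis
    by (simp add: midx_choose_def I J K tfact_def binomial_fact field_simps)
qed

lemma midx_splits_iff: "(J, K) \<in> midx_splits I \<longleftrightarrow> exps J + exps K = exps I"
  by (cases "exps I"; cases "exps J"; cases "exps K") (simp add: midx_splits_def)

lemma finite_atMost_triple [simp]: "finite {P. P \<le> (I :: nat \<times> nat \<times> nat)}"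
proof -
  obtain a b c where "I = (a, b, c)" by (cases I)
  then have "{P. P \<le> I} \<subseteq> {..a} \<times> {..b} \<times> {..c}" by auto
  then show ?thesis by (rule finite_subset) simp
qed

lemma triple_add_diff: "P \<le> I \<Longrightarrow> P + (I - P) = (I :: nat \<times> nat \<times> nat)"
  by (cases P; cases I) simp

lemma triple_le_add: "P \<le> P + (Q :: nat \<times> nat \<times> nat)" "Q \<le> P + (Q :: nat \<times> nat \<times> nat)"
  by (cases P; cases Q; simp)+

lemma triple_add_diff_cancel: "P + Q - P = (Q :: nat \<times> nat \<times> nat)" "P + Q - Q = (P :: nat \<times> nat \<times> nat)"
  by (cases P; cases Q; simp)+

lemma valid_diff: "valid I \<Longrightarrow> P \<le> I \<Longrightarrow> valid (I - P) \<longleftrightarrow> P \<noteq> I"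
  by (cases P; cases I) (auto simp: valid_iff)

lemma midx_splits_triple:
  "midx_splits I = (\<lambda>P. (mk_midx P, mk_midx (exps I - P))) ` {P. P \<le> exps I \<and> P \<noteq> 0 \<and> P \<noteq> exps I}"
proof (intro set_eqI iffI)
  fix z assume "z \<in> midx_splits I"
  then obtain J K where z: "z = (J, K)" "exps J + exps K = exps I"
    by (cases z) (auto simp: midx_splits_iff)
  have "exps J \<le> exps I" "exps K = exps I - exps J"
    by (simp_all flip: z(2) add: triple_le_add triple_add_diff_cancel)
  moreover have "exps J \<noteq> 0" "exps J \<noteq> exps I"
    using valid_exps [of J] valid_exps [of K] z(2) by (auto simp: valid_def)
  ultimately show "z \<in> (\<lambda>P. (mk_midx P, mk_midx (exps I - P))) ` {P. P \<le> exps I \<and> P \<noteq> 0 \<and> P \<noteq> exps I}"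
    unfolding z(1) by (intro image_eqI [of _ _ "exps J"]) (simp_all flip: \<open>exps K = _\<close>)
next
  fix z assume "z \<in> (\<lambda>P. (mk_midx P, mk_midx (exps I - P))) ` {P. P \<le> exps I \<and> P \<noteq> 0 \<and> P \<noteq> exps I}"
  then obtain P where P: "P \<le> exps I" "P \<noteq> 0" "P \<noteq> exps I" "z = (mk_midx P, mk_midx (exps I - P))"
    by blast
  have "fst P \<le> fst (exps I)" using P(1) by (simp add: less_eq_prod_def)
  then have "valid P" using P(2) valid_exps [of I] by (auto simp: valid_def)
  then show "z \<in> midx_splits I"
    using P by (simp add: midx_splits_iff valid_diff triple_add_diff)
qed

lemma finite_midx_splits [simp]: "finite (midx_splits I)"
  unfolding midx_splits_triple
  by (rule finite_imageI) (rule finite_subset [OF _ finite_atMost_triple [of "exps I"]], auto)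

text \<open>Turns a sum over proper splittings into a convolution over all \<open>P\<close> below
  the exponent. The two improper splittings contribute nothing: at zero \<open>f\<close> vanishes by
  hypothesis, and at the full exponent the guard on the second factor is false.\<close>

lemma sum_midx_splits:
  assumes "\<And>P. \<not> valid P \<Longrightarrow> f P = 0"
  shows "(\<Sum>(J, K)\<in>midx_splits I. f (exps J) * g (exps K)) =
    (\<Sum>P\<in>{P. P \<le> exps I}. f P * (if valid (exps I - P) then g (exps I - P) else 0 :: 'a::ring_1))"
proof -
  let ?S = "{P. P \<le> exps I \<and> P \<noteq> 0 \<and> P \<noteq> exps I}"
  have v: "valid P" "valid (exps I - P)" if "P \<in> ?S" for P
  proof -
    have "fst P \<le> fst (exps I)" using that by (simp add: less_eq_prod_def)
    then show "valid P" using that valid_exps [of I] by (auto simp: valid_def)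
    show "valid (exps I - P)" using that by (simp add: valid_diff)
  qed
  have "inj_on (\<lambda>P. (mk_midx P, mk_midx (exps I - P))) ?S"
  proof (rule inj_onI)
    fix P Q assume "P \<in> ?S" "Q \<in> ?S"
      and "(mk_midx P, mk_midx (exps I - P)) = (mk_midx Q, mk_midx (exps I - Q))"
    then have "exps (mk_midx P) = exps (mk_midx Q)" by (simp only: prod.inject)
    then show "P = Q" by (simp only: exps_mk v(1) [OF \<open>P \<in> ?S\<close>] v(1) [OF \<open>Q \<in> ?S\<close>])
  qed
  then have "(\<Sum>(J, K)\<in>midx_splits I. f (exps J) * g (exps K)) = (\<Sum>P\<in>?S. f P * g (exps I - P))"
    unfolding midx_splits_triple
    by (subst sum.reindex) (simp_all only: comp_apply case_prod_conv exps_mk v cong: sum.cong)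
  also have "\<dots> = (\<Sum>P\<in>?S. f P * (if valid (exps I - P) then g (exps I - P) else 0))"
    by (intro sum.cong) (simp_all add: v)
  also have "\<dots> = (\<Sum>P\<in>{P. P \<le> exps I}. f P * (if valid (exps I - P) then g (exps I - P) else 0))"
    by (intro sum.mono_neutral_left) (auto simp: assms valid_diff)
  finally show ?thesis .
qed


section \<open>Comultiplication and tensor products of maps\<close>

lemma lookup_comult:
  "Poly_Mapping.lookup (comult x) (J, K) =
    (if valid (exps J + exps K)
     then of_nat (midx_choose (mk_midx (exps J + exps K)) J)
       * Poly_Mapping.lookup x (mk_midx (exps J + exps K)) else 0)"
proof -
  have "Poly_Mapping.lookup (comult x) (J, K) =
      (\<Sum>I\<in>Poly_Mapping.keys x. if (J, K) \<in> midx_splits I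
        then of_nat (midx_choose I J) * Poly_Mapping.lookup x I else 0)"
    unfolding comult_def lookup_sum
  proof (intro sum.cong refl)
    fix I
    have "(\<Sum>z\<in>midx_splits I. Poly_Mapping.lookup (case z of (J, K) \<Rightarrow>
        Poly_Mapping.single (J, K) (of_nat (midx_choose I J) * Poly_Mapping.lookup x I)) (J, K)) =
        (\<Sum>z\<in>midx_splits I. if z = (J, K) then of_nat (midx_choose I J) * Poly_Mapping.lookup x I else 0)"
      by (intro sum.cong) (auto simp: lookup_single when_def split: if_splits)
    then show "(\<Sum>z\<in>midx_splits I. Poly_Mapping.lookup (case z of (J, K) \<Rightarrow>
        Poly_Mapping.single (J, K) (of_nat (midx_choose I J) * Poly_Mapping.lookup x I)) (J, K)) =
        (if (J, K) \<in> midx_splits I then of_nat (midx_choose I J) * Poly_Mapping.lookup x I else 0)"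
      by simp
  qed
  also have "\<dots> = (\<Sum>I\<in>Poly_Mapping.keys x. if I = mk_midx (exps J + exps K)
      then (if valid (exps J + exps K) then of_nat (midx_choose I J) * Poly_Mapping.lookup x I else 0) else 0)"
  proof (intro sum.cong refl)
    fix I
    have "(J, K) \<in> midx_splits I \<longleftrightarrow> valid (exps J + exps K) \<and> I = mk_midx (exps J + exps K)"
      unfolding midx_splits_iff by (metis exps_mk mk_exps valid_exps)
    then show "(if (J, K) \<in> midx_splits I then of_nat (midx_choose I J) * Poly_Mapping.lookup x I else 0) =
      (if I = mk_midx (exps J + exps K)
      then (if valid (exps J + exps K) then of_nat (midx_choose I J) * Poly_Mapping.lookup x I else 0) else 0)"
      by simp
  qed
  also have "\<dots> = (if valid (exps J + exps K)
     then of_nat (midx_choose (mk_midx (exps J + exps K)) J)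
       * Poly_Mapping.lookup x (mk_midx (exps J + exps K)) else 0)"
    by (simp add: not_in_keys_iff_lookup_eq_zero)
  finally show ?thesis .
qed

lemma comult_add: "comult (x + y) = comult x + comult y"
  by (rule poly_mapping_eqI) (auto simp: lookup_comult lookup_add distrib_left split_paired_all)

lemma comult_smul: "comult (smul x a) = smul (comult x) a"
  by (rule poly_mapping_eqI) (auto simp: lookup_comult mult.assoc split_paired_all)

lemma right_linear_comult: "right_linear comult"
  by (simp add: right_linear_def comult_add comult_smul)

lemma comult_single_keys:
  "Poly_Mapping.keys (comult (Poly_Mapping.single I (1::'a::ring_1))) \<subseteq> midx_splits I"
proof
  fix z assume "z \<in> Poly_Mapping.keys (comult (Poly_Mapping.single I (1::'a)))"
  then show "z \<in> midx_splits I"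
    by (cases z) (auto simp: in_keys_iff lookup_comult lookup_single when_def midx_splits_iff
        split: if_splits)
qed

lemma lookup_comult_single:
  assumes "(J, K) \<in> midx_splits I"
  shows "Poly_Mapping.lookup (comult (Poly_Mapping.single I 1)) (J, K) = of_nat (midx_choose I J)"
  using assms by (simp add: lookup_comult midx_splits_iff)

context augmented_local_algebra
begin

lemma lookup_tens:
  "Poly_Mapping.lookup (tens B x y) (P, Q) =
    twist B (midx_parity Q) (Poly_Mapping.lookup x P) * Poly_Mapping.lookup y Q"
proof -
  have "Poly_Mapping.lookup (tens B x y) (P, Q) =
    (\<Sum>P'\<in>Poly_Mapping.keys x. \<Sum>Q'\<in>Poly_Mapping.keys y.
      if Q' = Q then (if P' = P then
        twist B (midx_parity Q) (Poly_Mapping.lookup x P) * Poly_Mapping.lookup y Q else 0) else 0)"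
    unfolding tens_def lookup_sum by (intro sum.cong refl) (auto simp: lookup_single when_def)
  also have "\<dots> = twist B (midx_parity Q) (Poly_Mapping.lookup x P) * Poly_Mapping.lookup y Q"
    by (cases "P \<in> Poly_Mapping.keys x"; cases "Q \<in> Poly_Mapping.keys y")
      (simp_all add: in_keys_iff)
  finally show ?thesis .
qed

lemma lookup_tens_map:
  assumes "finite S" "Poly_Mapping.keys z \<subseteq> S"
  shows "Poly_Mapping.lookup (tens_map B q F G z) (P, Q) =
    (\<Sum>(J, K)\<in>S. twist B (midx_parity Q) (ent F P J) * ent G Q K * ksign (q * midx_parity J)
      * Poly_Mapping.lookup z (J, K))"
proof -
  have "Poly_Mapping.lookup (tens_map B q F G z) (P, Q) =
    (\<Sum>(J, K)\<in>Poly_Mapping.keys z. twist B (midx_parity Q) (ent F P J) * ent G Q K * ksign (q * midx_parity J)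
      * Poly_Mapping.lookup z (J, K))"
    unfolding tens_map_def lookup_sum
    by (intro sum.cong refl) (auto simp: lookup_tens ent_def monom_w_def mult.assoc)
  also have "\<dots> = (\<Sum>(J, K)\<in>S. twist B (midx_parity Q) (ent F P J) * ent G Q K * ksign (q * midx_parity J)
      * Poly_Mapping.lookup z (J, K))"
    using assms by (intro sum.mono_neutral_left) (auto simp: not_in_keys_iff_lookup_eq_zero)
  finally show ?thesis .
qed

lemma right_linear_tens_map: "right_linear (tens_map B q F G)"
  by (rule right_linearI [where A = "\<lambda>(P, Q) (J, K). twist B (midx_parity Q) (ent F P J) * ent G Q K
      * ksign (q * midx_parity J)"])
    (auto simp: lookup_tens_map case_prod_unfold split_paired_all intro!: sum.cong)

lemma ent_tens_map:
  "ent (tens_map B q F G) (P, Q) (J, K) =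
    twist B (midx_parity Q) (ent F P J) * ent G Q K * ksign (q * midx_parity J)"
  unfolding ent_def [of "tens_map B q F G"] using lookup_tens_map [of "{(J, K)}" "Poly_Mapping.single (J, K) 1"]
  by simp

lemma tens_map_keys:
  "Poly_Mapping.keys (tens_map B q F G (Poly_Mapping.single (J, K) 1)) \<subseteq>
    Poly_Mapping.keys (F (Poly_Mapping.single J 1)) \<times> Poly_Mapping.keys (G (Poly_Mapping.single K 1))"
proof
  fix z assume "z \<in> Poly_Mapping.keys (tens_map B q F G (Poly_Mapping.single (J, K) 1))"
  moreover obtain P Q where "z = (P, Q)" by (cases z)
  ultimately show "z \<in> Poly_Mapping.keys (F (Poly_Mapping.single J 1)) \<times>
      Poly_Mapping.keys (G (Poly_Mapping.single K 1))"
    using ent_tens_map [of q F G P Q J K]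
    by (auto simp: in_keys_iff ent_def)
qed

text \<open>The interchange law for tensor products of graded maps. The sign comes from
  \<open>G\<close> passing \<open>F'\<close>, so these are the two maps whose parity is
  prescribed.\<close>

lemma tens_map_comp:
  assumes F: "right_linear F" and G: "right_linear G"
    and pG: "has_parity B q G" and F': "right_linear F'" and pF': "has_parity B p' F'"
  shows "tens_map B q F G (tens_map B q' F' G' z) =
    smul (tens_map B (q + q') (F \<circ> F') (G \<circ> G') z) (ksign (q * p'))"
proof -
  let ?L = "tens_map B q F G \<circ> tens_map B q' F' G'"
  let ?R = "\<lambda>z. smul (tens_map B (q + q') (F \<circ> F') (G \<circ> G') z) (ksign (q * p'))"
  have "?L = ?R"
  proof (rule right_linear_ext)
    show "right_linear ?L" by (intro right_linear_comp right_linear_tens_map)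
    show "right_linear ?R"
      by (auto simp: right_linear_def right_linear_add [OF right_linear_tens_map]
          right_linear_smul [OF right_linear_tens_map] smul_add ksign_commute)
    fix PQ JK :: "midx \<times> midx"
    obtain P Q where PQ: "PQ = (P, Q)" by (cases PQ)
    obtain J K where JK: "JK = (J, K)" by (cases JK)
    let ?A = "Poly_Mapping.keys (F' (Poly_Mapping.single J 1))"
    let ?C = "Poly_Mapping.keys (G' (Poly_Mapping.single K 1))"
    \<comment> \<open>An entry of \<open>G\<close> is moved past an entry of \<open>F'\<close>. The
      sign this produces involves the parity of the intermediate monomial \<open>R\<close> only
      through a factor that cancels against the sign in \<open>tens_map\<close>; hence the double
      sum over \<open>R\<close> and \<open>S\<close> factors.\<close>
    have swap: "twist B (midx_parity Q) (ent F P R) * ent G Q S * ksign (q * midx_parity R)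
        * (twist B (midx_parity S) (ent F' R J) * ent G' S K * ksign (q' * midx_parity J)) =
        twist B (midx_parity Q) (ent F P R * ent F' R J) * (ent G Q S * ent G' S K)
          * ksign ((q + q') * midx_parity J) * ksign (q * p')" for R S
    proof -
      have h: "ent F' R J \<in> homog B (p' + midx_parity J + midx_parity R)"
        and g: "ent G Q S \<in> homog B (q + midx_parity S + midx_parity Q)"
        using pF' pG F' G by (simp_all add: has_parity_iff)
      have "ent G Q S * twist B (midx_parity S) (ent F' R J) =
          twist B (q + midx_parity S + midx_parity Q + midx_parity S) (ent F' R J) * ent G Q S"
        by (subst twist_commute [OF g]) (simp add: twist_twist)
      also have "q + midx_parity S + midx_parity Q + midx_parity S = midx_parity Q + q"
        by (cases q; cases "midx_parity S"; cases "midx_parity Q") simp_all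
      also have "twist B (midx_parity Q + q) (ent F' R J) =
          ksign (q * (p' + midx_parity J + midx_parity R)) * twist B (midx_parity Q) (ent F' R J)"
        by (simp add: twist_homog [OF h] distrib_left distrib_right ksign_add mult.assoc)
          (simp add: ksign_def mult.commute)
      finally have e: "ent G Q S * twist B (midx_parity S) (ent F' R J) =
        ksign (q * (p' + midx_parity J + midx_parity R)) * twist B (midx_parity Q) (ent F' R J) * ent G Q S" .
      have "twist B (midx_parity Q) (ent F P R) * ent G Q S * ksign (q * midx_parity R)
        * (twist B (midx_parity S) (ent F' R J) * ent G' S K * ksign (q' * midx_parity J)) =
        twist B (midx_parity Q) (ent F P R) * (ent G Q S * twist B (midx_parity S) (ent F' R J))
         * ent G' S K * (ksign (q * midx_parity R) * ksign (q' * midx_parity J))"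
        by (cases "q * midx_parity R = 0") (simp_all add: mult.assoc ksign_def)
      also have "\<dots> = twist B (midx_parity Q) (ent F P R) * twist B (midx_parity Q) (ent F' R J)
        * ent G Q S * ent G' S K * (ksign (q * (p' + midx_parity J + midx_parity R))
          * ksign (q * midx_parity R) * ksign (q' * midx_parity J))"
        unfolding e by (cases "q * (p' + midx_parity J + midx_parity R) = 0") (simp_all add: mult.assoc ksign_def)
      also have "ksign (q * (p' + midx_parity J + midx_parity R))
          * ksign (q * midx_parity R) * ksign (q' * midx_parity J) =
          (ksign ((q + q') * midx_parity J) * ksign (q * p') :: 'a)"
        by (cases q; cases q'; cases p'; cases "midx_parity J"; cases "midx_parity R") (simp_all add: ksign_def)
      finally show ?thesis by (simp add: twist_mult mult.assoc)
    qed
    have "ent ?L PQ JK = (\<Sum>(R, S)\<in>?A \<times> ?C. ent (tens_map B q F G) (P, Q) (R, S)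
        * ent (tens_map B q' F' G') (R, S) (J, K))"
      unfolding PQ JK
      by (subst ent_comp [OF right_linear_tens_map, of "?A \<times> ?C"])
        (simp_all add: case_prod_unfold tens_map_keys)
    also have "\<dots> = (\<Sum>(R, S)\<in>?A \<times> ?C. twist B (midx_parity Q) (ent F P R * ent F' R J)
        * (ent G Q S * ent G' S K) * ksign ((q + q') * midx_parity J) * ksign (q * p'))"
      by (intro sum.cong) (auto simp: ent_tens_map swap)
    also have "\<dots> = twist B (midx_parity Q) (\<Sum>R\<in>?A. ent F P R * ent F' R J)
        * (\<Sum>S\<in>?C. ent G Q S * ent G' S K) * ksign ((q + q') * midx_parity J) * ksign (q * p')"
      unfolding twist_sum sum_product sum.cartesian_product
      by (simp add: sum_distrib_right case_prod_unfold)
    also have "\<dots> = ent ?R PQ JK"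
      unfolding PQ JK using ent_tens_map [of "q + q'" "F \<circ> F'" "G \<circ> G'" P Q J K]
        ent_comp [OF F, of ?A F' J P] ent_comp [OF G, of ?C G' K Q]
      by (simp add: ent_def)
    finally show "ent ?L PQ JK = ent ?R PQ JK" .
  qed
  then show ?thesis by (metis comp_apply)
qed

lemma tens_map_id: "tens_map B 0 id id = id"
proof (rule right_linear_ext)
  fix PQ JK :: "midx \<times> midx"
  show "ent (tens_map B 0 id id) PQ JK = ent id PQ JK"
    by (cases PQ; cases JK) (auto simp: ent_tens_map ent_id when_def twist_even homog_zero)
qed (simp_all add: right_linear_tens_map right_linear_id)

text \<open>For odd \<open>D\<close> the operators D (x) 1 and 1 (x) D anticommute by the
  interchange law, so the mixed terms of the square cancel.\<close>

lemma coderivation_square: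
  assumes D: "coderivation B 1 D"
  shows "coderivation B 0 (D \<circ> D)"
proof -
  have lin: "right_linear D" and par: "has_parity B 1 D"
    and der: "\<And>x. comult (D x) = tens_map B 0 D id (comult x) + tens_map B 1 id D (comult x)"
    using D by (simp_all add: coderivation_def)
  note tm = right_linear_add [OF right_linear_tens_map]
  note idp = right_linear_id has_parity_id
  have "comult (D (D x)) = tens_map B 0 (D \<circ> D) id (comult x) + tens_map B 0 id (D \<circ> D) (comult x)" for x
  proof -
    let ?z = "comult x"
    have 1: "tens_map B 0 D id (tens_map B 0 D id ?z) = tens_map B 0 (D \<circ> D) id ?z"
      using tens_map_comp [OF lin idp(1) idp(2) lin par] by simp
    have 2: "tens_map B 0 D id (tens_map B 1 id D ?z) = tens_map B 1 D D ?z"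
      using tens_map_comp [OF lin idp(1) idp(2) idp(1) idp(2)] by simp
    have 3: "tens_map B 1 id D (tens_map B 0 D id ?z) = - tens_map B 1 D D ?z"
      using tens_map_comp [OF idp(1) lin par lin par, of 0 id ?z]
      by (simp add: poly_mapping_eq_iff fun_eq_iff)
    have 4: "tens_map B 1 id D (tens_map B 1 id D ?z) = tens_map B 0 id (D \<circ> D) ?z"
      using tens_map_comp [OF idp(1) lin par idp(1) idp(2), of 1 D ?z] by simp
    show ?thesis unfolding der tm 1 2 3 4 by simp
  qed
  then show ?thesis
    using has_parity_comp [OF par par] by (simp add: coderivation_def right_linear_comp lin)
qed

text \<open>The parity is the point that needs an idea. If y is the part of \<open>inv L x\<close>
  having the parity of x, then x - L y = L (inv L x - y) has both parities at once and is therefore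
  zero.\<close>

lemma coalgebra_aut_inv:
  assumes "coalgebra_aut B L"
  shows "coalgebra_aut B (inv L)"
proof -
  have lin: "right_linear L" and par: "has_parity B 0 L" and bij: "bij L"
    and hom: "\<And>x. comult (L x) = tens_map B 0 L L (comult x)"
    using assms by (simp_all add: coalgebra_aut_def)
  let ?M = "inv L"
  have Linv1 [simp]: "L (?M x) = x" for x using bij by (simp add: bij_is_surj surj_f_inv_f)
  have Linv2 [simp]: "?M (L x) = x" for x using bij by (simp add: bij_is_inj)
  have linM: "right_linear ?M"
    unfolding right_linear_def
  proof (intro conjI allI)
    fix x y a
    have "?M (L (?M x + ?M y)) = ?M x + ?M y" "?M (L (smul (?M x) a)) = smul (?M x) a"
      by (rule Linv2)+
    then show "?M (x + y) = ?M x + ?M y" "?M (smul x a) = smul (?M x) a"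
      by (simp_all add: right_linear_add [OF lin] right_linear_smul [OF lin] del: Linv2)
  qed
  have parM: "has_parity B 0 ?M"
    unfolding has_parity_def
  proof (intro allI ballI)
    fix q x assume x: "x \<in> sym_homog B q"
    have "Poly_Mapping.lookup (?M x) I \<in> homog B (q + midx_parity I)" for I
    proof -
      \<comment> \<open>The parity of a coefficient is that of the vector shifted by that of its
        monomial. The fact \<open>zero\<close> below keeps the support of this component
        finite.\<close>
      define parts where "parts J = (SOME y. y \<in> homog B (q + midx_parity J) \<and>
        Poly_Mapping.lookup (?M x) J - y \<in> homog B (q + midx_parity J + 1))" for J
      have parts: "parts J \<in> homog B (q + midx_parity J) \<and>
        Poly_Mapping.lookup (?M x) J - parts J \<in> homog B (q + midx_parity J + 1)" for J
      proof -
        obtain y0 y1 where y: "y0 \<in> homog B 0" "y1 \<in> homog B 1" "Poly_Mapping.lookup (?M x) J = y0 + y1"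
          by (rule homog_split)
        have "\<exists>y. y \<in> homog B (q + midx_parity J) \<and>
            Poly_Mapping.lookup (?M x) J - y \<in> homog B (q + midx_parity J + 1)"
        proof (cases "q + midx_parity J = 0")
          case True
          then show ?thesis using y by (intro exI [of _ y0]) simp
        next
          case False
          then show ?thesis using y by (intro exI [of _ y1]) simp
        qed
        then show ?thesis unfolding parts_def by (rule someI_ex)
      qed
      have zero: "Poly_Mapping.lookup (?M x) J = 0 \<Longrightarrow> parts J = 0" for J
      proof -
        assume "Poly_Mapping.lookup (?M x) J = 0"
        then have "parts J \<in> homog B (q + midx_parity J)" "parts J \<in> homog B (q + midx_parity J + 1)"
          using parts [of J] homog_uminus [of "- parts J"] by auto
        then show ?thesis using homog_disjoint [of "parts J"] by (cases "q + midx_parity J") simp_all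
      qed
      have fin: "finite {J. parts J \<noteq> 0}"
        by (rule finite_subset [OF _ finite_keys [of "?M x"]]) (auto simp: in_keys_iff zero)
      define y where "y = Abs_poly_mapping parts"
      have y: "Poly_Mapping.lookup y J = parts J" for J
        using fin by (simp add: y_def lookup_Abs_poly_mapping)
      have "L y \<in> sym_homog B q" "L (?M x - y) \<in> sym_homog B (q + 1)"
      proof -
        have "y \<in> sym_homog B q" using parts by (simp add: sym_homog_def y)
        then show "L y \<in> sym_homog B q" using has_parityD [OF par] by simp
        have "?M x - y \<in> sym_homog B (q + 1)"
          using parts by (simp add: sym_homog_def y lookup_minus add.assoc add.commute [of 1])
        then show "L (?M x - y) \<in> sym_homog B (q + 1)" using has_parityD [OF par] by simp
      qed
      moreover have d: "L (?M x - y) = x - L y"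
        using right_linear_add [OF lin, of "?M x - y" y] by (simp add: eq_diff_eq)
      ultimately have "Poly_Mapping.lookup (x - L y) J \<in> homog B (q + midx_parity J)"
        "Poly_Mapping.lookup (x - L y) J \<in> homog B (q + midx_parity J + 1)" for J
        using x unfolding sym_homog_def
        by (simp_all add: lookup_minus homog_diff add.assoc add.commute [of _ 1])
      then have "Poly_Mapping.lookup (x - L y) J = 0" for J
        using homog_disjoint [of "Poly_Mapping.lookup (x - L y) J"]
        by (cases "q + midx_parity J") (metis add_0 bit_add_self add.right_neutral)+
      then have "x - L y = 0" by (intro poly_mapping_eqI) simp
      then have "?M x = y" using Linv2 [of y] by simp
      then show ?thesis using y parts by simp
    qed
    then show "?M x \<in> sym_homog B (0 + q)" by (simp add: sym_homog_def)
  qed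
  have "comult (?M x) = tens_map B 0 ?M ?M (comult x)" for x
  proof -
    have "tens_map B 0 ?M ?M (comult x) = tens_map B 0 ?M ?M (tens_map B 0 L L (comult (?M x)))"
      by (simp flip: hom)
    also have "\<dots> = tens_map B 0 (?M \<circ> L) (?M \<circ> L) (comult (?M x))"
      using tens_map_comp [OF linM linM parM lin par, of 0 L] by simp
    also have "\<dots> = comult (?M x)"
    proof -
      have "?M \<circ> L = id" by (simp add: fun_eq_iff)
      then show ?thesis by (simp only: tens_map_id id_apply)
    qed
    finally show ?thesis ..
  qed
  then show ?thesis
    using linM parM bij by (simp add: coalgebra_aut_def bij_imp_bij_inv)
qed

lemma coderivation_conj:
  assumes L: "coalgebra_aut B L" and D: "coderivation B p D"
  shows "coderivation B p (L \<circ> D \<circ> inv L)"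
proof -
  have lin: "right_linear L" and par: "has_parity B 0 L" and bij: "bij L"
    and hom: "\<And>x. comult (L x) = tens_map B 0 L L (comult x)"
    using L by (simp_all add: coalgebra_aut_def)
  let ?M = "inv L"
  have M: "right_linear ?M" "has_parity B 0 ?M" "\<And>x. comult (?M x) = tens_map B 0 ?M ?M (comult x)"
    using coalgebra_aut_inv [OF L] by (simp_all add: coalgebra_aut_def)
  have dl: "right_linear D" and dp: "has_parity B p D"
    and der: "\<And>x. comult (D x) = tens_map B 0 D id (comult x) + tens_map B p id D (comult x)"
    using D by (simp_all add: coderivation_def)
  have LM: "L \<circ> ?M = id" using bij by (auto simp: bij_is_surj surj_f_inv_f)
  have "comult ((L \<circ> D \<circ> ?M) x) =
      tens_map B 0 (L \<circ> D \<circ> ?M) id (comult x) + tens_map B p id (L \<circ> D \<circ> ?M) (comult x)" for x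
  proof -
    let ?z = "comult x"
    have "comult ((L \<circ> D \<circ> ?M) x) =
      tens_map B 0 L L (tens_map B 0 D id (tens_map B 0 ?M ?M ?z)) +
      tens_map B 0 L L (tens_map B p id D (tens_map B 0 ?M ?M ?z))"
      by (simp add: hom der M right_linear_add [OF right_linear_tens_map])
    also have "tens_map B 0 L L (tens_map B 0 D id (tens_map B 0 ?M ?M ?z)) =
        tens_map B 0 (L \<circ> D \<circ> ?M) (L \<circ> ?M) ?z"
      using tens_map_comp [OF dl right_linear_id has_parity_id M(1) M(2), of 0 ?M ?z]
        tens_map_comp [OF lin lin par right_linear_comp [OF dl M(1)] has_parity_comp [OF dp M(2)], of 0 ?M ?z]
      by (simp add: comp_assoc)
    also have "tens_map B 0 L L (tens_map B p id D (tens_map B 0 ?M ?M ?z)) =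
        tens_map B p (L \<circ> ?M) (L \<circ> D \<circ> ?M) ?z"
      using tens_map_comp [OF right_linear_id dl dp M(1) M(2), of 0 ?M ?z]
        tens_map_comp [OF lin lin par M(1) M(2), of p "D \<circ> ?M" ?z]
      by (simp add: comp_assoc)
    finally show ?thesis unfolding LM .
  qed
  then show ?thesis
    using has_parity_comp [OF has_parity_comp [OF par dp] M(2)]
    unfolding coderivation_def by (simp add: right_linear_comp lin dl M)
qed

end


section \<open>Matrix entries in the dual monomial basis\<close>

context augmented_local_algebra
begin

lemma scal_left_commute: "scal B z * (x * y) = x * (scal B z * y)"
  by (metis mult.assoc scal_commute)

text \<open>
  The normalisation by factorials turns the comultiplication into the dual of the
  multiplication of monomials, so that the row \<open>dcf F P\<close> is the power series \<open>x\<^bsup>P\<^esup> \<circ> F\<close>.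
\<close>

definition dcf :: "('a sym \<Rightarrow> 'a sym) \<Rightarrow> nat \<times> nat \<times> nat \<Rightarrow> nat \<times> nat \<times> nat \<Rightarrow> 'a" where
  "dcf F P I = (if valid P \<and> valid I
     then scal B (of_nat (tfact P) / of_nat (tfact I)) * ent F (mk_midx P) (mk_midx I) else 0)"

lemma dcf_invalid [simp]: "\<not> valid P \<Longrightarrow> dcf F P I = 0" "\<not> valid I \<Longrightarrow> dcf F P I = 0"
  by (simp_all add: dcf_def)

lemma ent_dcf: "ent F J I = scal B (of_nat (tfact (exps I)) / of_nat (tfact (exps J))) * dcf F (exps J) (exps I)"
  by (simp add: dcf_def mult.assoc [symmetric] scal_mult [symmetric] scal_one)

lemma dcf_ext:
  assumes "right_linear F" "right_linear G"
    and "\<And>P I. valid P \<Longrightarrow> valid I \<Longrightarrow> dcf F P I = dcf G P I"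
  shows "F = G"
  by (rule right_linear_ext) (simp_all add: assms ent_dcf)

lemma dcf_parity_iff:
  assumes "right_linear F"
  shows "has_parity B p F \<longleftrightarrow>
    (\<forall>P I. valid P \<longrightarrow> valid I \<longrightarrow> dcf F P I \<in> homog B (p + tpar P + tpar I))"
proof
  assume "has_parity B p F"
  then have h: "ent F J I \<in> homog B (p + midx_parity I + midx_parity J)" for I J
    using assms by (simp add: has_parity_iff)
  show "\<forall>P I. valid P \<longrightarrow> valid I \<longrightarrow> dcf F P I \<in> homog B (p + tpar P + tpar I)"
  proof (intro allI impI)
    fix P I assume "valid P" "valid I"
    then show "dcf F P I \<in> homog B (p + tpar P + tpar I)"
      using homog_mult [OF scal_even h, of _ "mk_midx P" "mk_midx I"]
      by (simp add: dcf_def add.assoc add.commute [of "tpar P"])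
  qed
next
  assume h: "\<forall>P I. valid P \<longrightarrow> valid I \<longrightarrow> dcf F P I \<in> homog B (p + tpar P + tpar I)"
  have "ent F J I \<in> homog B (p + midx_parity I + midx_parity J)" for I J
    using homog_mult [OF scal_even h [rule_format], of "exps J" "exps I"]
    by (simp add: ent_dcf midx_parity_tpar add.assoc add.commute [of "tpar (exps J)"])
  then show "has_parity B p F" using assms by (simp add: has_parity_iff)
qed

lemma dcf_homog:
  assumes "right_linear F" "has_parity B p F"
  shows "dcf F P I \<in> homog B (p + tpar P + tpar I)"
proof (cases "valid P \<and> valid I")
  case True
  then show ?thesis using assms dcf_parity_iff by blast
next
  case False
  then show ?thesis by (auto simp: homog_zero)
qed

lemma dcf_id: "dcf id P I = (if P = I \<and> valid P then 1 else 0)"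
proof (cases "valid P \<and> valid I")
  case True
  then have "mk_midx I = mk_midx P \<longleftrightarrow> I = P" by (metis exps_mk)
  then show ?thesis using True by (auto simp: dcf_def ent_id scal_one when_def)
next
  case False
  then show ?thesis by auto
qed

lemma dcf_comp:
  assumes E: "right_linear E" and "finite S"
    and S: "\<And>J. valid J \<Longrightarrow> dcf E P J * dcf D J I \<noteq> 0 \<Longrightarrow> J \<in> S"
  shows "dcf (E \<circ> D) P I = (\<Sum>J\<in>S. dcf E P J * dcf D J I)"
proof (cases "valid P \<and> valid I")
  case True
  let ?K = "Poly_Mapping.keys (D (Poly_Mapping.single (mk_midx I) 1))"
  have "dcf (E \<circ> D) P I =
      scal B (of_nat (tfact P) / of_nat (tfact I)) * (\<Sum>K\<in>?K. ent E (mk_midx P) K * ent D K (mk_midx I))"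
    using True by (simp add: dcf_def ent_comp [OF E, of ?K])
  also have "\<dots> = (\<Sum>K\<in>?K. dcf E P (exps K) * dcf D (exps K) I)"
    unfolding sum_distrib_left
  proof (intro sum.cong refl)
    fix K
    have "scal B (of_nat (tfact P) / of_nat (tfact I)) =
        scal B (of_nat (tfact P) / of_nat (tfact (exps K))) * scal B (of_nat (tfact (exps K)) / of_nat (tfact I))"
      by (simp flip: scal_mult)
    then show "scal B (of_nat (tfact P) / of_nat (tfact I)) * (ent E (mk_midx P) K * ent D K (mk_midx I)) =
        dcf E P (exps K) * dcf D (exps K) I"
      using True scal_left_commute [of "of_nat (tfact (exps K)) / of_nat (tfact I)" "ent E (mk_midx P) K"]
      by (simp add: dcf_def mult.assoc)
  qed
  also have "\<dots> = (\<Sum>J\<in>exps ` ?K. dcf E P J * dcf D J I)"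
    by (subst sum.reindex) (auto simp: inj_on_def exps_inject)
  also have "\<dots> = (\<Sum>J\<in>exps ` ?K \<union> S. dcf E P J * dcf D J I)"
  proof (intro sum.mono_neutral_left ballI)
    fix J assume J: "J \<in> exps ` ?K \<union> S - exps ` ?K"
    show "dcf E P J * dcf D J I = 0"
    proof (cases "valid J")
      case True
      then have "mk_midx J \<notin> ?K" using J by (metis DiffD2 exps_mk imageI)
      then have "ent D (mk_midx J) (mk_midx I) = 0" by (simp add: ent_def in_keys_iff)
      then show ?thesis by (simp add: dcf_def)
    qed simp
  qed (use \<open>finite S\<close> in auto)
  also have "\<dots> = (\<Sum>J\<in>S. dcf E P J * dcf D J I)"
  proof (intro sum.mono_neutral_right ballI)
    fix J assume "J \<in> exps ` ?K \<union> S - S"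
    then have "valid J" "J \<notin> S" by auto
    then show "dcf E P J * dcf D J I = 0" using S by blast
  qed (use \<open>finite S\<close> in auto)
  finally show ?thesis .
next
  case False
  then show ?thesis by auto
qed

definition of_dcf :: "(nat \<times> nat \<times> nat \<Rightarrow> nat \<times> nat \<times> nat \<Rightarrow> 'a) \<Rightarrow> 'a sym \<Rightarrow> 'a sym" where
  "of_dcf A = mat_map (\<lambda>J I. scal B (of_nat (tfact (exps I)) / of_nat (tfact (exps J))) * A (exps J) (exps I))"

lemma
  assumes "\<And>I. valid I \<Longrightarrow> finite {P. valid P \<and> A P I \<noteq> 0}"
  shows right_linear_of_dcf: "right_linear (of_dcf A)"
    and dcf_of_dcf: "valid P \<Longrightarrow> valid I \<Longrightarrow> dcf (of_dcf A) P I = A P I"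
proof -
  let ?A = "\<lambda>J I. scal B (of_nat (tfact (exps I)) / of_nat (tfact (exps J))) * A (exps J) (exps I)"
  have fin: "finite {J. ?A J I \<noteq> 0}" for I
  proof (rule finite_subset)
    show "{J. ?A J I \<noteq> 0} \<subseteq> mk_midx ` {P. valid P \<and> A P (exps I) \<noteq> 0}"
    proof
      fix J assume "J \<in> {J. ?A J I \<noteq> 0}"
      then show "J \<in> mk_midx ` {P. valid P \<and> A P (exps I) \<noteq> 0}"
        by (intro image_eqI [of _ _ "exps J"]) auto
    qed
    show "finite (mk_midx ` {P. valid P \<and> A P (exps I) \<noteq> 0})"
      using assms [OF valid_exps] by simp
  qed
  show "right_linear (of_dcf A)"
    unfolding of_dcf_def by (rule right_linear_mat_map) (rule fin)
  show "dcf (of_dcf A) P I = A P I" if "valid P" "valid I"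
    using that ent_mat_map [of ?A "mk_midx P" "mk_midx I", OF fin]
    by (simp add: dcf_def of_dcf_def mult.assoc [symmetric] scal_mult [symmetric] scal_one)
qed

text \<open>The binomial coefficient (P+Q)! / (P! Q!) in the comultiplication is exactly what the
  factorial normalisation removes, so comultiplying just adds row indices. If \<open>P + Q\<close>
  contains the odd coordinate twice, both sides are zero.\<close>

lemma dcf_comult:
  assumes "valid P" "valid Q" "valid I"
  shows "scal B (of_nat (tfact P) * of_nat (tfact Q) / of_nat (tfact I))
    * ent (comult \<circ> D) (mk_midx P, mk_midx Q) (mk_midx I) = dcf D (P + Q) I"
proof (cases "valid (P + Q)")
  case True
  have "of_nat (midx_choose (mk_midx (P + Q)) (mk_midx P)) =
      scal B (of_nat (tfact (P + Q)) / (of_nat (tfact P) * of_nat (tfact Q)))"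
    using midx_choose_fact [of "mk_midx P" "mk_midx Q" "mk_midx (P + Q)"] assms True
    by (simp flip: scal_of_nat)
  then show ?thesis
    using assms True by (simp add: ent_def lookup_comult dcf_def mult.assoc [symmetric] scal_mult [symmetric])
next
  case False
  then show ?thesis using assms by (simp add: ent_def lookup_comult)
qed

lemma dcf_tens_map:
  assumes "valid P" "valid Q" "valid I"
  shows "scal B (of_nat (tfact P) * of_nat (tfact Q) / of_nat (tfact I))
    * ent (tens_map B q F G \<circ> comult) (mk_midx P, mk_midx Q) (mk_midx I) =
    (\<Sum>J\<in>{J. J \<le> I}. twist B (tpar Q) (dcf F P J) * ksign (q * tpar J) * dcf G Q (I - J))"
proof -
  let ?c = "scal B (of_nat (tfact P) * of_nat (tfact Q) / of_nat (tfact I))"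
  let ?I = "mk_midx I"
  let ?f = "\<lambda>J. twist B (tpar Q) (dcf F P J) * ksign (q * tpar J)"
  have "?c * ent (tens_map B q F G \<circ> comult) (mk_midx P, mk_midx Q) ?I =
    (\<Sum>(J, K)\<in>midx_splits ?I. ?c * (twist B (tpar Q) (ent F (mk_midx P) J) * ent G (mk_midx Q) K
      * ksign (q * midx_parity J) * of_nat (midx_choose ?I J)))"
    using assms
    by (subst ent_comp [OF right_linear_tens_map, of "midx_splits ?I"])
      (auto dest: subsetD [OF comult_single_keys] simp: sum_distrib_left ent_tens_map ent_def [of comult] lookup_comult_single intro!: sum.cong)
  also have "\<dots> = (\<Sum>(J, K)\<in>midx_splits ?I. ?f (exps J) * dcf G Q (exps K))"
  proof (intro sum.cong refl, clarify)
    fix J K assume "(J, K) \<in> midx_splits ?I"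
    then have JK: "exps J + exps K = exps ?I" by (simp add: midx_splits_iff)
    let ?a = "twist B (tpar Q) (ent F (mk_midx P) J)" and ?b = "ent G (mk_midx Q) K"
    let ?s = "ksign (q * midx_parity J) :: 'a"
    let ?u = "scal B (of_nat (tfact P) / of_nat (tfact (exps J)))"
    let ?v = "scal B (of_nat (tfact Q) / of_nat (tfact (exps K)))"
    have "of_nat (midx_choose ?I J) =
        scal B (of_nat (tfact I) / (of_nat (tfact (exps J)) * of_nat (tfact (exps K))))"
      using midx_choose_fact [OF JK] assms by (simp flip: scal_of_nat)
    then have c: "?c * of_nat (midx_choose ?I J) = ?u * ?v"
      by (simp add: scal_mult [symmetric])
    have "?c * (?a * ?b * ?s * of_nat (midx_choose ?I J)) = (?c * of_nat (midx_choose ?I J)) * (?a * ?b * ?s)"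
      by (simp only: mult.assoc mult_of_nat_commute [of _ "?a * (?b * ?s)", simplified mult.assoc])
    also have "\<dots> = (?u * ?a) * (?v * (?b * ?s))"
      unfolding c mult.assoc by (subst scal_left_commute [of _ ?a]) (rule refl)
    also have "\<dots> = (?u * ?a) * ?s * (?v * ?b)"
      using ksign_commute [of "q * midx_parity J" "?v * ?b"] by (simp only: mult.assoc)
    also have "?u * ?a = twist B (tpar Q) (?u * ent F (mk_midx P) J)"
      by (simp add: twist_mult twist_even scal_even)
    finally show "?c * (?a * ?b * ?s * of_nat (midx_choose ?I J)) = ?f (exps J) * dcf G Q (exps K)"
      using assms by (simp add: dcf_def midx_parity_tpar)
  qed
  also have "\<dots> = (\<Sum>J\<in>{J. J \<le> exps ?I}. ?f J
      * (if valid (exps ?I - J) then dcf G Q (exps ?I - J) else 0))"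
    by (rule sum_midx_splits) simp
  also have "\<dots> = (\<Sum>J\<in>{J. J \<le> I}. ?f J * dcf G Q (I - J))"
    using assms by (intro sum.cong) auto
  finally show ?thesis .
qed

text \<open>Entries may be compared after multiplication by a nonzero scalar, here the one for which
  \<open>dcf_comult\<close> and \<open>dcf_tens_map\<close> become free of factorials.\<close>

lemma comult_eq_iff:
  assumes "right_linear F" "right_linear G"
  shows "(\<forall>x. comult (F x) = G (comult x)) \<longleftrightarrow>
    (\<forall>P Q I. valid P \<longrightarrow> valid Q \<longrightarrow> valid I \<longrightarrow>
      dcf F (P + Q) I = scal B (of_nat (tfact P) * of_nat (tfact Q) / of_nat (tfact I))
        * ent (G \<circ> comult) (mk_midx P, mk_midx Q) (mk_midx I))" (is "?l \<longleftrightarrow> ?r")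
proof
  assume ?l
  then have "comult \<circ> F = G \<circ> comult" by auto
  then show ?r by (simp add: dcf_comult [symmetric])
next
  assume r: ?r
  have "comult \<circ> F = G \<circ> comult"
  proof (rule right_linear_ext)
    fix PQ :: "midx \<times> midx" and I :: midx
    obtain P Q where PQ: "PQ = (P, Q)" by (cases PQ)
    have "scal B (of_nat (tfact (exps P)) * of_nat (tfact (exps Q)) / of_nat (tfact (exps I)))
        * ent (comult \<circ> F) (P, Q) I =
      scal B (of_nat (tfact (exps P)) * of_nat (tfact (exps Q)) / of_nat (tfact (exps I)))
        * ent (G \<circ> comult) (P, Q) I"
      using dcf_comult [of "exps P" "exps Q" "exps I" F] r by simp
    then show "ent (comult \<circ> F) PQ I = ent (G \<circ> comult) PQ I"
      unfolding PQ by (subst (asm) scal_cancel) simp_all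
  qed (intro right_linear_comp right_linear_comult assms)+
  then show ?l by (metis comp_apply)
qed

text \<open>Dually this is the Leibniz rule for the functions x^P and x^Q: shifting the column by
  \<open>Q\<close> is multiplication by x^Q, \<open>twist\<close> moves the coefficient past x^Q,
  and \<open>ksign\<close> moves the derivation past x^P.\<close>

lemma coderivation_iff:
  "coderivation B p D \<longleftrightarrow> right_linear D \<and> has_parity B p D \<and>
    (\<forall>P Q I. valid P \<longrightarrow> valid Q \<longrightarrow> valid I \<longrightarrow>
      dcf D (P + Q) I = (if Q \<le> I then twist B (tpar Q) (dcf D P (I - Q)) else 0)
        + (if P \<le> I then ksign (p * tpar P) * dcf D Q (I - P) else 0))"
proof (cases "right_linear D")
  case True
  let ?G = "\<lambda>x. tens_map B 0 D id x + tens_map B p id D x"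
  have G: "right_linear ?G"
    by (auto simp: right_linear_def right_linear_add [OF right_linear_tens_map]
        right_linear_smul [OF right_linear_tens_map] smul_add)
  have "scal B (of_nat (tfact P) * of_nat (tfact Q) / of_nat (tfact I))
        * ent (?G \<circ> comult) (mk_midx P, mk_midx Q) (mk_midx I) =
      (if Q \<le> I then twist B (tpar Q) (dcf D P (I - Q)) else 0)
        + (if P \<le> I then ksign (p * tpar P) * dcf D Q (I - P) else 0)"
    if v: "valid P" "valid Q" "valid I" for P Q I
  proof -
    have "(\<Sum>J\<in>{J. J \<le> I}. twist B (tpar Q) (dcf D P J) * ksign (0 * tpar J) * dcf id Q (I - J)) =
      (\<Sum>J\<in>{J. J \<le> I}. if J = I - Q then (if Q \<le> I then twist B (tpar Q) (dcf D P (I - Q)) else 0) else 0)"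
    proof (intro sum.cong refl)
      fix J assume "J \<in> {J. J \<le> I}"
      then have "Q = I - J \<longleftrightarrow> J = I - Q \<and> Q \<le> I"
        by (cases J; cases I; cases Q) auto
      then show "twist B (tpar Q) (dcf D P J) * ksign (0 * tpar J) * dcf id Q (I - J) =
          (if J = I - Q then (if Q \<le> I then twist B (tpar Q) (dcf D P (I - Q)) else 0) else 0)"
        using v by (auto simp: dcf_id)
    qed
    also have "\<dots> = (if Q \<le> I then twist B (tpar Q) (dcf D P (I - Q)) else 0)"
      by (cases I; cases Q) (simp add: sum.delta')
    finally have 1: "(\<Sum>J\<in>{J. J \<le> I}. twist B (tpar Q) (dcf D P J) * ksign (0 * tpar J) * dcf id Q (I - J)) =
      (if Q \<le> I then twist B (tpar Q) (dcf D P (I - Q)) else 0)" .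
    have "(\<Sum>J\<in>{J. J \<le> I}. twist B (tpar Q) (dcf id P J) * ksign (p * tpar J) * dcf D Q (I - J)) =
      (\<Sum>J\<in>{J. J \<le> I}. if J = P then ksign (p * tpar P) * dcf D Q (I - P) else 0)"
      using v by (intro sum.cong) (auto simp: dcf_id twist_even)
    also have "\<dots> = (if P \<le> I then ksign (p * tpar P) * dcf D Q (I - P) else 0)"
      by simp
    finally have 2: "(\<Sum>J\<in>{J. J \<le> I}. twist B (tpar Q) (dcf id P J) * ksign (p * tpar J) * dcf D Q (I - J)) =
      (if P \<le> I then ksign (p * tpar P) * dcf D Q (I - P) else 0)" .
    have "ent (?G \<circ> comult) (mk_midx P, mk_midx Q) (mk_midx I) =
       ent (tens_map B 0 D id \<circ> comult) (mk_midx P, mk_midx Q) (mk_midx I) +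
       ent (tens_map B p id D \<circ> comult) (mk_midx P, mk_midx Q) (mk_midx I)"
      by (simp add: ent_def lookup_add)
    then show ?thesis
      unfolding 1 [symmetric] 2 [symmetric] dcf_tens_map [OF v, symmetric] by (simp add: distrib_left)
  qed
  then show ?thesis
    using comult_eq_iff [OF True G] True by (simp add: coderivation_def)
next
  case False
  then show ?thesis by (simp add: coderivation_def)
qed

text \<open>Dually, pulling back along a coalgebra morphism is multiplicative: the row at
  \<open>P + Q\<close> is the product of the rows at \<open>P\<close> and \<open>Q\<close>, with
  Koszul signs.\<close>

lemma comultiplicative_iff:
  assumes "right_linear L"
  shows "(\<forall>x. comult (L x) = tens_map B 0 L L (comult x)) \<longleftrightarrow>
    (\<forall>P Q I. valid P \<longrightarrow> valid Q \<longrightarrow> valid I \<longrightarrow>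
      dcf L (P + Q) I = (\<Sum>J\<in>{J. J \<le> I}. twist B (tpar Q) (dcf L P J) * dcf L Q (I - J)))"
  using comult_eq_iff [OF assms right_linear_tens_map, of 0 L L] by (simp add: dcf_tens_map)

end


section \<open>Power series in two commuting variables\<close>

unbundle fps_syntax

text \<open>The inner variable is x and the outer one is y, so \<open>f $ j $ i\<close> is the
  coefficient of x^i y^j: the exponents are read in reverse order. The variables commute with the
  coefficients, which need not commute with each other.\<close>

definition mon :: "nat \<Rightarrow> nat \<Rightarrow> 'a::ring_1 fps fps" where
  "mon a b = fps_const (fps_X ^ a) * fps_X ^ b"

lemma mon_mult_nth:
  "(mon a b * f) $ j $ i = (if a \<le> i \<and> b \<le> j then f $ (j - b) $ (i - a) else (0::'a::ring_1))"
  by (auto simp: mon_def mult.assoc fps_X_power_mult_nth)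

lemma mult_mon_nth:
  "(f * mon a b) $ j $ i = (if a \<le> i \<and> b \<le> j then f $ (j - b) $ (i - a) else (0::'a::ring_1))"
  by (auto simp: mon_def mult.assoc [symmetric] fps_X_power_mult_right_nth)

lemma mon_0_0 [simp]: "mon 0 0 = (1 :: 'a::ring_1 fps fps)"
  by (simp add: mon_def)

lemma mon_nth: "mon a b $ j $ i = (if i = a \<and> j = b then 1 else (0::'a::ring_1))"
  using mon_mult_nth [of a b 1 j i] by (auto simp: fps_one_nth)

lemma mon_mult: "mon a b * mon c d = (mon (a + c) (b + d) :: 'a::ring_1 fps fps)"
  by (intro fps_ext) (auto simp: mon_mult_nth mon_nth)

lemma mult_nth_nth:
  "(f * g) $ j $ i = (\<Sum>b\<le>j. \<Sum>a\<le>i. f $ b $ a * g $ (j - b) $ (i - a) :: 'a::ring_1)"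
  by (simp add: fps_mult_nth fps_sum_nth atMost_atLeast0)

definition dx :: "'a::ring_1 fps fps \<Rightarrow> 'a fps fps" where
  "dx f = Abs_fps (\<lambda>j. fps_deriv (f $ j))"

abbreviation dy :: "'a::ring_1 fps fps \<Rightarrow> 'a fps fps" where
  "dy \<equiv> fps_deriv"

lemma dx_nth [simp]: "dx f $ j = fps_deriv (f $ j)"
  by (simp add: dx_def)

lemma dx_add: "dx (f + g) = dx f + dx g"
  and dx_diff: "dx (f - g) = dx f - dx g"
  by (simp_all add: fps_eq_iff algebra_simps)

lemma dx_mult: "dx (f * g) = f * dx g + dx f * (g :: 'a::ring_1 fps fps)"
  by (intro fps_ext) (simp add: fps_mult_nth fps_deriv_sum sum.distrib fps_sum_nth del: fps_deriv_nth)

text \<open>The partial derivatives of \<open>mon m n\<close> in closed form. The numerical factor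
  neutralises the truncated exponent when \<open>m\<close> is zero.\<close>

definition monx :: "nat \<Rightarrow> nat \<Rightarrow> 'a::ring_1 fps fps" where
  "monx m n = of_nat m * mon (m - 1) n"

definition mony :: "nat \<Rightarrow> nat \<Rightarrow> 'a::ring_1 fps fps" where
  "mony m n = of_nat n * mon m (n - 1)"

lemma mult_of_nat_left_commute: "x * (of_nat k * y) = of_nat k * x * (y :: 'a::ring_1)"
  by (metis mult.assoc mult_of_nat_commute)

lemma monx_add: "monx (m + m') (n + n') = mon m' n' * monx m n + (mon m n * monx m' n' :: 'a::ring_1 fps fps)"
proof -
  have "mon m' n' * monx m n = (of_nat m * mon (m + m' - 1) (n + n') :: 'a fps fps)"
    by (cases m) (simp_all add: monx_def mult_of_nat_left_commute mult.assoc mon_mult add.commute del: of_nat_Suc)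
  moreover have "mon m n * monx m' n' = (of_nat m' * mon (m + m' - 1) (n + n') :: 'a fps fps)"
    by (cases m') (simp_all add: monx_def mult_of_nat_left_commute mult.assoc mon_mult del: of_nat_Suc)
  ultimately show ?thesis by (simp add: monx_def distrib_right)
qed

lemma mony_add: "mony (m + m') (n + n') = mon m' n' * mony m n + (mon m n * mony m' n' :: 'a::ring_1 fps fps)"
proof -
  have "mon m' n' * mony m n = (of_nat n * mon (m + m') (n + n' - 1) :: 'a fps fps)"
    by (cases n) (simp_all add: mony_def mult_of_nat_left_commute mult.assoc mon_mult add.commute del: of_nat_Suc)
  moreover have "mon m n * mony m' n' = (of_nat n' * mon (m + m') (n + n' - 1) :: 'a fps fps)"
    by (cases n') (simp_all add: mony_def mult_of_nat_left_commute mult.assoc mon_mult del: of_nat_Suc)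
  ultimately show ?thesis by (simp add: mony_def distrib_right)
qed

lemma of_nat_fps_mult_nth: "(of_nat k * f) $ n = of_nat k * (f $ n :: 'a::ring_1)"
  by (induction k) (simp_all add: distrib_right)

lemma monx_mult_nth: "(monx m n * f) $ j $ i = of_nat m * (mon (m - 1) n * f) $ j $ i"
  and mony_mult_nth: "(mony m n * f) $ j $ i = of_nat n * (mon m (n - 1) * f) $ j $ i"
  by (simp_all add: monx_def mony_def mult.assoc of_nat_fps_mult_nth)

text \<open>Expands \<open>f\<close> into monomials, looked at in one coefficient. Only exponents
  that can reach x^i y^j contribute, so a finite sum replaces any notion of convergence.\<close>

lemma sum_mon_nth:
  fixes f g :: "'a::ring_1 fps fps"
  assumes "i \<le> M" "j \<le> N"
  shows "(\<Sum>m\<le>M. \<Sum>n\<le>N. f $ n $ m * (mon m n * g) $ j $ i) = (f * g) $ j $ i"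
proof -
  have "(\<Sum>m\<le>M. \<Sum>n\<le>N. f $ n $ m * (mon m n * g) $ j $ i) =
      (\<Sum>m\<le>i. \<Sum>n\<le>N. f $ n $ m * (mon m n * g) $ j $ i)"
    using assms by (intro sum.mono_neutral_right) (auto simp: mon_mult_nth)
  also have "\<dots> = (\<Sum>m\<le>i. \<Sum>n\<le>j. f $ n $ m * (mon m n * g) $ j $ i)"
    using assms by (intro sum.cong refl sum.mono_neutral_right) (auto simp: mon_mult_nth)
  also have "\<dots> = (\<Sum>m\<le>i. \<Sum>n\<le>j. f $ n $ m * g $ (j - n) $ (i - m))"
    by (intro sum.cong) (auto simp: mon_mult_nth)
  also have "\<dots> = (f * g) $ j $ i"
    unfolding mult_nth_nth by (rule sum.swap)
  finally show ?thesis .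
qed

text \<open>The bound is strict in the first exponent because differentiation lowers it: the term
  x^(i+1) of \<open>f\<close> contributes to x^i.\<close>

lemma sum_monx_nth:
  fixes f g :: "'a::ring_1 fps fps"
  assumes "i < M" "j \<le> N"
  shows "(\<Sum>m\<le>M. \<Sum>n\<le>N. f $ n $ m * (monx m n * g) $ j $ i) = (dx f * g) $ j $ i"
proof -
  obtain M' where M: "M = Suc M'" using assms(1) by (cases M) auto
  have "(\<Sum>m\<le>M. \<Sum>n\<le>N. f $ n $ m * (monx m n * g) $ j $ i) =
      (\<Sum>m\<le>M'. \<Sum>n\<le>N. dx f $ n $ m * (mon m n * g) $ j $ i)"
  proof -
    have "f $ n $ Suc m * (monx (Suc m) n * g) $ j $ i = dx f $ n $ m * (mon m n * g) $ j $ i" for m n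
      unfolding monx_mult_nth mult_of_nat_left_commute by (simp del: of_nat_Suc)
    moreover have "(monx 0 n * g) $ j $ i = 0" for n
      unfolding monx_mult_nth by simp
    ultimately show ?thesis unfolding M sum.atMost_Suc_shift by simp
  qed
  also have "\<dots> = (dx f * g) $ j $ i"
    using assms M by (intro sum_mon_nth) auto
  finally show ?thesis .
qed

lemma sum_mony_nth:
  fixes f g :: "'a::ring_1 fps fps"
  assumes "i \<le> M" "j < N"
  shows "(\<Sum>m\<le>M. \<Sum>n\<le>N. f $ n $ m * (mony m n * g) $ j $ i) = (dy f * g) $ j $ i"
proof -
  obtain N' where N: "N = Suc N'" using assms(2) by (cases N) auto
  have "(\<Sum>m\<le>M. \<Sum>n\<le>N. f $ n $ m * (mony m n * g) $ j $ i) =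
      (\<Sum>m\<le>M. \<Sum>n\<le>N'. dy f $ n $ m * (mon m n * g) $ j $ i)"
  proof -
    have "f $ Suc n $ m * (mony m (Suc n) * g) $ j $ i = dy f $ n $ m * (mon m n * g) $ j $ i" for m n
      unfolding mony_mult_nth mult_of_nat_left_commute by (simp add: of_nat_fps_mult_nth del: of_nat_Suc)
    moreover have "(mony m 0 * g) $ j $ i = 0" for m
      unfolding mony_mult_nth by simp
    ultimately show ?thesis unfolding N sum.atMost_Suc_shift by simp
  qed
  also have "\<dots> = (dy f * g) $ j $ i"
    using assms N by (intro sum_mon_nth) auto
  finally show ?thesis .
qed


lemma dx_nth_nth: "dx f $ j $ i = of_nat (Suc i) * f $ j $ Suc i"
  and dy_nth_nth: "dy f $ j $ i = of_nat (Suc j) * f $ Suc j $ (i::nat)"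
  by (simp_all add: of_nat_fps_mult_nth del: of_nat_Suc)

lemma sum_atMost_rev: "(\<Sum>b\<le>n. f b) = (\<Sum>b\<le>n. f (n - b :: nat))"
  by (rule sum.reindex_bij_witness [of _ "\<lambda>b. n - b" "\<lambda>b. n - b"]) auto

lemma mult_nth_nth_rev:
  "(f * g) $ j $ i = (\<Sum>b\<le>j. \<Sum>a\<le>i. f $ (j - b) $ (i - a) * g $ b $ a :: 'a::ring_1)"
proof -
  have "(f * g) $ j $ i = (\<Sum>b\<le>j. \<Sum>a\<le>i. f $ (j - b) $ a * g $ (j - (j - b)) $ (i - a))"
    unfolding mult_nth_nth by (rule sum_atMost_rev)
  also have "\<dots> = (\<Sum>b\<le>j. \<Sum>a\<le>i. f $ (j - b) $ (i - a) * g $ (j - (j - b)) $ (i - (i - a)))"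
    by (intro sum.cong refl sum_atMost_rev)
  also have "\<dots> = (\<Sum>b\<le>j. \<Sum>a\<le>i. f $ (j - b) $ (i - a) * g $ b $ a)"
    by (intro sum.cong refl) simp
  finally show ?thesis .
qed

section \<open>Parity and m-adic size of power series\<close>

context augmented_local_algebra
begin

definition series_homog :: "bit \<Rightarrow> 'a fps fps \<Rightarrow> bool" where
  "series_homog p f \<longleftrightarrow> (\<forall>i j. f $ j $ i \<in> homog B p)"

definition series_mp :: "nat \<Rightarrow> 'a fps fps \<Rightarrow> bool" where
  "series_mp n f \<longleftrightarrow> (\<forall>i j. f $ j $ i \<in> mp n)"

lemma series_homog_0: "series_homog p 0"
  by (simp add: series_homog_def homog_zero)

lemma series_homog_add: "series_homog p f \<Longrightarrow> series_homog p g \<Longrightarrow> series_homog p (f + g)"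
  and series_homog_diff: "series_homog p f \<Longrightarrow> series_homog p g \<Longrightarrow> series_homog p (f - g)"
  and series_homog_uminus: "series_homog p f \<Longrightarrow> series_homog p (- f)"
  by (simp_all add: series_homog_def homog_add homog_diff homog_uminus)

lemma series_homog_mult: "series_homog p f \<Longrightarrow> series_homog q g \<Longrightarrow> series_homog (p + q) (f * g)"
  by (simp add: series_homog_def mult_nth_nth homog_sum homog_mult)

lemma series_homog_mult_even: "series_homog 0 f \<Longrightarrow> series_homog p g \<Longrightarrow> series_homog p (f * g)"
  using series_homog_mult [of 0 f p g] by simp

lemma series_homog_mult_even_right: "series_homog p f \<Longrightarrow> series_homog 0 g \<Longrightarrow> series_homog p (f * g)"
  using series_homog_mult [of p f 0 g] by simp

lemma series_homog_const: "a \<in> homog B p \<Longrightarrow> series_homog p (fps_const (fps_const a))"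
  by (auto simp: series_homog_def homog_zero)

lemma series_homog_mon: "series_homog 0 (mon a b)"
  by (simp add: series_homog_def mon_nth homog_zero)

lemma series_homog_1: "series_homog 0 1"
  using series_homog_mon [of 0 0] by simp

lemma series_homog_of_nat: "series_homog 0 (of_nat n)"
  by (induction n) (simp_all add: series_homog_0 series_homog_1 series_homog_add)

lemma series_homog_monx: "series_homog 0 (monx a b)"
  and series_homog_mony: "series_homog 0 (mony a b)"
  unfolding monx_def mony_def
  by (intro series_homog_mult_even series_homog_of_nat series_homog_mon)+

lemma series_homog_power: "series_homog 0 f \<Longrightarrow> series_homog 0 (f ^ n)"
  by (induction n) (simp_all add: series_homog_1 series_homog_mult_even)

lemma series_homog_dx: "series_homog p f \<Longrightarrow> series_homog p (dx f)"
  and series_homog_dy: "series_homog p f \<Longrightarrow> series_homog p (dy f)"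
  using homog_mult [OF homog_of_nat]
  by (auto simp: series_homog_def dx_nth_nth dy_nth_nth simp del: dx_nth fps_deriv_nth of_nat_Suc)

lemma series_homog_ksign: "series_homog p f \<Longrightarrow> series_homog p (ksign q * f)"
  by (simp add: ksign_def series_homog_uminus)

lemma series_even_commute: "series_homog 0 f \<Longrightarrow> f * g = g * f"
proof (intro fps_ext)
  fix i j assume f: "series_homog 0 f"
  show "(f * g) $ j $ i = (g * f) $ j $ i"
    unfolding mult_nth_nth [of f] mult_nth_nth_rev [of g]
    using f even_commute by (intro sum.cong refl) (auto simp: series_homog_def)
qed

lemma series_odd_anticommute: "series_homog 1 f \<Longrightarrow> series_homog 1 g \<Longrightarrow> f * g = - (g * f)"
proof (intro fps_ext)
  fix i j assume f: "series_homog 1 f" and g: "series_homog 1 g"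
  have "f $ b $ a * g $ d $ c = - (g $ d $ c * f $ b $ a)" for a b c d
    using graded_commute [of "f $ b $ a" 1 "g $ d $ c" 1] f g by (simp add: series_homog_def)
  then show "(f * g) $ j $ i = (- (g * f)) $ j $ i"
    unfolding fps_neg_nth mult_nth_nth [of f] mult_nth_nth_rev [of g] sum_negf [symmetric]
    by (intro sum.cong refl)
qed

lemma series_odd_square: "series_homog 1 f \<Longrightarrow> f * f = 0"
proof (intro fps_ext)
  fix i j assume "series_homog 1 f"
  then have "f * f + f * f = 0" using series_odd_anticommute [of f f] by (simp add: eq_neg_iff_add_eq_0)
  then have "(f * f + f * f) $ j $ i = 0" by (simp only: fps_zero_nth)
  then show "(f * f) $ j $ i = 0 $ j $ i" using double_zero [of "(f * f) $ j $ i"] by simp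
qed

lemma series_mp_0: "series_mp n 0"
  by (simp add: series_mp_def)

lemma series_mp_add: "series_mp n f \<Longrightarrow> series_mp n g \<Longrightarrow> series_mp n (f + g)"
  and series_mp_diff: "series_mp n f \<Longrightarrow> series_mp n g \<Longrightarrow> series_mp n (f - g)"
  and series_mp_uminus: "series_mp n f \<Longrightarrow> series_mp n (- f)"
  by (simp_all add: series_mp_def mp_add mp_diff)

lemma series_mp_left: "series_mp n g \<Longrightarrow> series_mp n (f * g)"
  and series_mp_right: "series_mp n f \<Longrightarrow> series_mp n (f * g)"
  by (simp_all add: series_mp_def mult_nth_nth mp_sum mp_left mp_right)

lemma series_mp_Suc: "series_mp n f \<Longrightarrow> series_mp 1 g \<Longrightarrow> series_mp (Suc n) (f * g)"
  and series_mp_Suc_left: "series_mp n f \<Longrightarrow> series_mp 1 g \<Longrightarrow> series_mp (Suc n) (g * f)"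
  by (simp_all add: series_mp_def mult_nth_nth mp_sum mp_Suc_mult mp_Suc_mult_left)

lemma series_mp_dx: "series_mp n f \<Longrightarrow> series_mp n (dx f)"
  and series_mp_dy: "series_mp n f \<Longrightarrow> series_mp n (dy f)"
  by (auto simp: series_mp_def dx_nth_nth dy_nth_nth mp_left simp del: dx_nth fps_deriv_nth of_nat_Suc)

lemma series_mp_const: "a \<in> mp n \<Longrightarrow> series_mp n (fps_const (fps_const a))"
  by (auto simp: series_mp_def)


section \<open>Coderivations and coalgebra morphisms by their rows\<close>

text \<open>The pullback of x^P under \<open>F\<close> is a function \<open>row F P 0\<close> +
  \<open>row F P 1\<close> xi, where xi is the odd coordinate.\<close>

definition row :: "('a sym \<Rightarrow> 'a sym) \<Rightarrow> nat \<times> nat \<times> nat \<Rightarrow> nat \<Rightarrow> 'a fps fps" where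
  "row F P k = Abs_fps (\<lambda>j. Abs_fps (\<lambda>i. dcf F P (k, i, j)))"

lemma row_nth [simp]: "row F P k $ j $ i = dcf F P (k, i, j)"
  by (simp add: row_def)

lemmas dcf_coderivation = coderivation_iff [THEN iffD1, THEN conjunct2, THEN conjunct2, rule_format]

text \<open>A derivation acts on x^m y^n by the chain rule. The induction splits off one coordinate
  at a time, first for the powers of x and then for those of y.\<close>

lemma coderivation_rows_even:
  assumes D: "coderivation B p D" and k: "k \<le> 1"
  shows "row D (0, m, n) k = monx m n * row D (0, 1, 0) k + mony m n * row D (0, 0, 1) k"
proof -
  note C = dcf_coderivation [OF D]
  have add: "row D (0, m + m', n + n') k = mon m' n' * row D (0, m, n) k + mon m n * row D (0, m', n') k"
    if "m + n \<noteq> 0" "m' + n' \<noteq> 0" for m m' n n'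
  proof (intro fps_ext)
    fix i j
    have v: "valid (0, m, n)" "valid (0, m', n')" using that by (auto simp: valid_iff)
    show "row D (0, m + m', n + n') k $ j $ i =
      (mon m' n' * row D (0, m, n) k + mon m n * row D (0, m', n') k) $ j $ i"
    proof (cases "valid (k, i, j)")
      case True
      then show ?thesis using C [OF v True] by (simp add: mon_mult_nth)
    next
      case False
      then show ?thesis using k that by (auto simp: mon_mult_nth valid_iff)
    qed
  qed
  have zero: "row D (0, 0, 0) k = 0"
    by (intro fps_ext) (simp add: valid_iff)
  have x: "row D (0, m, 0) k = monx m 0 * row D (0, 1, 0) k" for m
  proof (induction m)
    case (Suc m)
    show ?case
    proof (cases "m = 0")
      case False
      have "monx 1 0 = (1 :: 'a fps fps)" by (simp add: monx_def)
      then have "monx (Suc m) 0 = mon 1 0 * monx m 0 + (mon m 0 :: 'a fps fps)"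
        using monx_add [of m 1 0 0, where 'a = 'a] by simp
      then show ?thesis
        using add [of m 0 1 0] Suc False by (simp add: distrib_right mult.assoc)
    qed (simp add: monx_def)
  qed (simp add: zero monx_def)
  show ?thesis
  proof (induction n)
    case 0
    show ?case using x [of m] by (simp add: mony_def)
  next
    case (Suc n)
    show ?case
    \<comment> \<open>The empty monomial is not an index of S(W), so \<open>add\<close> cannot split
      off the first factor y.\<close>
    proof (cases "m + n = 0")
      case True
      then show ?thesis by (simp add: monx_def mony_def)
    next
      case False
      have "monx m (Suc n) = mon 0 1 * (monx m n :: 'a fps fps)"
        by (simp add: monx_def mult_of_nat_left_commute mult.assoc mon_mult)
      moreover have "mony m (Suc n) = mon 0 1 * mony m n + (mon m n :: 'a fps fps)"
        using mony_add [of m 0 n 1] by (simp add: mony_def)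
      ultimately show ?thesis
        using add [of m n 0 1] False Suc by (simp add: distrib_right distrib_left mult.assoc)
    qed
  qed
qed

text \<open>The Leibniz rule for xi times x^m y^n. In the term where xi itself survives, only the
  part of the other factor free of xi counts, because xi squares to zero; \<open>ksign p\<close> is
  the sign of moving the derivation past xi.\<close>

lemma coderivation_rows_odd:
  assumes D: "coderivation B p D"
  shows "row D (1, m, n) 0 = mon m n * row D (1, 0, 0) 0"
    and "row D (1, m, n) 1 = mon m n * row D (1, 0, 0) 1 + ksign p * row D (0, m, n) 0"
proof -
  note C = dcf_coderivation [OF D]
  have ks: "(ksign p * f) $ j $ i = ksign p * f $ j $ i" for f :: "'a fps fps" and i j
    by (simp add: ksign_def)
  have v1: "valid (1, 0, 0)" by (simp add: valid_iff)
  show "row D (1, m, n) 0 = mon m n * row D (1, 0, 0) 0"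
  proof (cases "m + n = 0")
    case False
    then have v: "valid (0, m, n)" by (auto simp: valid_iff)
    show ?thesis
    proof (intro fps_ext)
      fix i j
      show "row D (1, m, n) 0 $ j $ i = (mon m n * row D (1, 0, 0) 0) $ j $ i"
      proof (cases "valid (0, i, j)")
        case True
        then show ?thesis using C [OF v1 v True] by (simp add: mon_mult_nth)
      next
        case False
        then show ?thesis using \<open>m + n \<noteq> 0\<close> by (auto simp: mon_mult_nth valid_iff)
      qed
    qed
  qed simp
  show "row D (1, m, n) 1 = mon m n * row D (1, 0, 0) 1 + ksign p * row D (0, m, n) 0"
  proof (cases "m + n = 0")
    case False
    then have v: "valid (0, m, n)" by (auto simp: valid_iff)
    show ?thesis
    proof (intro fps_ext)
      fix i j
      show "row D (1, m, n) 1 $ j $ i = (mon m n * row D (1, 0, 0) 1 + ksign p * row D (0, m, n) 0) $ j $ i"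
        using C [OF v1 v, of "(1, i, j)"] by (simp add: mon_mult_nth ks valid_iff)
    qed
  next
    case True
    have "row D (0, 0, 0) 0 = 0" by (intro fps_ext) (simp add: valid_iff)
    then show ?thesis using True by simp
  qed
qed

lemma coderivation_eqI:
  assumes D: "coderivation B p D" and E: "coderivation B p E"
    and "\<And>P I. P \<in> {(1, 0, 0), (0, 1, 0), (0, 0, 1)} \<Longrightarrow> dcf D P I = dcf E P I"
  shows "D = E"
proof -
  have gen: "row D P k = row E P k" if "P \<in> {(1, 0, 0), (0, 1, 0), (0, 0, 1)}" for P k
    by (intro fps_ext) (simp add: assms(3) [OF that])
  have even: "row D (0, m, n) k = row E (0, m, n) k" if "k \<le> 1" for m n k
    using gen [of "(0, 1, 0)" k] gen [of "(0, 0, 1)" k]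
      coderivation_rows_even [OF D that, of m n] coderivation_rows_even [OF E that, of m n] by simp
  have odd: "row D (1, m, n) k = row E (1, m, n) k" if "k \<le> 1" for m n k
  proof -
    have "k = 0 \<or> k = 1" using that by auto
    then show ?thesis
      using coderivation_rows_odd [OF D, of m n] coderivation_rows_odd [OF E, of m n]
        gen [of "(1, 0, 0)"] even [of 0 m n] by auto
  qed
  show ?thesis
  proof (rule dcf_ext)
    show "right_linear D" "right_linear E" using D E by (simp_all add: coderivation_def)
    fix P I assume v: "valid P" "valid I"
    obtain a m n where P: "P = (a, m, n)" by (cases P)
    obtain k i j where I: "I = (k, i, j)" by (cases I)
    have "a = 0 \<or> a = 1" "k \<le> 1" using v P I by (auto simp: valid_iff)
    then have "row D P k = row E P k" using even odd P by auto
    then have "row D P k $ j $ i = row E P k $ j $ i" by simp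
    then show "dcf D P I = dcf E P I" by (simp add: I)
  qed
qed

text \<open>A derivation lowers the exponents of x and y by at most one. This makes each column of
  \<open>D\<close> finite and bounds the sums in \<open>row_comp_coderivation\<close>.\<close>

lemma dcf_coderivation_bound:
  assumes D: "coderivation B p D" and nz: "dcf D (a, m, n) (k, i, j) \<noteq> 0"
  shows "a \<le> 1" "m \<le> Suc i" "n \<le> Suc j"
proof -
  have v: "valid (a, m, n)" "valid (k, i, j)" using nz dcf_invalid by blast+
  then show a: "a \<le> 1" by (simp add: valid_iff)
  have k: "k \<le> 1" using v by (simp add: valid_iff)
  have ks: "(ksign p * f) $ j $ i = ksign p * f $ j $ i" for f :: "'a fps fps" and i j
    by (simp add: ksign_def)
  have even: "m \<le> Suc i \<and> n \<le> Suc j" if "row D (0, m, n) k' $ j $ i \<noteq> 0" "k' \<le> 1" for k'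
  proof (rule ccontr)
    assume "\<not> (m \<le> Suc i \<and> n \<le> Suc j)"
    then have "row D (0, m, n) k' $ j $ i = 0"
      unfolding coderivation_rows_even [OF D that(2), of m n] by (auto simp: monx_mult_nth mony_mult_nth mon_mult_nth)
    then show False using that by simp
  qed
  have "m \<le> Suc i \<and> n \<le> Suc j"
  proof (cases "a = 0")
    case True
    then show ?thesis using even [of k] nz k by simp
  next
    case False
    then have a1: "a = 1" using a by simp
    show ?thesis
    proof (rule ccontr)
      assume b: "\<not> (m \<le> Suc i \<and> n \<le> Suc j)"
      have "row D (0, m, n) 0 $ j $ i = 0" using even [of 0] b by blast
      then have "row D (1, m, n) k $ j $ i = 0"
      proof (cases "k = 0")
        case True
        then show ?thesis unfolding True coderivation_rows_odd(1) [OF D, of m n] using b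
          by (auto simp: mon_mult_nth)
      next
        case False
        then have k1: "k = 1" using k by simp
        show ?thesis unfolding k1 coderivation_rows_odd(2) [OF D, of m n]
          using b \<open>row D (0, m, n) 0 $ j $ i = 0\<close> by (auto simp: mon_mult_nth ks)
      qed
      then show False using nz a1 by simp
    qed
  qed
  then show "m \<le> Suc i" "n \<le> Suc j" by auto
qed

text \<open>Here \<open>E\<close> is merely right linear, so \<open>row E P\<close> stands for an
  arbitrary function f0 + f1 xi, to which the vector field \<open>D\<close> is applied. The last
  term is negative because the odd \<open>D\<close> passes xi.\<close>

lemma row_comp_coderivation:
  assumes E: "right_linear E" and D: "coderivation B 1 D"
  shows "row (E \<circ> D) P 0 = dx (row E P 0) * row D (0, 1, 0) 0 + dy (row E P 0) * row D (0, 0, 1) 0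
      + row E P 1 * row D (1, 0, 0) 0"
    and "row (E \<circ> D) P 1 = dx (row E P 0) * row D (0, 1, 0) 1 + dy (row E P 0) * row D (0, 0, 1) 1
      + row E P 1 * row D (1, 0, 0) 1
      - (dx (row E P 1) * row D (0, 1, 0) 0 + dy (row E P 1) * row D (0, 0, 1) 0)"
proof -
  have main: "row (E \<circ> D) P k $ j $ i =
      (\<Sum>m\<le>Suc i. \<Sum>n\<le>Suc j. row E P 0 $ n $ m * row D (0, m, n) k $ j $ i) +
      (\<Sum>m\<le>Suc i. \<Sum>n\<le>Suc j. row E P 1 $ n $ m * row D (1, m, n) k $ j $ i)" for k i j
  proof -
    let ?S = "{..1} \<times> {..Suc i} \<times> {..Suc j}"
    have "dcf (E \<circ> D) P (k, i, j) = (\<Sum>J\<in>?S. dcf E P J * dcf D J (k, i, j))"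
    proof (rule dcf_comp [OF E])
      fix J assume "dcf E P J * dcf D J (k, i, j) \<noteq> 0"
      then have "dcf D J (k, i, j) \<noteq> 0" by auto
      then show "J \<in> ?S" using dcf_coderivation_bound [OF D] by (cases J) auto
    qed simp
    also have "\<dots> = (\<Sum>a\<le>1. \<Sum>m\<le>Suc i. \<Sum>n\<le>Suc j. dcf E P (a, m, n) * dcf D (a, m, n) (k, i, j))"
      by (simp only: sum.cartesian_product prod.case_eq_if) (simp add: case_prod_unfold)
    finally show ?thesis by simp
  qed
  define X where "X = row D (0, 1, 0)"
  define Y where "Y = row D (0, 0, 1)"
  define Z where "Z = row D (1, 0, 0)"
  have rows: "row D (0, m, n) 0 = monx m n * X 0 + mony m n * Y 0"
      "row D (0, m, n) 1 = monx m n * X 1 + mony m n * Y 1"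
      "row D (1, m, n) 0 = mon m n * Z 0"
      "row D (1, m, n) 1 = mon m n * Z 1 - (monx m n * X 0 + mony m n * Y 0)" for m n
    unfolding X_def Y_def Z_def
    using coderivation_rows_even [OF D, of 0 m n] coderivation_rows_even [OF D, of 1 m n]
      coderivation_rows_odd [OF D, of m n] by simp_all
  have sums: "(\<Sum>m\<le>Suc i. \<Sum>n\<le>Suc j. f $ n $ m * (mon m n * g) $ j $ i) = (f * g) $ j $ i"
    "(\<Sum>m\<le>Suc i. \<Sum>n\<le>Suc j. f $ n $ m * (monx m n * g) $ j $ i) = (dx f * g) $ j $ i"
    "(\<Sum>m\<le>Suc i. \<Sum>n\<le>Suc j. f $ n $ m * (mony m n * g) $ j $ i) = (dy f * g) $ j $ i"
    for f g :: "'a fps fps" and i j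
    by (rule sum_mon_nth sum_monx_nth sum_mony_nth; simp)+
  show "row (E \<circ> D) P 0 = dx (row E P 0) * row D (0, 1, 0) 0 + dy (row E P 0) * row D (0, 0, 1) 0
      + row E P 1 * row D (1, 0, 0) 0"
    unfolding X_def [symmetric] Y_def [symmetric] Z_def [symmetric]
    by (intro fps_ext) (simp only: main rows fps_add_nth distrib_left sum.distrib sums)
  show "row (E \<circ> D) P 1 = dx (row E P 0) * row D (0, 1, 0) 1 + dy (row E P 0) * row D (0, 0, 1) 1
      + row E P 1 * row D (1, 0, 0) 1
      - (dx (row E P 1) * row D (0, 1, 0) 0 + dy (row E P 1) * row D (0, 0, 1) 0)"
    unfolding X_def [symmetric] Y_def [symmetric] Z_def [symmetric]
    by (intro fps_ext) (simp only: main rows fps_add_nth fps_sub_nth distrib_left right_diff_distrib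
        sum.distrib sum_subtractf sums add_diff_eq add.assoc)
qed

text \<open>Any values on the three coordinates extend to a derivation: \<open>R\<close> lists the
  rows forced by the preceding row formulas. The parts free of xi cannot have a constant term, since
  S(W) has no degree zero; the parts multiplying xi can, since w_1 is a monomial.\<close>

lemma coderivation_exists:
  assumes h: "series_homog p X0" "series_homog (p + 1) X1" "series_homog p Y0" "series_homog (p + 1) Y1"
      "series_homog (p + 1) Z0" "series_homog p Z1"
    and const: "X0 $ 0 $ 0 = 0" "Y0 $ 0 $ 0 = 0" "Z0 $ 0 $ 0 = 0"
  obtains D where "coderivation B p D"
    "row D (0, 1, 0) 0 = X0" "row D (0, 1, 0) 1 = X1"
    "row D (0, 0, 1) 0 = Y0" "row D (0, 0, 1) 1 = Y1"
    "row D (1, 0, 0) 0 = Z0" "row D (1, 0, 0) 1 = Z1"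
proof -
  define X where "X k = (if k = 0 then X0 else X1)" for k :: nat
  define Y where "Y k = (if k = 0 then Y0 else Y1)" for k :: nat
  define Z where "Z k = (if k = 0 then Z0 else Z1)" for k :: nat
  define R where "R P k = (case P of (a, m, n) \<Rightarrow> if a = 0 then monx m n * X k + mony m n * Y k
     else mon m n * Z k + (if k = 0 then 0 else ksign p * (monx m n * X 0 + mony m n * Y 0)))"
    for P :: "nat \<times> nat \<times> nat" and k :: nat
  define A where "A P I = (case I of (k, i, j) \<Rightarrow> R P k $ j $ i)" for P I :: "nat \<times> nat \<times> nat"
  have ks: "(ksign p * f) $ j $ i = ksign p * f $ j $ i" for f :: "'a fps fps" and i j
    by (simp add: ksign_def)
  have fin: "finite {P. valid P \<and> A P I \<noteq> 0}" for I
  proof -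
    obtain k i j where I: "I = (k, i, j)" by (cases I)
    have "{P. valid P \<and> A P I \<noteq> 0} \<subseteq> {..1} \<times> {..Suc i} \<times> {..Suc j}"
    proof
      fix P assume P: "P \<in> {P. valid P \<and> A P I \<noteq> 0}"
      obtain a m n where Pe: "P = (a, m, n)" by (cases P)
      have "A P I = 0" if "\<not> (m \<le> Suc i \<and> n \<le> Suc j)"
        using that by (auto simp: A_def R_def I Pe monx_mult_nth mony_mult_nth mon_mult_nth ks)
      then show "P \<in> {..1} \<times> {..Suc i} \<times> {..Suc j}"
        using P by (auto simp: Pe valid_iff)
    qed
    then show ?thesis by (rule finite_subset) simp
  qed
  define D where "D = of_dcf A"
  have lin: "right_linear D" unfolding D_def by (rule right_linear_of_dcf) (rule fin)
  have hX: "series_homog (p + of_nat k) (X k)" "series_homog (p + of_nat k) (Y k)"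
      "series_homog (p + 1 + of_nat k) (Z k)" if "k \<le> 1" for k
  proof -
    have "k = 0 \<or> k = 1" using that by auto
    then show "series_homog (p + of_nat k) (X k)" "series_homog (p + of_nat k) (Y k)"
      "series_homog (p + 1 + of_nat k) (Z k)"
      using h by (auto simp: X_def Y_def Z_def add.assoc)
  qed
  have hR: "series_homog (p + of_nat a + of_nat k) (R (a, m, n) k)" if "a \<le> 1" "k \<le> 1" for a k m n
  proof (cases "a = 0")
    case True
    then show ?thesis using hX [OF that(2)]
      by (simp add: R_def series_homog_add series_homog_mult_even series_homog_monx series_homog_mony)
  next
    case False
    then have a1: "a = 1" using that by simp
    have "series_homog p (monx m n * X 0 + mony m n * Y 0)"
      using hX [of 0] by (simp add: series_homog_add series_homog_mult_even series_homog_monx series_homog_mony)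
    then show ?thesis using hX(3) [OF that(2)] that(2) a1
      by (cases "k = 0") (auto simp: R_def series_homog_add series_homog_mult_even series_homog_mon
          series_homog_ksign add.assoc le_Suc_eq)
  qed
  have zero: "R P 0 $ 0 $ 0 = 0" for P
    using const by (cases P) (auto simp: R_def monx_mult_nth mony_mult_nth mon_mult_nth X_def Y_def Z_def)
  have dcf: "dcf D P (k, i, j) = R P k $ j $ i" if "valid P" "k \<le> 1" for P k i j
  proof (cases "valid (k, i, j)")
    case True
    then show ?thesis using dcf_of_dcf [where A = A, OF fin that(1) True] by (simp add: D_def A_def)
  next
    case False
    then have "k = 0" "i = 0" "j = 0" using that by (auto simp: valid_iff)
    then show ?thesis using False zero by simp
  qed
  have par: "has_parity B p D"
    unfolding dcf_parity_iff [OF lin]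
  proof (intro allI impI)
    fix P I assume v: "valid P" "valid I"
    obtain a m n where P: "P = (a, m, n)" by (cases P)
    obtain k i j where I: "I = (k, i, j)" by (cases I)
    have "a \<le> 1" "k \<le> 1" using v by (auto simp: P I valid_iff)
    then show "dcf D P I \<in> homog B (p + tpar P + tpar I)"
      using v dcf [of P k i j] hR [of a k m n] by (simp add: P I tpar_def series_homog_def)
  qed
  have C: "dcf D (P + Q) I = (if Q \<le> I then twist B (tpar Q) (dcf D P (I - Q)) else 0)
        + (if P \<le> I then ksign (p * tpar P) * dcf D Q (I - P) else 0)"
    if v: "valid P" "valid Q" "valid I" for P Q I
  proof -
    obtain a m n where P: "P = (a, m, n)" by (cases P)
    obtain b m' n' where Q: "Q = (b, m', n')" by (cases Q)
    obtain k i j where I: "I = (k, i, j)" by (cases I)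
    have ab: "a = 0 \<or> a = 1" "b = 0 \<or> b = 1" "k = 0 \<or> k = 1" using v by (auto simp: P Q I valid_iff)
    have evenR: "R (0, m + m', n + n') k = mon m' n' * R (0, m, n) k + mon m n * R (0, m', n') k" for k
      by (simp add: R_def monx_add mony_add distrib_right distrib_left mult.assoc)
    have vPQ: "valid (P + Q)" if "a + b \<le> 1" using that v by (auto simp: P Q valid_iff)
    have q0: "twist B 1 (R (0, m, n) 0 $ j $ i) = ksign p * R (0, m, n) 0 $ j $ i" for m n i j
      using hR [of 0 0 m n] twist_homog [of "R (0, m, n) 0 $ j $ i" p 1] by (simp add: series_homog_def)
    have q1: "twist B 1 (R (1, m, n) 0 $ j $ i) = ksign (p + 1) * R (1, m, n) 0 $ j $ i" for m n i j
      using hR [of 1 0 m n] twist_homog [of "R (1, m, n) 0 $ j $ i" "p + 1" 1] by (simp add: series_homog_def)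
    consider "a = 0" "b = 0" | "a = 1" "b = 0" | "a = 0" "b = 1" | "a = 1" "b = 1" using ab by blast
    then show ?thesis
    proof cases
      case 1
      then show ?thesis
        using v ab(3) vPQ evenR [of k] dcf [of "P + Q" k i j] dcf [of P k "i - m'" "j - n'"]
          dcf [of Q k "i - m" "j - n"]
        by (auto simp: P Q I mon_mult_nth)
    next
      case 2
      have "R (1, m + m', n + n') k = mon m' n' * R (1, m, n) k
          + (if k = 0 then 0 else ksign p * (mon m n * R (0, m', n') 0))"
        using evenR [of 0] mon_mult [of m' n' m n, where 'a = 'a]
        by (auto simp: R_def distrib_left distrib_right mult.assoc [symmetric] add.commute ksign_def)
      then show ?thesis
        using 2 v ab(3) vPQ dcf [of "P + Q" k i j] dcf [of P k "i - m'" "j - n'"]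
          dcf [of Q 0 "i - m" "j - n"]
        by (auto simp: P Q I mon_mult_nth ks)
    next
      case 3
      have "R (1, m + m', n + n') k = (if k = 0 then 0 else ksign p * (mon m' n' * R (0, m, n) 0))
          + mon m n * R (1, m', n') k"
        using evenR [of 0] mon_mult [of m n m' n', where 'a = 'a]
        by (auto simp: R_def distrib_left distrib_right mult.assoc [symmetric] add.commute ksign_def)
      then show ?thesis
        using 3 v ab(3) vPQ dcf [of "P + Q" k i j] dcf [of P 0 "i - m'" "j - n'"]
          dcf [of Q k "i - m" "j - n"]
        by (auto simp: P Q I mon_mult_nth ks q0)
    next
      \<comment> \<open>Both factors contain xi. The row on the left is zero because xi occurs
        twice, and the two terms on the right are equal up to the opposite signs
        \<open>ksign (p + 1)\<close> and \<open>ksign p\<close>.\<close>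
      case 4
      have "mon m' n' * R (1, m, n) 0 = mon m n * R (1, m', n') 0"
        by (simp add: R_def mon_mult add.commute flip: mult.assoc)
      then have "(mon m' n' * R (1, m, n) 0) $ j $ i = (mon m n * R (1, m', n') 0) $ j $ i" by simp
      then show ?thesis
        using 4 v ab(3) dcf [of P 0 "i - m'" "j - n'"] dcf [of Q 0 "i - m" "j - n"]
        by (auto simp: P Q I mon_mult_nth ks q1 [unfolded One_nat_def] ksign_add valid_iff split: if_splits)
    qed
  qed
  have "coderivation B p D"
    unfolding coderivation_iff by (intro conjI lin par allI impI C)
  moreover have "row D P k = R P k" if "valid P" "k \<le> 1" for P k
    using dcf [OF that] by (intro fps_ext) simp
  ultimately show ?thesis
    by (intro that [of D]) (simp_all add: R_def X_def Y_def Z_def valid_iff monx_def mony_def)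
qed

end

section \<open>Coalgebra morphisms with prescribed coordinates\<close>

definition series_ord :: "nat \<Rightarrow> 'a::ring_1 fps fps \<Rightarrow> bool" where
  "series_ord k f \<longleftrightarrow> (\<forall>i j. i + j < k \<longrightarrow> f $ j $ i = 0)"

lemma series_ord_mult:
  assumes "series_ord k f" "series_ord l g"
  shows "series_ord (k + l) (f * g)"
  unfolding series_ord_def mult_nth_nth
proof (intro allI impI sum.neutral ballI)
  fix i j b a assume "i + j < k + l" "b \<in> {..j}" "a \<in> {..i}"
  then have "a + b < k \<or> (i - a) + (j - b) < l" by auto
  then show "f $ b $ a * g $ (j - b) $ (i - a) = 0"
    using assms by (auto simp: series_ord_def)
qed

lemma series_ord_power: "series_ord 1 f \<Longrightarrow> series_ord n (f ^ n)"
proof (induction n)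
  case (Suc n)
  then show ?case using series_ord_mult [of 1 f n "f ^ n"] by simp
qed (simp add: series_ord_def)

lemma series_ord_1_iff: "series_ord 1 f \<longleftrightarrow> f $ 0 $ 0 = 0"
  by (auto simp: series_ord_def)

definition tlen :: "nat \<times> nat \<times> nat \<Rightarrow> nat" where
  "tlen P = fst P + fst (snd P) + snd (snd P)"

lemma atMost_triple: "{J. J \<le> (k, i, j)} = {..k} \<times> {..i} \<times> {..j::nat}"
  by auto

context augmented_local_algebra
begin

text \<open>The substitution of \<open>x\<close>, \<open>y\<close> and \<open>c0\<close> +
  \<open>c1\<close> xi for the three coordinates. Since nothing has a constant term, the order of
  the row at \<open>P\<close> grows with the length of \<open>P\<close>; this makes the columns
  finite and is recorded in the last clause, on which the inversion of the morphism relies.\<close>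

lemma morphism_exists:
  assumes h: "series_homog 0 x" "series_homog 0 y" "series_homog 1 c0" "series_homog 0 c1"
    and const: "x $ 0 $ 0 = 0" "y $ 0 $ 0 = 0" "c0 $ 0 $ 0 = 0"
  obtains L where "right_linear L" "has_parity B 0 L"
    "\<And>x. comult (L x) = tens_map B 0 L L (comult x)"
    "\<And>m n. m + n \<noteq> 0 \<Longrightarrow> row L (0, m, n) 0 = x ^ m * y ^ n"
    "\<And>m n. m + n \<noteq> 0 \<Longrightarrow> row L (0, m, n) 1 = 0"
    "\<And>m n. row L (1, m, n) 0 = x ^ m * y ^ n * c0"
    "\<And>m n. row L (1, m, n) 1 = x ^ m * y ^ n * c1"
    "\<And>P I. dcf L P I \<noteq> 0 \<Longrightarrow> tlen P \<le> tlen I"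
proof -
  define R where "R P k = (case P of (a, m, n) \<Rightarrow> x ^ m * y ^ n *
     (if a = 0 then (if k = 0 then 1 else 0) else (if k = 0 then c0 else c1)))"
    for P :: "nat \<times> nat \<times> nat" and k :: nat
  define A where "A P I = (case I of (k, i, j) \<Rightarrow> R P k $ j $ i)" for P I :: "nat \<times> nat \<times> nat"
  have ord: "series_ord (m + n) (x ^ m * y ^ n)" for m n
    using const by (intro series_ord_mult series_ord_power) (simp_all only: series_ord_1_iff)
  have ord0: "series_ord 0 f" for f :: "'a fps fps" by (simp add: series_ord_def)
  have bound: "tlen P \<le> tlen I" if "valid P" "fst I \<le> 1" "A P I \<noteq> 0" for P I
  proof -
    obtain a m n where P: "P = (a, m, n)" by (cases P)
    obtain k i j where I: "I = (k, i, j)" by (cases I)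
    have ak: "a \<le> 1" "k \<le> 1" using that by (auto simp: P I valid_iff)
    have "series_ord (m + n + (if a = 1 \<and> k = 0 then 1 else 0)) (R P k)"
      using ak const(3) unfolding P R_def prod.case
      by (intro series_ord_mult ord) (auto simp: ord0 series_ord_1_iff [simplified])
    then have "m + n + (if a = 1 \<and> k = 0 then 1 else 0) \<le> i + j"
      using that(3) unfolding A_def I prod.case series_ord_def by (meson not_le)
    moreover have "a = 0" if "k = 1" "a \<noteq> 1" using that ak by auto
    moreover have "k = 0 \<or> k = 1" using ak by auto
    moreover have "k = 0" if "a = 0" using \<open>A P I \<noteq> 0\<close> that by (auto simp: A_def I P R_def split: if_splits)
    ultimately show ?thesis using ak by (auto simp: tlen_def P I split: if_splits)
  qed
  have fin: "finite {P. valid P \<and> A P I \<noteq> 0}" if "valid I" for I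
  proof (rule finite_subset)
    show "{P. valid P \<and> A P I \<noteq> 0} \<subseteq> {P. P \<le> (tlen I, tlen I, tlen I)}"
    proof
      fix P assume "P \<in> {P. valid P \<and> A P I \<noteq> 0}"
      then have "tlen P \<le> tlen I" using bound [of P I] that by (auto simp: valid_def)
      then show "P \<in> {P. P \<le> (tlen I, tlen I, tlen I)}" by (cases P) (simp add: tlen_def)
    qed
  qed simp
  define L where "L = of_dcf A"
  have lin: "right_linear L" unfolding L_def by (rule right_linear_of_dcf) (rule fin)
  have zero: "R P 0 $ 0 $ 0 = 0" if "valid P" for P
  proof -
    have "tlen P \<noteq> 0" using that by (cases P) (auto simp: tlen_def valid_iff)
    then show ?thesis using bound [of P 0] that by (force simp: A_def zero_prod_def tlen_def)
  qed
  have dcf: "dcf L P (k, i, j) = R P k $ j $ i" if "valid P" "k \<le> 1" for P k i j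
  proof (cases "valid (k, i, j)")
    case True
    then show ?thesis using dcf_of_dcf [where A = A, OF fin that(1) True] by (simp add: L_def A_def)
  next
    case False
    then have "k = 0" "i = 0" "j = 0" using that by (auto simp: valid_iff)
    then show ?thesis using False zero that by simp
  qed
  have hR: "series_homog (of_nat a + of_nat k) (R (a, m, n) k)" if "a \<le> 1" "k \<le> 1" for a k m n
  proof -
    have "series_homog 0 (x ^ m * y ^ n)" using h by (intro series_homog_mult_even series_homog_power)
    moreover have "(a = 0 \<or> a = 1) \<and> (k = 0 \<or> k = 1)" using that by auto
    ultimately show ?thesis using h series_homog_mult_even [of "x ^ m * y ^ n"]
      by (auto simp: R_def series_homog_1 series_homog_0)
  qed
  have par: "has_parity B 0 L"
    unfolding dcf_parity_iff [OF lin]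
  proof (intro allI impI)
    fix P I assume v: "valid P" "valid I"
    obtain a m n where P: "P = (a, m, n)" by (cases P)
    obtain k i j where I: "I = (k, i, j)" by (cases I)
    have "a \<le> 1" "k \<le> 1" using v by (auto simp: P I valid_iff)
    then show "dcf L P I \<in> homog B (0 + tpar P + tpar I)"
      using v dcf [of P k i j] hR [of a k m n] by (simp add: P I tpar_def series_homog_def)
  qed
  have C: "dcf L (P + Q) I = (\<Sum>J\<in>{J. J \<le> I}. twist B (tpar Q) (dcf L P J) * dcf L Q (I - J))"
    if v: "valid P" "valid Q" "valid I" for P Q I
  proof -
    obtain a m n where P: "P = (a, m, n)" by (cases P)
    obtain b m' n' where Q: "Q = (b, m', n')" by (cases Q)
    obtain k i j where I: "I = (k, i, j)" by (cases I)
    have ab: "a = 0 \<or> a = 1" "b = 0 \<or> b = 1" "k = 0 \<or> k = 1" using v by (auto simp: P Q I valid_iff)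
    let ?M = "x ^ m * y ^ n" and ?N = "x ^ m' * y ^ n'"
    have M: "series_homog 0 ?M" and N: "series_homog 0 ?N"
      using h by (auto intro!: series_homog_mult_even series_homog_power)
    have MN: "x ^ (m + m') * y ^ (n + n') = ?M * ?N"
      using series_even_commute [OF series_homog_power [OF h(1)], of m' "y ^ n"]
      by (simp add: power_add mult.assoc) (simp flip: mult.assoc)
    have tw: "twist B (of_nat b) (R P l $ j $ i) = ksign (of_nat b * (of_nat a + of_nat l)) * R P l $ j $ i"
      if "l \<le> 1" for l i j
      using hR [of a l m n] that ab by (auto simp: P series_homog_def intro!: twist_homog)
    have "(\<Sum>J\<in>{J. J \<le> I}. twist B (tpar Q) (dcf L P J) * dcf L Q (I - J)) =
      (\<Sum>l\<le>k. \<Sum>i'\<le>i. \<Sum>j'\<le>j. twist B (tpar Q) (dcf L P (l, i', j')) * dcf L Q (k - l, i - i', j - j'))"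
      unfolding I atMost_triple sum.cartesian_product by (intro sum.cong refl) auto
    also have "\<dots> = (\<Sum>l\<le>k. \<Sum>i'\<le>i. \<Sum>j'\<le>j. ksign (of_nat b * (of_nat a + of_nat l))
        * (R P l $ j' $ i' * R Q (k - l) $ (j - j') $ (i - i')))"
    proof (intro sum.cong refl)
      fix l i' j' assume "l \<in> {..k}"
      then have "l \<le> 1" "k - l \<le> 1" using ab by auto
      then show "twist B (tpar Q) (dcf L P (l, i', j')) * dcf L Q (k - l, i - i', j - j') =
          ksign (of_nat b * (of_nat a + of_nat l)) * (R P l $ j' $ i' * R Q (k - l) $ (j - j') $ (i - i'))"
        using dcf [OF v(1), of l i' j'] dcf [OF v(2), of "k - l" "i - i'" "j - j'"] tw [of l j' i']
        by (simp add: tpar_def Q mult.assoc)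
    qed
    also have "\<dots> = (\<Sum>l\<le>k. ksign (of_nat b * (of_nat a + of_nat l)) * (R P l * R Q (k - l)) $ j $ i)"
    proof (intro sum.cong refl)
      fix l
      show "(\<Sum>i'\<le>i. \<Sum>j'\<le>j. ksign (of_nat b * (of_nat a + of_nat l))
        * (R P l $ j' $ i' * R Q (k - l) $ (j - j') $ (i - i'))) =
        ksign (of_nat b * (of_nat a + of_nat l)) * (R P l * R Q (k - l)) $ j $ i"
        unfolding mult_nth_nth sum_distrib_left by (rule sum.swap)
    qed
    finally have e: "(\<Sum>J\<in>{J. J \<le> I}. twist B (tpar Q) (dcf L P J) * dcf L Q (I - J)) =
      (\<Sum>l\<le>k. ksign (of_nat b * (of_nat a + of_nat l)) * (R P l * R Q (k - l)) $ j $ i)" .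
    have vPQ: "valid (P + Q)" if "a + b \<le> 1" using that v by (auto simp: P Q valid_iff)
    have comm: "?M * f * (?N * g) = ?M * ?N * (f * g)" for f g
      using series_even_commute [OF N, of f] by (simp add: mult.assoc) (simp flip: mult.assoc)
    consider "a + b \<le> 1" | "a = 1" "b = 1" using ab by force
    then show ?thesis
    proof cases
      case 1
      have "dcf L (P + Q) I = R (P + Q) k $ j $ i"
        using dcf [OF vPQ [OF 1]] ab by (auto simp: I)
      also have "\<dots> = (\<Sum>l\<le>k. ksign (of_nat b * (of_nat a + of_nat l)) * (R P l * R Q (k - l)) $ j $ i)"
      proof -
        have r: "R (P + Q) k = ?M * ?N * (if a + b = 0 then (if k = 0 then 1 else 0) else (if k = 0 then c0 else c1))"
          by (simp add: R_def P Q MN)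
        have c: "c0 * ?N = x ^ m' * (y ^ n' * c0)" "c1 * ?N = x ^ m' * (y ^ n' * c1)"
          by (simp_all only: series_even_commute [OF N, of c0, symmetric]
              series_even_commute [OF N, of c1, symmetric] mult.assoc)
        show ?thesis
          using 1 ab unfolding r by (auto simp: R_def P Q mult.assoc c)
      qed
      finally show ?thesis using e by simp
    next
      \<comment> \<open>The square of \<open>c0\<close> + \<open>c1\<close> xi has to vanish:
        \<open>c0\<close> is odd and squares to zero, and the two mixed terms cancel because the
        even \<open>c1\<close> commutes with \<open>c0\<close>.\<close>
      case 2
      have "\<not> valid (P + Q)" using 2 by (simp add: P Q valid_iff)
      moreover have "(\<Sum>l\<le>k. ksign (of_nat b * (of_nat a + of_nat l)) * (R P l * R Q (k - l)) $ j $ i) = 0"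
        using 2 ab(3) series_odd_square [OF h(3)] series_even_commute [OF h(4), of c0]
        by (auto simp: R_def P Q comm)
      ultimately show ?thesis using e by simp
    qed
  qed
  have row: "row L P k = R P k" if "valid P" "k \<le> 1" for P k
    using dcf [OF that] by (intro fps_ext) simp
  have mult: "comult (L z) = tens_map B 0 L L (comult z)" for z
    using comultiplicative_iff [OF lin] C by blast
  have "tlen P \<le> tlen I" if nz: "dcf L P I \<noteq> 0" for P I
  proof -
    have "valid P" "valid I" using nz dcf_invalid by blast+
    then show ?thesis using bound [of P I] nz dcf_of_dcf [where A = A, OF fin \<open>valid P\<close> \<open>valid I\<close>]
      by (auto simp: L_def valid_def)
  qed
  moreover have "valid (0, m, n)" if "m + n \<noteq> 0" for m n
    using that by (auto simp: valid_iff)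
  moreover have "valid (1, m, n)" for m n by (simp add: valid_iff)
  ultimately show ?thesis
    by (intro that [OF lin par mult]) (simp_all add: row R_def)
qed

end


section \<open>Vector fields in two even variables\<close>

definition vf :: "'a::ring_1 fps fps \<Rightarrow> 'a fps fps \<Rightarrow> 'a fps fps \<Rightarrow> 'a fps fps" where
  "vf X Y f = dx f * X + dy f * Y"

abbreviation cc :: "'a::ring_1 \<Rightarrow> 'a fps fps" where
  "cc a \<equiv> fps_const (fps_const a)"

lemma cc_nth: "cc a $ j $ i = (if i = 0 \<and> j = 0 then a else 0)"
  by auto

lemma dx_cc [simp]: "dx (cc a) = 0" and dx_1 [simp]: "dx 1 = 0" and dx_0 [simp]: "dx 0 = 0"
  by (intro fps_ext; simp add: fps_one_nth)+

lemma dx_mon [simp]: "dx (mon 1 0) = 1" "dx (mon 0 1) = 0" "dy (mon 1 0) = 0" "dy (mon 0 1) = 1"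
  by (intro fps_ext; auto simp: mon_nth fps_one_nth dx_nth_nth dy_nth_nth
      simp del: dx_nth fps_deriv_nth)+

lemma vf_add: "vf X Y (f + g) = vf X Y f + vf X Y g"
  and vf_diff: "vf X Y (f - g) = vf X Y f - vf X Y g"
  by (simp_all add: vf_def dx_add dx_diff algebra_simps)

lemma vf_0 [simp]: "vf X Y 0 = 0" and vf_1 [simp]: "vf X Y 1 = 0" and vf_cc [simp]: "vf X Y (cc a) = 0"
  by (simp_all add: vf_def)

lemma vf_cc_mult: "vf X Y (cc a * f) = cc a * vf X Y f"
  by (simp add: vf_def dx_mult algebra_simps)

text \<open>The field x d/dx + (x + y) d/dy multiplying the odd coordinate in
  \<open>d_sharp\<close>.\<close>

definition vlin :: "'a::ring_1 fps fps \<Rightarrow> 'a fps fps" where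
  "vlin = vf (mon 1 0) (mon 1 0 + mon 0 1)"

text \<open>Semisimple part plus nilpotent part: x d/dx + y d/dy multiplies x^i y^j by its degree,
  and x d/dy moves the coefficient at (i - 1, j + 1) to (i, j). Within one degree the operator is
  therefore triangular in \<open>i\<close>.\<close>

lemma vlin_nth:
  "vlin f $ j $ i = of_nat (i + j) * f $ j $ i + (if i = 0 then 0 else of_nat (Suc j) * f $ Suc j $ (i - 1))"
  unfolding vlin_def vf_def distrib_left fps_add_nth mult_mon_nth
  by (cases i; cases j) (simp_all add: dx_nth_nth dy_nth_nth distrib_right del: dx_nth fps_deriv_nth)

text \<open>Substitution for the triangular system that \<open>vlin\<close>, minus a multiple of the
  identity, gives in each degree. \<open>d\<close> holds the inverses of the diagonal weights. Where
  a weight vanishes, \<open>d\<close> is chosen at will, and the value zero makes the corresponding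
  unknown zero.\<close>

primrec tri_solve :: "(nat \<Rightarrow> nat \<Rightarrow> 'a) \<Rightarrow> (nat \<Rightarrow> nat \<Rightarrow> 'a) \<Rightarrow> nat \<Rightarrow> nat \<Rightarrow> 'a::ring_1" where
  "tri_solve d r 0 = (\<lambda>j. d 0 j * r 0 j)"
| "tri_solve d r (Suc i) = (\<lambda>j. d (Suc i) j * (r (Suc i) j - of_nat (Suc j) * tri_solve d r i (Suc j)))"

lemma tri_solve_eq:
  assumes "\<And>x. w * (d i j * x) = x"
  shows "w * tri_solve d r i j + (if i = 0 then 0 else of_nat (Suc j) * tri_solve d r (i - 1) (Suc j)) = r i j"
  using assms by (cases i) (simp_all del: of_nat_Suc)

lemma tri_solve_zero: "d i j = 0 \<Longrightarrow> tri_solve d r i j = 0"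
  by (cases i) simp_all

context augmented_local_algebra
begin

lemma tri_solve_homog:
  assumes "\<And>i j. d i j \<in> homog B 0" "\<And>i j. r i j \<in> homog B p"
  shows "tri_solve d r i j \<in> homog B p"
proof (induction i arbitrary: j)
  case 0
  show ?case using homog_mult [OF assms(1) [of 0 j] assms(2) [of 0 j]] by simp
next
  case (Suc i)
  have "of_nat (Suc j) * tri_solve d r i (Suc j) \<in> homog B p"
    using homog_mult [OF homog_of_nat Suc, of "Suc j" "Suc j"] by simp
  then show ?case
    using homog_mult [OF assms(1) homog_diff [OF assms(2)], of "of_nat (Suc j) * tri_solve d r i (Suc j)" "Suc i" j "Suc i" j]
    by simp
qed

lemma tri_solve_mp:
  assumes "\<And>i j. r i j \<in> mp n"
  shows "tri_solve d r i j \<in> mp n"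
  by (induction i arbitrary: j) (simp_all add: assms mp_left mp_diff del: of_nat_Suc)

lemma tri_solve_cong:
  assumes "\<And>i j. r i j - r' i j \<in> mp n"
  shows "tri_solve d r i j - tri_solve d r' i j \<in> mp n"
proof (induction i arbitrary: j)
  case 0
  show ?case using mp_left [OF assms, of "d 0 j"] by (simp add: right_diff_distrib)
next
  case (Suc i)
  have "tri_solve d r (Suc i) j - tri_solve d r' (Suc i) j =
     d (Suc i) j * ((r (Suc i) j - r' (Suc i) j) - of_nat (Suc j) * (tri_solve d r i (Suc j) - tri_solve d r' i (Suc j)))"
    by (simp add: right_diff_distrib del: of_nat_Suc)
  then show ?case using assms Suc by (simp add: mp_left mp_diff del: of_nat_Suc)
qed

text \<open>The uniqueness counterpart of \<open>tri_solve\<close>: with a nonzero weight, the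
  triangular system of one degree is injective modulo a power of the maximal ideal.\<close>

lemma tri_inject:
  assumes "w \<noteq> 0"
    and "\<And>i j. i + j = N \<Longrightarrow>
      of_nat w * g i j + (if i = 0 then 0 else of_nat (Suc j) * g (i - 1) (Suc j)) \<in> mp k"
  shows "i + j = N \<Longrightarrow> g i j \<in> mp k"
proof (induction i arbitrary: j)
  case 0
  then show ?case using assms(2) [of 0 j] mp_of_nat_cancel [OF assms(1)] by simp
next
  case (Suc i)
  have "of_nat (Suc j) * g i (Suc j) \<in> mp k" using Suc by (intro mp_left) simp
  then have "of_nat w * g (Suc i) j \<in> mp k"
    using mp_diff [OF assms(2) [of "Suc i" j]] Suc.prems by fastforce
  then show ?case by (rule mp_of_nat_cancel [OF assms(1)])
qed

text \<open>A product of two small factors contracts: a change of order n in the factors changes the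
  product by order n + 1. This is what makes the quadratic error terms harmless in the fixed point
  argument.\<close>

lemma series_mp_mult_cong:
  assumes "series_mp n (f - f')" "series_mp n (g - g')" "series_mp 1 f'" "series_mp 1 g"
  shows "series_mp (Suc n) (f * g - f' * g')"
proof -
  have "f * g - f' * g' = (f - f') * g + f' * (g - g')" by (simp add: algebra_simps)
  then show ?thesis using assms by (simp add: series_mp_add series_mp_Suc series_mp_Suc_left)
qed

lemma series_mp_vf: "series_mp n f \<Longrightarrow> series_mp 1 X \<Longrightarrow> series_mp 1 Y \<Longrightarrow> series_mp (Suc n) (vf X Y f)"
  unfolding vf_def by (intro series_mp_add series_mp_Suc series_mp_dx series_mp_dy)

lemma series_homog_vf:
  "series_homog p f \<Longrightarrow> series_homog q X \<Longrightarrow> series_homog q Y \<Longrightarrow> series_homog (p + q) (vf X Y f)"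
  unfolding vf_def by (intro series_homog_add series_homog_mult series_homog_dx series_homog_dy)

lemma vf_mult:
  assumes "series_homog 0 X" "series_homog 0 Y"
  shows "vf X Y (f * g) = vf X Y f * g + f * vf X Y g"
proof -
  have "dx f * g * X = dx f * X * g" "dy f * g * Y = dy f * Y * g"
    using series_even_commute assms by (metis mult.assoc)+
  then show ?thesis by (simp add: vf_def dx_mult distrib_left distrib_right) (simp add: algebra_simps)
qed

lemma of_nat_scal_inverse: "n \<noteq> 0 \<Longrightarrow> of_nat n * (scal B (inverse (of_nat n)) * x) = x"
  using scal_inverse [of "inverse (of_nat n)" x] by simp

lemma scal_half: "scal B (1 / 2) * x + scal B (1 / 2) * x = x"
  using scal_add [of "1/2" "1/2"] by (simp add: distrib_right [symmetric] scal_one)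

end


section \<open>Linearisation of the even vector field\<close>

context formal_algebra
begin

text \<open>
  The linear part of the field has the single eigenvalue 1, so there are no resonances in degrees
  at least two. In lower degrees the obstructions are absorbed by the parameters
  \<open>t\<^sub>1, t\<^sub>2, t\<^sub>3\<close> and by the rescaling \<open>c\<close> of the odd coordinate.
\<close>

lemma linearisation:
  assumes even: "series_homog 0 X" "series_homog 0 Y"
    and small: "series_mp 1 (X - mon 1 0)" "series_mp 1 (Y - (mon 1 0 + mon 0 1))"
  obtains x y a t1 t2 t3 where
    "series_homog 0 x" "series_homog 0 y" "series_mp 1 (x - mon 1 0)" "series_mp 1 (y - mon 0 1)"
    "x $ 0 $ 0 = 0" "y $ 0 $ 0 = 0" "x $ 0 $ 1 = 1" "y $ 0 $ 1 = 0"
    "a \<in> homog B 0" "t1 \<in> homog B 0" "t2 \<in> homog B 0" "t3 \<in> homog B 0"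
    "a \<in> max_ideal B" "t1 \<in> max_ideal B" "t2 \<in> max_ideal B" "t3 \<in> max_ideal B"
    "vf X Y x = (1 + cc a) * (x + cc t1 - cc t3 * y)"
    "vf X Y y = (1 + cc a) * (x + y + cc t2)"
proof -
  define m2 where "m2 = X - mon 1 0"
  define m3 where "m3 = Y - (mon 1 0 + mon 0 1)"
  have hm: "series_homog 0 m2" "series_homog 0 m3" and sm: "series_mp 1 m2" "series_mp 1 m3"
    using even small by (simp_all add: m2_def m3_def series_homog_diff series_homog_add series_homog_mon)
  \<comment> \<open>A single function on triples carries all the unknowns, so that one fixed point
    theorem applies: first entry 0 and 1 for the corrections to x and y, 2 for the rescaling
    \<open>a\<close>, and 3 to 5 for \<open>t1\<close>, \<open>t2\<close>,
    \<open>t3\<close>.\<close>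
  define be where "be s = Abs_fps (\<lambda>j. Abs_fps (\<lambda>i. s (0, i, j)))" for s :: "nat \<times> nat \<times> nat \<Rightarrow> 'a"
  define ga where "ga s = Abs_fps (\<lambda>j. Abs_fps (\<lambda>i. s (1, i, j)))" for s :: "nat \<times> nat \<times> nat \<Rightarrow> 'a"
  define al where "al s = s (2, 0, 0)" for s :: "nat \<times> nat \<times> nat \<Rightarrow> 'a"
  define T1 where "T1 s = s (3, 0, 0)" for s :: "nat \<times> nat \<times> nat \<Rightarrow> 'a"
  define T2 where "T2 s = s (4, 0, 0)" for s :: "nat \<times> nat \<times> nat \<Rightarrow> 'a"
  define T3 where "T3 s = s (5, 0, 0)" for s :: "nat \<times> nat \<times> nat \<Rightarrow> 'a"
  \<comment> \<open>Insert x + \<open>be s\<close> and y + \<open>ga s\<close> into the required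
    equations. What remains linear in the unknowns is solved directly; \<open>R2\<close> and
    \<open>R3\<close> collect the rest, namely the perturbation and the terms with at least two
    small factors.\<close>
  define R2 where "R2 s = cc (al s) * be s + cc (al s) * cc (T1 s) - cc (T3 s) * ga s
      - cc (al s) * (cc (T3 s) * (mon 0 1 + ga s)) - vf m2 m3 (be s) - m2" for s
  define R3 where "R3 s = cc (al s) * (be s + ga s + cc (T2 s)) - vf m2 m3 (ga s) - m3" for s
  \<comment> \<open>In degree n at least two the weight is n - 1. In degree one it is zero; the
    entry 1 at the coefficient of y lets \<open>tri_solve\<close> output a prescribed value there,
    while the coefficient of x and the constant term are set to zero.\<close>
  define d where "d i j = (if 2 \<le> i + j then scal B (inverse (of_nat (i + j - 1)))
      else if i = 0 \<and> j = 1 then 1 else 0)" for i j :: nat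
  define h where "h = scal B (1 / 2)"
  \<comment> \<open>Write f_ij for the coefficient of x^i y^j and b, g for the two corrections. With
    b_10 = 0, the degree-one equations include b_01 = R2_10 + a and - b_01 = R3_01 + a. Half their
    sum and half their difference give a and b_01; the remaining two give t3 = R2_01 and g_01 =
    R3_10 + a.\<close>
  define na where "na s = - (h * (R2 s $ 0 $ 1 + R3 s $ 1 $ 0))" for s
  define nb where "nb s i j = tri_solve d
     (\<lambda>i j. if 2 \<le> i + j then R2 s $ j $ i else h * (R2 s $ 0 $ 1 - R3 s $ 1 $ 0)) i j" for s i j
  define ng where "ng s i j = tri_solve d
     (\<lambda>i j. if 2 \<le> i + j then R3 s $ j $ i + nb s i j else R3 s $ 0 $ 1 + na s) i j" for s i j
  define T where "T s = (\<lambda>(k, i, j). if k = 0 then nb s i j else if k = 1 then ng s i j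
     else if k = 2 then na s else if k = 3 then - R2 s $ 0 $ 0 else if k = 4 then - R3 s $ 0 $ 0
     else if k = (5::nat) then R2 s $ 1 $ 0 else 0)" for s
  let ?par = "\<lambda>_ :: nat \<times> nat \<times> nat. 0 :: bit"
  define K where "K = {s. \<forall>i. s i \<in> homog B (?par i) \<and> s i \<in> max_ideal B}"
  have dh: "d i j \<in> homog B 0" for i j
    by (auto simp: d_def scal_even homog_zero)
  have K: "series_homog 0 (be s)" "series_homog 0 (ga s)" "series_homog 0 (cc (al s))"
      "series_homog 0 (cc (T1 s))" "series_homog 0 (cc (T2 s))" "series_homog 0 (cc (T3 s))"
      "series_mp 1 (be s)" "series_mp 1 (ga s)" "series_mp 1 (cc (al s))"
      "series_mp 1 (cc (T1 s))" "series_mp 1 (cc (T2 s))" "series_mp 1 (cc (T3 s))" if "s \<in> K" for s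
    using that by (auto simp: K_def be_def ga_def al_def T1_def T2_def T3_def series_homog_def
        series_mp_def homog_zero max_ideal_iff)
  have hR: "series_homog 0 (R2 s)" "series_homog 0 (R3 s)" if "s \<in> K" for s
    unfolding R2_def R3_def
    by (intro series_homog_add series_homog_diff series_homog_mult_even series_homog_mon hm K [OF that]
        series_homog_vf [of 0 _ 0, simplified])+
  have sR: "series_mp 1 (R2 s)" "series_mp 1 (R3 s)" if "s \<in> K" for s
    unfolding R2_def R3_def vf_def
    by (intro series_mp_add series_mp_diff series_mp_left [OF sm(1)] series_mp_left [OF sm(2)]
        series_mp_right [OF K(9) [OF that]] series_mp_right [OF K(12) [OF that]] sm)+
  \<comment> \<open>Apart from the fixed perturbation, every term of \<open>R2\<close> and
    \<open>R3\<close> contains two small factors, either two unknowns or an unknown and a component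
    of the perturbation. A change of order n is therefore felt at order n + 1.\<close>
  have cR: "series_mp (Suc n) (R2 s - R2 s')" "series_mp (Suc n) (R3 s - R3 s')"
    if s: "s \<in> K" "s' \<in> K" and c: "\<And>i. s i - s' i \<in> mp n" for s s' n
  proof -
    have c: "series_mp n (be s - be s')" "series_mp n (ga s - ga s')" "series_mp n (cc (al s) - cc (al s'))"
        "series_mp n (cc (T1 s) - cc (T1 s'))" "series_mp n (cc (T2 s) - cc (T2 s'))"
        "series_mp n (cc (T3 s) - cc (T3 s'))"
      using c by (auto simp: be_def ga_def al_def T1_def T2_def T3_def series_mp_def)
    have group2: "(a + b - c - d - e - m) - (a' + b' - c' - d' - e' - m) =
        (a - a') + (b - b') - (c - c') - (d - d') - (e - e')"
      for a b c d e m a' b' c' d' e' :: "'a fps fps"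
      by (simp add: algebra_simps)
    note K1 = K [OF s(1)] and K2 = K [OF s(2)]
    have a3: "series_mp (Suc n) (cc (al s) * cc (T3 s) - cc (al s') * cc (T3 s'))"
      using c K1 K2 by (intro series_mp_mult_cong)
    have "series_mp (Suc n) (cc (al s) * (cc (T3 s) * (mon 0 1 + ga s)) - cc (al s') * (cc (T3 s') * (mon 0 1 + ga s')))"
    proof -
      have "cc (al s) * (cc (T3 s) * (mon 0 1 + ga s)) - cc (al s') * (cc (T3 s') * (mon 0 1 + ga s')) =
        (cc (al s) * cc (T3 s) - cc (al s') * cc (T3 s')) * (mon 0 1 + ga s)
         + cc (al s') * (cc (T3 s') * (ga s - ga s'))"
        by (simp add: left_diff_distrib right_diff_distrib distrib_left mult.assoc del: fps_const_mult)
      moreover have "series_mp (Suc n) (cc (T3 s') * (ga s - ga s'))"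
        using c K2 by (intro series_mp_Suc_left)
      then have "series_mp (Suc n) ((cc (al s) * cc (T3 s) - cc (al s') * cc (T3 s')) * (mon 0 1 + ga s)
         + cc (al s') * (cc (T3 s') * (ga s - ga s')))"
        by (rule series_mp_add [OF series_mp_right [OF a3] series_mp_left])
      ultimately show ?thesis by (simp only:)
    qed
    moreover have "series_mp (Suc n) (vf m2 m3 (be s) - vf m2 m3 (be s'))"
        "series_mp (Suc n) (vf m2 m3 (ga s) - vf m2 m3 (ga s'))"
      unfolding vf_diff [symmetric] using c sm by (simp_all only: series_mp_vf)
    moreover have "series_mp (Suc n) (cc (al s) * be s - cc (al s') * be s')"
        "series_mp (Suc n) (cc (al s) * cc (T1 s) - cc (al s') * cc (T1 s'))"
        "series_mp (Suc n) (cc (T3 s) * ga s - cc (T3 s') * ga s')"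
      using c K1 K2 by (simp_all only: series_mp_mult_cong)
    moreover have "R2 s - R2 s' = (cc (al s) * be s - cc (al s') * be s')
        + (cc (al s) * cc (T1 s) - cc (al s') * cc (T1 s')) - (cc (T3 s) * ga s - cc (T3 s') * ga s')
        - (cc (al s) * (cc (T3 s) * (mon 0 1 + ga s)) - cc (al s') * (cc (T3 s') * (mon 0 1 + ga s')))
        - (vf m2 m3 (be s) - vf m2 m3 (be s'))"
      unfolding R2_def by (rule group2)
    ultimately show "series_mp (Suc n) (R2 s - R2 s')"
      by (simp only: series_mp_add series_mp_diff)
    have group3: "(a - f - m) - (a' - f' - m) = (a - a') - (f - f')" for a f m a' f' :: "'a fps fps"
      by (simp add: algebra_simps)
    have "series_mp (Suc n) (cc (al s) * (be s + ga s + cc (T2 s)) - cc (al s') * (be s' + ga s' + cc (T2 s')))"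
    proof (rule series_mp_mult_cong)
      have "be s + ga s + cc (T2 s) - (be s' + ga s' + cc (T2 s')) =
          (be s - be s') + (ga s - ga s') + (cc (T2 s) - cc (T2 s'))" by (simp only: algebra_simps)
      then show "series_mp n (be s + ga s + cc (T2 s) - (be s' + ga s' + cc (T2 s')))"
        using c by (simp only: series_mp_add)
      show "series_mp 1 (be s + ga s + cc (T2 s))" using K1 by (simp only: series_mp_add)
    qed (simp_all only: c K2)
    moreover have "R3 s - R3 s' = (cc (al s) * (be s + ga s + cc (T2 s)) - cc (al s') * (be s' + ga s' + cc (T2 s')))
        - (vf m2 m3 (ga s) - vf m2 m3 (ga s'))"
      unfolding R3_def by (rule group3)
    ultimately show "series_mp (Suc n) (R3 s - R3 s')"
      using \<open>series_mp (Suc n) (vf m2 m3 (ga s) - vf m2 m3 (ga s'))\<close> by (simp only: series_mp_diff)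
  qed
  have hh: "h \<in> homog B 0" by (simp add: h_def scal_even)
  have maps: "T s \<in> K" if "s \<in> K" for s
  proof -
    have R: "R2 s $ j $ i \<in> homog B 0" "R3 s $ j $ i \<in> homog B 0"
        "R2 s $ j $ i \<in> mp 1" "R3 s $ j $ i \<in> mp 1" for i j
      using hR [OF that] sR [OF that] by (simp_all only: series_homog_def series_mp_def)
    have hm0: "h * x \<in> homog B 0" if "x \<in> homog B 0" for x using homog_mult [OF hh that] by simp
    have a: "na s \<in> homog B 0" "na s \<in> mp 1"
      unfolding na_def by (intro homog_uminus hm0 homog_add mp_uminus mp_left mp_add R)+
    have b: "nb s i j \<in> homog B 0" "nb s i j \<in> mp 1" for i j
    proof -
      show "nb s i j \<in> homog B 0" unfolding nb_def
        by (rule tri_solve_homog [OF dh]) (simp only: R hm0 homog_diff split: if_split, simp)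
      show "nb s i j \<in> mp 1" unfolding nb_def
        by (rule tri_solve_mp) (simp only: R mp_left mp_diff split: if_split, simp)
    qed
    have g: "ng s i j \<in> homog B 0" "ng s i j \<in> mp 1" for i j
    proof -
      show "ng s i j \<in> homog B 0" unfolding ng_def
        by (rule tri_solve_homog [OF dh]) (simp only: R a b homog_add split: if_split, simp)
      show "ng s i j \<in> mp 1" unfolding ng_def
        by (rule tri_solve_mp) (simp only: R a b mp_add split: if_split, simp)
    qed
    have "T s (k, i, j) \<in> homog B 0 \<and> T s (k, i, j) \<in> mp 1" for k i j
      by (simp only: T_def prod.case fps_neg_nth R a b g homog_uminus mp_uminus homog_zero mp_zero simp_thms split: if_split)
    then show ?thesis by (auto simp: K_def)
  qed
  have contr: "T s i - T s' i \<in> mp (Suc n)"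
    if s: "s \<in> K" "s' \<in> K" and c: "\<And>i. s i - s' i \<in> mp n" for s s' n i
  proof -
    have R: "R2 s $ j $ i - R2 s' $ j $ i \<in> mp (Suc n)" "R3 s $ j $ i - R3 s' $ j $ i \<in> mp (Suc n)" for i j
      using cR [OF s c] by (simp_all add: series_mp_def)
    have "na s - na s' = - (h * ((R2 s $ 0 $ 1 - R2 s' $ 0 $ 1) + (R3 s $ 1 $ 0 - R3 s' $ 1 $ 0)))"
      by (simp add: na_def algebra_simps)
    then have a: "na s - na s' \<in> mp (Suc n)"
      using R by (simp only:) (intro mp_uminus mp_left mp_add)
    have e: "h * (R2 s $ 0 $ 1 - R3 s $ 1 $ 0) - h * (R2 s' $ 0 $ 1 - R3 s' $ 1 $ 0) =
        h * ((R2 s $ 0 $ 1 - R2 s' $ 0 $ 1) - (R3 s $ 1 $ 0 - R3 s' $ 1 $ 0))"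
      by (simp add: algebra_simps)
    have b: "nb s i j - nb s' i j \<in> mp (Suc n)" for i j
      unfolding nb_def
    proof (rule tri_solve_cong)
      fix i j
      show "(if 2 \<le> i + j then R2 s $ j $ i else h * (R2 s $ 0 $ 1 - R3 s $ 1 $ 0)) -
        (if 2 \<le> i + j then R2 s' $ j $ i else h * (R2 s' $ 0 $ 1 - R3 s' $ 1 $ 0)) \<in> mp (Suc n)"
        by (simp only: e R mp_left mp_diff split: if_split, simp)
    qed
    have g: "ng s i j - ng s' i j \<in> mp (Suc n)" for i j
      unfolding ng_def
    proof (rule tri_solve_cong)
      fix i j
      show "(if 2 \<le> i + j then R3 s $ j $ i + nb s i j else R3 s $ 0 $ 1 + na s) -
        (if 2 \<le> i + j then R3 s' $ j $ i + nb s' i j else R3 s' $ 0 $ 1 + na s') \<in> mp (Suc n)"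
        using R a b by (simp add: add_diff_add mp_add)
    qed
    obtain k i' j where i: "i = (k, i', j)" by (cases i)
    have "- R2 s $ 0 $ 0 + R2 s' $ 0 $ 0 \<in> mp (Suc n)" "- R3 s $ 0 $ 0 + R3 s' $ 0 $ 0 \<in> mp (Suc n)"
      using mp_uminus [OF R(1), of 0 0] mp_uminus [OF R(2), of 0 0] by simp_all
    then show ?thesis using R [of 0 0] R [of 0 1] R [of 1 0] a b g by (auto simp: T_def i)
  qed
  obtain s where s: "s \<in> K" "T s = s"
    using contraction_fixpoint [of ?par T] maps contr unfolding K_def by blast
  define b where "b = be s"
  define g where "g = ga s"
  have b_nth: "b $ j $ i = nb s i j" for i j
    using fun_cong [OF s(2), of "(0, i, j)"] by (simp add: b_def be_def T_def)
  have g_nth: "g $ j $ i = ng s i j" for i j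
    using fun_cong [OF s(2), of "(1, i, j)"] by (simp add: g_def ga_def T_def)
  have al: "al s = na s" and T1: "T1 s = - R2 s $ 0 $ 0" and T2: "T2 s = - R3 s $ 0 $ 0" and T3: "T3 s = R2 s $ 1 $ 0"
    using fun_cong [OF s(2), of "(2, 0, 0)"] fun_cong [OF s(2), of "(3, 0, 0)"]
      fun_cong [OF s(2), of "(4, 0, 0)"] fun_cong [OF s(2), of "(5, 0, 0)"]
    by (simp_all add: al_def T1_def T2_def T3_def T_def)
  \<comment> \<open>The zeros of \<open>d\<close> persist in the solution: the new coordinates fix
    the origin and have x-coefficients 1 and 0, a normalisation by which odd parameters can be read
    off later.\<close>
  have low: "b $ 0 $ 0 = 0" "b $ 0 $ 1 = 0" "g $ 0 $ 0 = 0" "g $ 0 $ 1 = 0"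
    unfolding b_nth g_nth nb_def ng_def by (rule tri_solve_zero; simp add: d_def)+
  have b01: "b $ 1 $ 0 = h * (R2 s $ 0 $ 1 - R3 s $ 1 $ 0)" and g01: "g $ 1 $ 0 = R3 s $ 0 $ 1 + na s"
    unfolding b_nth g_nth nb_def ng_def by (simp_all add: d_def)
  have dw: "of_nat (i + j - 1) * (d i j * z) = z" if "2 \<le> i + j" for i j z
    using that of_nat_scal_inverse [of "i + j - 1" z] by (simp add: d_def)
  have pred: "(of_nat (i + j) :: 'a) = of_nat (i + j - 1) + 1" if "2 \<le> i + j" for i j
  proof -
    have "i + j = Suc (i + j - 1)" using that by linarith
    then show ?thesis by (metis of_nat_Suc add.commute)
  qed
  have cc_mult_nth: "(cc z * f) $ j $ i = z * f $ j $ i" for z f i j by simp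
  have high: "(cc z * mon 1 0) $ j $ i = 0" "(cc z * mon 0 1) $ j $ i = 0" "cc z $ j $ i = 0"
    if "2 \<le> i + j" for i j z
    using that by (auto simp: mon_nth)
  have half: "h * z + h * z = z" for z unfolding h_def by (rule scal_half)
  have E2: "vlin b - b = R2 s + cc (al s) * mon 1 0 + cc (T1 s) - cc (T3 s) * mon 0 1"
  proof (intro fps_ext)
    fix i j :: nat
    consider "i = 0" "j = 0" | "i = 1" "j = 0" | "i = 0" "j = 1" | "2 \<le> i + j" by linarith
    then show "(vlin b - b) $ j $ i = (R2 s + cc (al s) * mon 1 0 + cc (T1 s) - cc (T3 s) * mon 0 1) $ j $ i"
    proof cases
      case 1
      then show ?thesis by (simp add: vlin_nth cc_nth mon_nth low T1)
    next
      case 2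
      have "b $ 1 $ 0 = R2 s $ 0 $ 1 + al s"
        using half [of "R2 s $ 0 $ 1"] unfolding b01 al na_def by (simp add: algebra_simps)
      then show ?thesis using 2 low by (simp add: vlin_nth cc_nth mon_nth)
    next
      case 3
      then show ?thesis by (simp add: vlin_nth cc_nth mon_nth T3)
    next
      case 4
      have "of_nat (i + j - 1) * nb s i j + (if i = 0 then 0 else of_nat (Suc j) * nb s (i - 1) (Suc j)) = R2 s $ j $ i"
        unfolding nb_def using tri_solve_eq [of "of_nat (i + j - 1)" d i j, OF dw [OF 4]] 4 by simp
      then have "vlin b $ j $ i = R2 s $ j $ i + b $ j $ i"
        unfolding vlin_nth pred [OF 4] b_nth distrib_right mult_1 by (simp only: ac_simps)
      then show ?thesis by (simp only: fps_add_nth fps_sub_nth high [OF 4]) simp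
    qed
  qed
  have E3: "vlin g - g - b = R3 s + cc (al s) * (mon 1 0 + mon 0 1) + cc (T2 s)"
  proof (intro fps_ext)
    fix i j :: nat
    consider "i = 0" "j = 0" | "i = 1" "j = 0" | "i = 0" "j = 1" | "2 \<le> i + j" by linarith
    then show "(vlin g - g - b) $ j $ i = (R3 s + cc (al s) * (mon 1 0 + mon 0 1) + cc (T2 s)) $ j $ i"
    proof cases
      case 1
      then show ?thesis by (simp add: vlin_nth cc_nth mon_nth low T2)
    next
      case 2
      then show ?thesis using low by (simp add: vlin_nth cc_nth mon_nth g01 [simplified] al)
    next
      case 3
      have "- (b $ 1 $ 0) = R3 s $ 1 $ 0 + al s"
        using half [of "R3 s $ 1 $ 0"] unfolding b01 al na_def by (simp add: algebra_simps)
      then show ?thesis using 3 by (simp add: vlin_nth cc_nth mon_nth)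
    next
      case 4
      have "of_nat (i + j - 1) * ng s i j + (if i = 0 then 0 else of_nat (Suc j) * ng s (i - 1) (Suc j))
          = R3 s $ j $ i + nb s i j"
        unfolding ng_def using tri_solve_eq [of "of_nat (i + j - 1)" d i j, OF dw [OF 4]] 4 by simp
      then have "vlin g $ j $ i = R3 s $ j $ i + b $ j $ i + g $ j $ i"
        unfolding vlin_nth pred [OF 4] b_nth g_nth distrib_right mult_1 by (simp only: ac_simps)
      then show ?thesis by (simp only: fps_add_nth fps_sub_nth distrib_left high [OF 4]) simp
    qed
  qed
  have U: "vf X Y f = vlin f + vf m2 m3 f" for f
    by (simp add: vlin_def vf_def m2_def m3_def algebra_simps)
  have vm: "vlin (mon 1 0) = mon 1 0" "vlin (mon 0 1) = mon 1 0 + mon 0 1"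
      "vf m2 m3 (mon 1 0) = m2" "vf m2 m3 (mon 0 1) = m3"
    by (simp_all only: vlin_def vf_def dx_mon mult_1 mult_zero_left add_0_left add_0_right)
  have Va: "vlin (f + f') = vlin f + vlin f'" for f f' :: "'a fps fps" by (simp add: vlin_def vf_add)
  have x_eq: "vf X Y (mon 1 0 + b) = (1 + cc (al s)) * (mon 1 0 + b + cc (T1 s) - cc (T3 s) * (mon 0 1 + g))"
  proof -
    have "vlin b = b + (R2 s + cc (al s) * mon 1 0 + cc (T1 s) - cc (T3 s) * mon 0 1)"
      unfolding E2 [symmetric] by simp
    then show ?thesis
      unfolding U Va vf_add vm R2_def b_def [symmetric] g_def [symmetric]
      by (simp only: distrib_left distrib_right right_diff_distrib mult_1 mult.assoc) (simp only: algebra_simps)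
  qed
  have y_eq: "vf X Y (mon 0 1 + g) = (1 + cc (al s)) * ((mon 1 0 + b) + (mon 0 1 + g) + cc (T2 s))"
  proof -
    have "vlin g = g + b + (R3 s + cc (al s) * (mon 1 0 + mon 0 1) + cc (T2 s))"
      unfolding E3 [symmetric] by simp
    then show ?thesis
      unfolding U Va vf_add vm R3_def b_def [symmetric] g_def [symmetric]
      by (simp only: distrib_left distrib_right right_diff_distrib mult_1 mult.assoc) (simp only: algebra_simps)
  qed
  have sK: "s (k, i, j) \<in> homog B 0" "s (k, i, j) \<in> max_ideal B" for k i j
    using s(1) by (auto simp: K_def)
  show ?thesis
  proof (rule that [OF _ _ _ _ _ _ _ _ _ _ _ _ _ _ _ _ x_eq y_eq])
    show "series_homog 0 (mon 1 0 + b)" "series_homog 0 (mon 0 1 + g)"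
      using K [OF s(1)] by (simp_all add: b_def g_def series_homog_add series_homog_mon)
    show "series_mp 1 (mon 1 0 + b - mon 1 0)" "series_mp 1 (mon 0 1 + g - mon 0 1)"
      using K [OF s(1)] by (simp_all add: b_def g_def)
  qed (use low in \<open>simp_all add: mon_nth al_def T1_def T2_def T3_def sK\<close>)
qed

text \<open>On series without constant term the weight of \<open>vlin\<close> is the degree, which
  is never zero.\<close>

lemma vlin_mp_0:
  assumes "f $ 0 $ 0 = 0" "series_mp n (vlin f)"
  shows "series_mp n f"
proof -
  have "f $ j $ i \<in> mp n" for i j
  proof (cases "i + j = 0")
    case False
    show ?thesis
    proof (rule tri_inject [of "i + j" "i + j" "\<lambda>i j. f $ j $ i"])
      fix i' j' assume "i' + j' = i + j"
      then show "of_nat (i + j) * f $ j' $ i' + (if i' = 0 then 0 else of_nat (Suc j') * f $ Suc j' $ (i' - 1)) \<in> mp n"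
        using assms(2) vlin_nth [of f j' i'] unfolding series_mp_def by metis
    qed (use False in auto)
  qed (simp add: assms)
  then show ?thesis by (simp add: series_mp_def)
qed

text \<open>The constant \<open>a\<close> is the obstruction: \<open>vlin\<close> is invertible in
  positive degrees and kills constants. The difference between the field and \<open>vlin\<close> is
  small and is absorbed by a fixed point iteration.\<close>

lemma vf_solve:
  assumes small: "series_mp 1 (X - mon 1 0)" "series_mp 1 (Y - (mon 1 0 + mon 0 1))"
    and even: "series_homog 0 X" "series_homog 0 Y" and r: "series_homog p r" "series_mp 1 r"
  obtains f a where "series_homog p f" "series_mp 1 f" "f $ 0 $ 0 = 0" "a \<in> max_ideal B"
    "vf X Y f = cc a - r"
proof -
  define m2 where "m2 = X - mon 1 0"
  define m3 where "m3 = Y - (mon 1 0 + mon 0 1)"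
  have hm: "series_homog 0 m2" "series_homog 0 m3" and sm: "series_mp 1 m2" "series_mp 1 m3"
    using even small by (simp_all add: m2_def m3_def series_homog_diff series_homog_add series_homog_mon)
  define ser where "ser s = Abs_fps (\<lambda>j. Abs_fps (\<lambda>i. s (i, j)))" for s :: "nat \<times> nat \<Rightarrow> 'a"
  define d where "d i j = (if i + j = 0 then 0 else scal B (inverse (of_nat (i + j))))" for i j :: nat
  define R where "R s = - r - vf m2 m3 (ser s)" for s
  define T where "T s = (\<lambda>(i, j). tri_solve d (\<lambda>i j. R s $ j $ i) i j)" for s
  let ?par = "\<lambda>_ :: nat \<times> nat. p"
  define K where "K = {s. \<forall>i. s i \<in> homog B (?par i) \<and> s i \<in> max_ideal B}"
  have K: "series_homog p (ser s)" "series_mp 1 (ser s)" if "s \<in> K" for s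
    using that by (auto simp: K_def ser_def series_homog_def series_mp_def)
  have dh: "d i j \<in> homog B 0" for i j
    by (auto simp: d_def scal_even homog_zero)
  have R: "series_homog p (R s)" "series_mp 1 (R s)" if "s \<in> K" for s
    using K [OF that] r hm sm series_homog_vf [of p "ser s" 0 m2 m3] unfolding R_def
    by (auto intro!: series_homog_diff series_homog_uminus series_mp_diff series_mp_uminus
        simp: vf_def series_mp_left series_mp_add)
  have maps: "T s \<in> K" if "s \<in> K" for s
    using R [OF that] tri_solve_homog [of d "\<lambda>i j. R s $ j $ i" p] tri_solve_mp [of "\<lambda>i j. R s $ j $ i" 1 d] dh
    by (auto simp: K_def T_def series_homog_def series_mp_def)
  have contr: "T s i - T s' i \<in> mp (Suc n)"
    if s: "s \<in> K" "s' \<in> K" and c: "\<And>i. s i - s' i \<in> mp n" for s s' n i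
  proof -
    have "series_mp n (ser s - ser s')" using c by (simp add: series_mp_def ser_def)
    then have "series_mp (Suc n) (vf m2 m3 (ser s - ser s'))" using sm by (rule series_mp_vf)
    then have "series_mp (Suc n) (- (R s - R s'))" by (simp add: R_def vf_diff)
    then have "R s $ j $ i - R s' $ j $ i \<in> mp (Suc n)" for i j
      unfolding series_mp_def by (metis fps_neg_nth fps_sub_nth mp_uminus_iff)
    then show ?thesis by (cases i) (simp add: T_def tri_solve_cong)
  qed
  obtain s where s: "s \<in> K" "T s = s"
    using contraction_fixpoint [of ?par T] maps contr unfolding K_def by blast
  define f where "f = ser s"
  have f_nth: "f $ j $ i = tri_solve d (\<lambda>i j. R s $ j $ i) i j" for i j
    using fun_cong [OF s(2), of "(i, j)"] by (simp add: f_def ser_def T_def)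
  have f0: "f $ 0 $ 0 = 0" unfolding f_nth by (rule tri_solve_zero) (simp add: d_def)
  have V: "vlin f = R s - cc (R s $ 0 $ 0)"
  proof (intro fps_ext)
    fix i j :: nat
    show "vlin f $ j $ i = (R s - cc (R s $ 0 $ 0)) $ j $ i"
    proof (cases "i + j = 0")
      case False
      have "of_nat (i + j) * (d i j * z) = z" for z
        unfolding d_def if_not_P [OF False] by (rule of_nat_scal_inverse [OF False])
      then show ?thesis
        using tri_solve_eq [of "of_nat (i + j)" d i j "\<lambda>i j. R s $ j $ i"] False
        unfolding vlin_nth f_nth fps_sub_nth cc_nth by auto
    qed (simp add: vlin_nth cc_nth f0)
  qed
  have "vf X Y f = vlin f + vf m2 m3 f"
    by (simp add: vlin_def vf_def m2_def m3_def algebra_simps)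
  then have "vf X Y f = cc (- R s $ 0 $ 0) - r"
    unfolding V by (simp add: R_def f_def)
  moreover have "- R s $ 0 $ 0 \<in> max_ideal B"
    using R [OF s(1)] by (auto simp: series_mp_def max_ideal_iff aug_uminus)
  ultimately show ?thesis
    using that [of f "- R s $ 0 $ 0"] K [OF s(1)] f0 by (simp add: f_def)
qed

end


section \<open>Normal form of an odd vector field of square zero\<close>

text \<open>
  The next two identities extract from the components of \<open>D\<^sup>2 = 0\<close> the errors \<open>e2\<close>, \<open>e3\<close> by which
  the components of \<open>D\<close> free of the odd coordinate differ from those of the normal form.
\<close>

lemma square_identity_x:
  fixes c :: "'a::ring_1"
  assumes E: "Ue2 + H2 * (c * u) - T3 * H1 * (c * w) + (c * u - T3 * (c * w)) * c0 + u * (La - c * Z1)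
      + c * u * Z1 - c * (e2 + (H2 * x - T3 * H1 * y + u * c0) - T3 * (e3 + (H1 * x + H2 * y + w * c0))) = 0"
    and uw: "u = x + T1 - T3 * y" "w = x + y + T2"
    and comm: "H2 * c = c * H2" "H1 * c = c * H1" "T3 * c = c * T3" "u * c = c * u" "H2 * T3 = T3 * H2"
  shows "Ue2 + u * La - c * (e2 - T3 * e3) + c * (H2 * T1 - T3 * H1 * T2) = 0"
proof -
  have l: "H2 * (c * f) = c * (H2 * f)" "H1 * (c * f) = c * (H1 * f)" "T3 * (c * f) = c * (T3 * f)"
      "u * (c * f) = c * (u * f)" "H2 * (T3 * f) = T3 * (H2 * f)" for f
    using comm by (metis mult.assoc)+
  have s1: "H2 * (c * u) = c * (H2 * x + H2 * T1 - T3 * (H2 * y))"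
    unfolding l(1) uw by (simp add: distrib_left right_diff_distrib l(5))
  have s2: "T3 * H1 * (c * w) = c * (T3 * (H1 * x) + T3 * (H1 * y) + T3 * (H1 * T2))"
    unfolding mult.assoc l uw by (simp add: distrib_left)
  have s3: "(c * u - T3 * (c * w)) * c0 = c * (u * c0) - c * (T3 * (w * c0))"
    unfolding l by (simp add: left_diff_distrib mult.assoc)
  have s4: "u * (La - c * Z1) = u * La - c * (u * Z1)"
    by (simp add: right_diff_distrib l)
  show ?thesis
    using E unfolding s1 s2 s3 s4 by (simp add: distrib_left right_diff_distrib mult.assoc l algebra_simps)
qed

lemma square_identity_y:
  fixes c :: "'a::ring_1"
  assumes E: "Ue3 + H1 * (c * u) + H2 * (c * w) + (c * u + c * w) * c0 + w * (La - c * Z1)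
      + c * w * Z1 - c * (e2 + (H2 * x - T3 * H1 * y + u * c0) + (e3 + (H1 * x + H2 * y + w * c0))) = 0"
    and uw: "u = x + T1 - T3 * y" "w = x + y + T2"
    and comm: "H2 * c = c * H2" "H1 * c = c * H1" "w * c = c * w" "H1 * T3 = T3 * H1"
  shows "Ue3 + w * La - c * (e2 + e3) + c * (H1 * T1 + H2 * T2) = 0"
proof -
  have l: "H2 * (c * f) = c * (H2 * f)" "H1 * (c * f) = c * (H1 * f)"
      "w * (c * f) = c * (w * f)" "H1 * (T3 * f) = T3 * (H1 * f)" for f
    using comm by (metis mult.assoc)+
  have s1: "H1 * (c * u) = c * (H1 * x + H1 * T1 - T3 * (H1 * y))"
    unfolding l(2) uw by (simp add: distrib_left right_diff_distrib l(4))
  have s2: "H2 * (c * w) = c * (H2 * x + H2 * y + H2 * T2)"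
    unfolding l(1) uw by (simp add: distrib_left)
  have s4: "w * (La - c * Z1) = w * La - c * (w * Z1)"
    by (simp add: right_diff_distrib l)
  show ?thesis
    using E unfolding s1 s2 s4 by (simp add: distrib_left distrib_right right_diff_distrib mult.assoc l algebra_simps)
qed

context augmented_local_algebra
begin

text \<open>In degree at least two the weight i + j - 1 is nonzero and the errors gain one power. In
  degree one, the x-coefficient of the first equation is (e2)_01 + la and the y-coefficient of the
  second is la - (e2)_01; their sum is 2 la, and the other degree-one errors follow.\<close>

lemma normal_form_step:
  assumes e: "series_mp n e2" "series_mp n e3" and la: "la \<in> mp n"
    and zero: "e2 $ 0 $ 0 = 0" "e3 $ 0 $ 0 = 0" "e2 $ 0 $ 1 = 0" "e3 $ 0 $ 1 = 0"
    and eq2: "\<And>i j. i + j \<noteq> 0 \<Longrightarrow> (vlin e2 + mon 1 0 * cc la - e2) $ j $ i \<in> mp (Suc n)"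
    and eq3: "\<And>i j. i + j \<noteq> 0 \<Longrightarrow> (vlin e3 + (mon 1 0 + mon 0 1) * cc la - (e2 + e3)) $ j $ i \<in> mp (Suc n)"
  shows "series_mp (Suc n) e2" "series_mp (Suc n) e3" "la \<in> mp (Suc n)"
proof -
  have mm: "(mon a b * cc la) $ j $ i = (if i = a \<and> j = b then la else 0)" for a b i j
    by (auto simp: mon_nth)
  have 1: "e2 $ 1 $ 0 + la \<in> mp (Suc n)"
    using eq2 [of 1 0] zero by (simp add: vlin_nth mon_nth)
  have 2: "la - e2 $ 1 $ 0 \<in> mp (Suc n)"
    using eq3 [of 0 1] by (simp add: vlin_nth mon_nth distrib_right)
  have "of_nat 2 * la \<in> mp (Suc n)"
    using mp_add [OF 1 2] by (simp add: mult_2 add.commute)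
  then show la': "la \<in> mp (Suc n)" by (rule mp_of_nat_cancel [rotated]) simp
  have e2': "e2 $ 1 $ 0 \<in> mp (Suc n)" using mp_diff [OF 1 la'] by simp
  have e3': "e3 $ 1 $ 0 \<in> mp (Suc n)"
    using mp_diff [OF eq3 [of 1 0] la'] zero by (simp add: vlin_nth mon_nth distrib_right)
  have pred: "(of_nat (i + j) :: 'a) = of_nat (i + j - 1) + 1" if "2 \<le> i + j" for i j
  proof -
    have "i + j = Suc (i + j - 1)" using that by linarith
    then show ?thesis by (metis of_nat_Suc add.commute)
  qed
  have high: "f $ j $ i \<in> mp (Suc n)"
    if f: "\<And>i j. 2 \<le> i + j \<Longrightarrow> (vlin f - f) $ j $ i \<in> mp (Suc n)" and ij: "2 \<le> i + j" for f i j
  proof (rule tri_inject [of "i + j - 1" "i + j" "\<lambda>i j. f $ j $ i"])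
    fix i' j' assume e: "i' + j' = i + j"
    then have "2 \<le> i' + j'" using ij by simp
    then show "of_nat (i + j - 1) * f $ j' $ i' + (if i' = 0 then 0 else of_nat (Suc j') * f $ Suc j' $ (i' - 1)) \<in> mp (Suc n)"
      using f [of i' j'] unfolding e [symmetric] fps_sub_nth vlin_nth pred [OF \<open>2 \<le> i' + j'\<close>]
      by (simp add: distrib_right algebra_simps del: of_nat_Suc of_nat_add)
  qed (use ij in auto)
  have low: "(mon 1 0 * cc la) $ j $ i = 0" "(mon 0 1 * cc la) $ j $ i = 0" if "2 \<le> i + j" for i j :: nat
    using that by (auto simp: mon_nth)
  have h2: "e2 $ j $ i \<in> mp (Suc n)" if "2 \<le> i + j" for i j
  proof (rule high [OF _ that])
    fix i j :: nat assume ij: "2 \<le> i + j"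
    then have "i + j \<noteq> 0" by linarith
    from eq2 [OF this] show "(vlin e2 - e2) $ j $ i \<in> mp (Suc n)"
      by (simp only: fps_add_nth fps_sub_nth low [OF ij] add_0_right)
  qed
  have h3: "e3 $ j $ i \<in> mp (Suc n)" if "2 \<le> i + j" for i j
  proof (rule high [OF _ that])
    fix i j :: nat assume ij: "2 \<le> i + j"
    then have "i + j \<noteq> 0" by linarith
    from eq3 [OF this] have "(vlin e3 - (e2 + e3)) $ j $ i \<in> mp (Suc n)"
      by (simp only: fps_add_nth fps_sub_nth distrib_right low [OF ij] add_0_right)
    then show "(vlin e3 - e3) $ j $ i \<in> mp (Suc n)"
      using mp_add [OF _ h2 [OF ij], of "(vlin e3 - (e2 + e3)) $ j $ i"] by (simp add: algebra_simps)
  qed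
  have cases: "i + j \<ge> 2 \<or> (i = 0 \<and> j = 0) \<or> (i = 1 \<and> j = 0) \<or> (i = 0 \<and> j = 1)" for i j :: nat
    by linarith
  have "e2 $ j $ i \<in> mp (Suc n) \<and> e3 $ j $ i \<in> mp (Suc n)" for i j
    using cases [of i j] h2 [of i j] h3 [of i j] e2' e3' zero mp_zero [of "Suc n"] by auto
  then show "series_mp (Suc n) e2" "series_mp (Suc n) e3" by (simp_all add: series_mp_def)
qed

end

context formal_algebra
begin

lemma series_mp_all_zero: "(\<And>n. series_mp n f) \<Longrightarrow> f = 0"
  by (intro fps_ext) (simp add: series_mp_def mp_all_zero)

lemma vf_mp_approx:
  assumes "series_mp 1 (X - mon 1 0)" "series_mp 1 (Y - (mon 1 0 + mon 0 1))" "series_mp n f"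
  shows "series_mp (Suc n) (vf X Y f - vlin f)"
proof -
  have "vf X Y f - vlin f = vf (X - mon 1 0) (Y - (mon 1 0 + mon 0 1)) f"
    by (simp add: vlin_def vf_def algebra_simps)
  then show ?thesis using assms by (simp add: series_mp_vf)
qed

text \<open>Here D has components X0 + X1 xi, Y0 + Y1 xi, Z0 + Z1 xi, and \<open>square\<close> is
  the xi-part of D applied twice to f0 + f1 xi. The new coordinates are \<open>x\<close>,
  \<open>y\<close> and \<open>c0\<close> + (1 + a) xi; the two equations for \<open>c0\<close> say
  that D annihilates the last one.\<close>

lemma normal_form:
  assumes par: "series_homog 1 X0" "series_homog 0 X1" "series_homog 1 Y0" "series_homog 0 Y1"
      "series_homog 0 Z0" "series_homog 1 Z1"
    and const: "X0 $ 0 $ 0 = 0" "Y0 $ 0 $ 0 = 0" "Z0 $ 0 $ 0 = 0"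
    and small: "series_mp 1 (X1 - mon 1 0)" "series_mp 1 (Y1 - (mon 1 0 + mon 0 1))" "series_mp 1 Z1"
    and square: "\<And>f0 f1. f0 $ 0 $ 0 = 0 \<Longrightarrow>
      vf X1 Y1 (vf X0 Y0 f0 + f1 * Z0) + (vf X1 Y1 f0 + f1 * Z1 - vf X0 Y0 f1) * Z1
        - vf X0 Y0 (vf X1 Y1 f0 + f1 * Z1 - vf X0 Y0 f1) = 0"
  obtains x y c0 a t1 t2 t3 h1 h2 where
    "series_homog 0 x" "series_homog 0 y" "series_homog 1 c0"
    "series_mp 1 (x - mon 1 0)" "series_mp 1 (y - mon 0 1)" "series_mp 1 c0"
    "x $ 0 $ 0 = 0" "y $ 0 $ 0 = 0" "c0 $ 0 $ 0 = 0"
    "a \<in> homog B 0" "t1 \<in> homog B 0" "t2 \<in> homog B 0" "t3 \<in> homog B 0" "h1 \<in> homog B 1" "h2 \<in> homog B 1"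
    "a \<in> max_ideal B" "t1 \<in> max_ideal B" "t2 \<in> max_ideal B" "t3 \<in> max_ideal B"
    "vf X0 Y0 x = cc h2 * x - cc t3 * cc h1 * y + (x + cc t1 - cc t3 * y) * c0"
    "vf X0 Y0 y = cc h1 * x + cc h2 * y + (x + y + cc t2) * c0"
    "vf X1 Y1 x = (1 + cc a) * (x + cc t1 - cc t3 * y)"
    "vf X1 Y1 y = (1 + cc a) * (x + y + cc t2)"
    "vf X0 Y0 c0 + (1 + cc a) * Z0 = 0" "vf X1 Y1 c0 + (1 + cc a) * Z1 = 0"
    "t1 * h1 + t2 * h2 = 0" "- (t1 * h2) + t2 * t3 * h1 = 0"
proof -
  obtain x y a t1 t2 t3 where
    hx: "series_homog 0 x" "series_homog 0 y" and sx: "series_mp 1 (x - mon 1 0)" "series_mp 1 (y - mon 0 1)"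
    and x0: "x $ 0 $ 0 = 0" "y $ 0 $ 0 = 0" and x1: "x $ 0 $ 1 = 1" "y $ 0 $ 1 = 0"
    and ht: "a \<in> homog B 0" "t1 \<in> homog B 0" "t2 \<in> homog B 0" "t3 \<in> homog B 0"
    and mt: "a \<in> max_ideal B" "t1 \<in> max_ideal B" "t2 \<in> max_ideal B" "t3 \<in> max_ideal B"
    and Ux: "vf X1 Y1 x = (1 + cc a) * (x + cc t1 - cc t3 * y)"
    and Uy: "vf X1 Y1 y = (1 + cc a) * (x + y + cc t2)"
    by (rule linearisation [OF par(2,4) small(1,2)])
  define c where "c = 1 + cc a"
  have cc_def: "c = cc (1 + a)" by (simp add: c_def flip: fps_const_add)
  have hc: "series_homog 0 c"
    using ht unfolding c_def by (intro series_homog_add series_homog_1 series_homog_const)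
  have "series_homog 1 (c * Z1)" "series_mp 1 (c * Z1)"
    using hc par small by (auto intro: series_homog_mult_even series_mp_left)
  \<comment> \<open>With this \<open>c0\<close> the xi-part of D(c0 + c xi) is the constant
    \<open>la\<close>. That the obstruction \<open>la\<close> vanishes comes out of the induction
    below.\<close>
  then obtain c0 la where hc0: "series_homog 1 c0" and sc0: "series_mp 1 c0" and c00: "c0 $ 0 $ 0 = 0"
    and mla: "la \<in> max_ideal B" and Uc: "vf X1 Y1 c0 = cc la - c * Z1"
    by (rule vf_solve [OF small(1,2) par(2,4)])
  let ?U = "vf X1 Y1" and ?S = "vf X0 Y0"
  define T1 where "T1 = cc t1"
  define T2 where "T2 = cc t2"
  define T3 where "T3 = cc t3"
  define La where "La = cc la"
  define u where "u = x + T1 - T3 * y"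
  define w where "w = x + y + T2"
  have Ux: "?U x = c * u" and Uy: "?U y = c * w"
    using Ux Uy by (simp_all add: c_def u_def w_def T1_def T2_def T3_def)
  have hT: "series_homog 0 T1" "series_homog 0 T2" "series_homog 0 T3"
    using ht by (simp_all add: T1_def T2_def T3_def series_homog_const)
  have mT: "series_mp 1 T1" "series_mp 1 T2" "series_mp 1 T3"
    using mt by (simp_all add: T1_def T2_def T3_def series_mp_const)
  have hu: "series_homog 0 u" "series_homog 0 w"
    unfolding u_def w_def by (intro series_homog_add series_homog_diff series_homog_mult_even hx hT)+
  \<comment> \<open>The odd parameters are the x-coefficients of what they have to match. As
    \<open>x\<close> and \<open>y\<close> have x-coefficients 1 and 0, the errors \<open>e2\<close>
    and \<open>e3\<close> then have none, as \<open>normal_form_step\<close> requires.\<close>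
  define h2 where "h2 = (?S x - u * c0) $ 0 $ 1"
  define h1 where "h1 = (?S y - w * c0) $ 0 $ 1"
  have S_odd: "series_homog 1 (?S f)" if "series_homog 0 f" for f
    using series_homog_vf [OF that par(1,3)] by simp
  have hh: "h1 \<in> homog B 1" "h2 \<in> homog B 1"
  proof -
    have "series_homog 1 (?S x - u * c0)" "series_homog 1 (?S y - w * c0)"
      by (intro series_homog_diff S_odd hx series_homog_mult_even hu hc0)+
    then show "h1 \<in> homog B 1" "h2 \<in> homog B 1" unfolding h1_def h2_def series_homog_def by blast+
  qed
  define H1 where "H1 = cc h1"
  define H2 where "H2 = cc h2"
  define e2 where "e2 = ?S x - (H2 * x - T3 * H1 * y + u * c0)"
  define e3 where "e3 = ?S y - (H1 * x + H2 * y + w * c0)"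
  have Sx: "?S x = e2 + (H2 * x - T3 * H1 * y + u * c0)" and Sy: "?S y = e3 + (H1 * x + H2 * y + w * c0)"
    by (simp_all add: e2_def e3_def)
  have m0: "(f * g) $ 0 $ 0 = f $ 0 $ 0 * g $ 0 $ 0" for f g :: "'a fps fps"
    by (simp add: mult_nth_nth)
  have S0: "?S f $ 0 $ 0 = 0" for f
    using const by (simp add: vf_def m0)
  have zero: "e2 $ 0 $ 0 = 0" "e3 $ 0 $ 0 = 0" "e2 $ 0 $ 1 = 0" "e3 $ 0 $ 1 = 0"
  proof -
    show "e2 $ 0 $ 0 = 0" "e3 $ 0 $ 0 = 0"
      by (simp_all only: e2_def e3_def fps_sub_nth fps_add_nth m0 S0 x0 c00 mult_zero_right diff_zero add_0)
    have "(H2 * x) $ 0 $ 1 = h2" "(H2 * y) $ 0 $ 1 = 0" "(H1 * x) $ 0 $ 1 = h1" "(T3 * H1 * y) $ 0 $ 1 = 0"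
      unfolding mult.assoc H1_def H2_def T3_def fps_mult_left_const_nth x1 by simp_all
    then show "e2 $ 0 $ 1 = 0" "e3 $ 0 $ 1 = 0"
      unfolding e2_def e3_def fps_sub_nth fps_add_nth h1_def h2_def by simp_all
  qed
  have Uadd: "?U (f + g) = ?U f + ?U g" "?U (f - g) = ?U f - ?U g" "?U (f * g) = ?U f * g + f * ?U g" for f g
    by (rule vf_add vf_diff vf_mult [OF par(2,4)])+
  have UT: "?U T1 = 0" "?U T2 = 0" "?U T3 = 0" "?U H1 = 0" "?U H2 = 0" "?S T1 = 0" "?S T2 = 0" "?S c = 0"
    by (simp_all add: T1_def T2_def T3_def H1_def H2_def cc_def)
  have Sc: "?S (c * f) = c * ?S f" "?S (T3 * f) = T3 * ?S f" for f
    unfolding cc_def T3_def by (rule vf_cc_mult)+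
  have sq: "?U (?S f) + ?U f * Z1 - ?S (?U f) = 0" if "f $ 0 $ 0 = 0" for f
    using square [of f 0] that by simp
  have comm: "H2 * c = c * H2" "H1 * c = c * H1" "T3 * c = c * T3" "u * c = c * u" "w * c = c * w"
      "H2 * T3 = T3 * H2" "H1 * T3 = T3 * H1"
    by (rule series_even_commute [OF hc, symmetric] series_even_commute [OF hT(3), symmetric])+
  have id2: "?U e2 + u * La - c * (e2 - T3 * e3) + c * (H2 * T1 - T3 * H1 * T2) = 0"
  proof (rule square_identity_x [OF _ u_def w_def comm(1-4) comm(6)])
    have "?U (?S x) = ?U e2 + (H2 * (c * u) - T3 * H1 * (c * w) + ((c * u - T3 * (c * w)) * c0 + u * (La - c * Z1)))"
      unfolding Sx Uadd UT Ux Uy Uc La_def by (simp add: u_def Uadd UT Ux [unfolded u_def] Uy [unfolded w_def] w_def)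
    moreover have "?S (?U x) = c * (e2 + (H2 * x - T3 * H1 * y + u * c0) - T3 * (e3 + (H1 * x + H2 * y + w * c0)))"
      unfolding Ux Sc by (subst u_def) (simp only: vf_add vf_diff UT Sc Sx Sy add_0_right)
    moreover have "p + (q - r + (s + t)) = p + q - r + s + t" for p q r s t :: "'a fps fps"
      by (simp add: algebra_simps)
    ultimately show "?U e2 + H2 * (c * u) - T3 * H1 * (c * w) + (c * u - T3 * (c * w)) * c0 + u * (La - c * Z1)
      + c * u * Z1 - c * (e2 + (H2 * x - T3 * H1 * y + u * c0) - T3 * (e3 + (H1 * x + H2 * y + w * c0))) = 0"
      using sq [OF x0(1)] unfolding Ux by (simp only:)
  qed
  have id3: "?U e3 + w * La - c * (e2 + e3) + c * (H1 * T1 + H2 * T2) = 0"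
  proof (rule square_identity_y [OF _ u_def w_def comm(1,2,5,7)])
    have "?U (?S y) = ?U e3 + (H1 * (c * u) + H2 * (c * w) + ((c * u + c * w) * c0 + w * (La - c * Z1)))"
      unfolding Sy Uadd UT Ux Uy Uc La_def by (simp add: w_def Uadd UT Ux Uy [unfolded w_def])
    moreover have "?S (?U y) = c * (e2 + (H2 * x - T3 * H1 * y + u * c0) + (e3 + (H1 * x + H2 * y + w * c0)))"
      unfolding Uy Sc by (subst w_def) (simp only: vf_add UT Sx Sy add_0_right)
    moreover have "p + (q + r + (s + t)) = p + q + r + s + t" for p q r s t :: "'a fps fps"
      by (simp add: algebra_simps)
    ultimately show "?U e3 + H1 * (c * u) + H2 * (c * w) + (c * u + c * w) * c0 + w * (La - c * Z1)
      + c * w * Z1 - c * (e2 + (H2 * x - T3 * H1 * y + u * c0) + (e3 + (H1 * x + H2 * y + w * c0))) = 0"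
      using sq [OF x0(2)] unfolding Uy by (simp only:)
  qed
  \<comment> \<open>The constants left over in \<open>id2\<close> and \<open>id3\<close>. Up to
    order and sign they are the two relations of the base.\<close>
  define r where "r = h2 * t1 - t3 * h1 * t2"
  define q where "q = h1 * t1 + h2 * t2"
  have K2: "c * (H2 * T1 - T3 * H1 * T2) = cc ((1 + a) * r)" and K3: "c * (H1 * T1 + H2 * T2) = cc ((1 + a) * q)"
    by (simp_all add: cc_def H1_def H2_def T1_def T2_def T3_def r_def q_def)
  \<comment> \<open>The three errors gain powers together. Modulo the next power, \<open>id2\<close>
    and \<open>id3\<close> become linear: the field may be replaced by \<open>vlin\<close>,
    \<open>u\<close> and \<open>w\<close> by x and x + y, \<open>c\<close> by 1, and the term with
    \<open>T3\<close> and \<open>e3\<close> drops out.\<close>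
  have "series_mp n e2 \<and> series_mp n e3 \<and> la \<in> mp n" for n
  proof (induction n)
    case 0
    show ?case by (simp add: series_mp_def)
  next
    case (Suc n)
    then have e: "series_mp n e2" "series_mp n e3" and l: "la \<in> mp n" by simp_all
    have mc: "series_mp (Suc n) (c * f - f)" if "series_mp n f" for f
    proof -
      have "c * f - f = cc a * f" by (simp add: c_def distrib_right)
      then show ?thesis using that mt by (simp add: series_mp_Suc_left series_mp_const)
    qed
    have su: "series_mp 1 (u - mon 1 0)" "series_mp 1 (w - (mon 1 0 + mon 0 1))"
    proof -
      have "u - mon 1 0 = (x - mon 1 0) + T1 - T3 * y" "w - (mon 1 0 + mon 0 1) = (x - mon 1 0) + (y - mon 0 1) + T2"
        by (simp_all add: u_def w_def)
      then show "series_mp 1 (u - mon 1 0)" "series_mp 1 (w - (mon 1 0 + mon 0 1))"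
        using sx mT by (simp_all only: series_mp_add series_mp_diff series_mp_right)
    qed
    have sLa: "series_mp n La" using l by (simp add: La_def series_mp_const)
    have "vlin e2 + mon 1 0 * La - e2 + cc ((1 + a) * r) =
        - (?U e2 - vlin e2) - (u - mon 1 0) * La + (c * e2 - e2) - c * (T3 * e3)"
      using id2 unfolding K2 by (simp add: algebra_simps)
    moreover have "series_mp (Suc n) \<dots>"
      by (intro series_mp_add series_mp_diff series_mp_uminus vf_mp_approx small e mc series_mp_left [of _ "T3 * e3"]
          series_mp_Suc_left [OF sLa] series_mp_Suc_left [OF _ mT(3)] su)
    ultimately have s2: "series_mp (Suc n) (vlin e2 + mon 1 0 * La - e2 + cc ((1 + a) * r))" by (simp only:)
    have "vlin e3 + (mon 1 0 + mon 0 1) * La - (e2 + e3) + cc ((1 + a) * q) =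
        - (?U e3 - vlin e3) - (w - (mon 1 0 + mon 0 1)) * La + (c * (e2 + e3) - (e2 + e3))"
      using id3 unfolding K3 by (simp add: algebra_simps)
    moreover have "series_mp (Suc n) \<dots>"
      by (intro series_mp_add series_mp_diff series_mp_uminus vf_mp_approx small e mc
          series_mp_Suc_left [OF sLa] su)
    ultimately have s3: "series_mp (Suc n) (vlin e3 + (mon 1 0 + mon 0 1) * La - (e2 + e3) + cc ((1 + a) * q))" by (simp only:)
    \<comment> \<open>Only nonconstant coefficients are used, since the constant terms still carry
      \<open>r\<close> and \<open>q\<close>, which are shown to vanish after the induction.\<close>
    have c2: "(vlin e2 + mon 1 0 * cc la - e2) $ j $ i \<in> mp (Suc n)" if "i + j \<noteq> 0" for i j
    proof -
      have "(vlin e2 + mon 1 0 * La - e2 + cc ((1 + a) * r)) $ j $ i \<in> mp (Suc n)"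
        using s2 unfolding series_mp_def by blast
      moreover have "cc ((1 + a) * r) $ j $ i = 0" using that by auto
      ultimately show ?thesis by (simp only: fps_add_nth La_def add_0_right)
    qed
    have c3: "(vlin e3 + (mon 1 0 + mon 0 1) * cc la - (e2 + e3)) $ j $ i \<in> mp (Suc n)" if "i + j \<noteq> 0" for i j
    proof -
      have "(vlin e3 + (mon 1 0 + mon 0 1) * La - (e2 + e3) + cc ((1 + a) * q)) $ j $ i \<in> mp (Suc n)"
        using s3 unfolding series_mp_def by blast
      moreover have "cc ((1 + a) * q) $ j $ i = 0" using that by auto
      ultimately show ?thesis unfolding La_def fps_add_nth by (simp only: add_0_right)
    qed
    show ?case using normal_form_step [OF e l zero c2 c3] by blast
  qed
  then have e0: "e2 = 0" "e3 = 0" "la = 0"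
    by (auto intro: series_mp_all_zero mp_all_zero)
  \<comment> \<open>From z = - a z it follows that z lies in every power of the maximal
    ideal.\<close>
  have unit: "z = 0" if "(1 + a) * z = 0" for z
  proof (rule mp_all_zero)
    fix n
    have z: "z = - (a * z)" using that by (simp add: distrib_right eq_neg_iff_add_eq_0)
    show "z \<in> mp n"
    proof (induction n)
      case (Suc n)
      then show ?case by (subst z) (intro mp_uminus mp_Suc_mult_left mt)
    qed simp
  qed
  have "cc ((1 + a) * r) = 0" "cc ((1 + a) * q) = 0"
    using id2 id3 unfolding K2 K3 e0 La_def by simp_all
  then have r0: "r = 0" and q0: "q = 0"
    using unit by (simp_all add: fps_const_eq_0_iff)
  \<comment> \<open>The part of D(c0 + c xi) free of xi. Its xi-part is already zero, so
    \<open>square\<close> says that the even field annihilates \<open>A0\<close>; a series without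
    constant term that it annihilates is zero.\<close>
  define A0 where "A0 = ?S c0 + c * Z0"
  have "?U A0 = 0"
  proof -
    have U0: "?U c0 + c * Z1 - ?S c = 0" unfolding Uc e0 UT by simp
    show ?thesis using square [OF c00, of c] unfolding A0_def U0 by simp
  qed
  moreover have "A0 $ 0 $ 0 = 0" unfolding A0_def fps_add_nth S0 m0 const by simp
  ultimately have "series_mp n A0" for n
  proof (induction n)
    case 0
    show ?case by (simp add: series_mp_def)
  next
    case (Suc n)
    have "series_mp (Suc n) (- vlin A0)"
      using vf_mp_approx [OF small(1,2) Suc.IH [OF Suc.prems]] Suc.prems(1) by simp
    then have "series_mp (Suc n) (vlin A0)" using series_mp_uminus by fastforce
    then show ?case by (rule vlin_mp_0 [OF Suc.prems(2)])
  qed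
  then have A0: "A0 = 0" by (rule series_mp_all_zero)
  have rel: "t1 * h1 + t2 * h2 = 0" "- (t1 * h2) + t2 * t3 * h1 = 0"
  proof -
    show "t1 * h1 + t2 * h2 = 0"
      using q0 even_commute [OF ht(2), of h1] even_commute [OF ht(3), of h2] by (simp add: q_def)
    have "t3 * h1 * t2 = t2 * t3 * h1"
      using even_commute [OF ht(3), of "t3 * h1"] by (simp add: mult.assoc)
    then show "- (t1 * h2) + t2 * t3 * h1 = 0"
      using r0 even_commute [OF ht(2), of h2] by (simp add: r_def)
  qed
  show ?thesis
  proof (rule that [OF hx hc0 sx sc0 x0 c00 ht hh mt _ _ _ _ _ _ rel])
    show "?S x = cc h2 * x - cc t3 * cc h1 * y + (x + cc t1 - cc t3 * y) * c0"
      using Sx unfolding e0 by (simp only: add_0 H1_def H2_def T3_def T1_def u_def)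
    show "?S y = cc h1 * x + cc h2 * y + (x + y + cc t2) * c0"
      using Sy unfolding e0 by (simp only: add_0 H1_def H2_def T2_def w_def)
    show "?U x = (1 + cc a) * (x + cc t1 - cc t3 * y)"
      using Ux by (simp only: c_def u_def T1_def T3_def)
    show "?U y = (1 + cc a) * (x + y + cc t2)"
      using Uy by (simp only: c_def w_def T2_def)
    show "?S c0 + (1 + cc a) * Z0 = 0"
      using A0 by (simp only: A0_def c_def)
    show "?U c0 + (1 + cc a) * Z1 = 0"
      using Uc unfolding e0 by (simp add: c_def)
  qed
qed

end


declare fps_mult_nth_0 [simp del] fps_mult_nth_1 [simp del]

section \<open>The filtration by order on \<open>\<complex>[[t\<^sub>1, t\<^sub>2, t\<^sub>3]]\<close>\<close>

type_synonym ser3 = "complex fps fps fps"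

definition fil :: "nat \<Rightarrow> ser3 set" where
  "fil n = {f. \<forall>i j k. i + j + k < n \<longrightarrow> f $ k $ j $ i = 0}"

definition x1 :: ser3 where "x1 = fps_const (fps_const fps_X)"
definition x2 :: ser3 where "x2 = fps_const fps_X"
definition x3 :: ser3 where "x3 = fps_X"

lemma filI: "(\<And>i j k. i + j + k < n \<Longrightarrow> f $ k $ j $ i = 0) \<Longrightarrow> f \<in> fil n"
  by (simp add: fil_def)

lemma filD: "f \<in> fil n \<Longrightarrow> i + j + k < n \<Longrightarrow> f $ k $ j $ i = 0"
  by (simp add: fil_def)

lemma x_mult_nth:
  "(x1 * f) $ k $ j $ i = (if i = 0 then 0 else f $ k $ j $ (i - 1))"
  "(x2 * f) $ k $ j $ i = (if j = 0 then 0 else f $ k $ (j - 1) $ i)"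
  "(x3 * f) $ k $ j $ i = (if k = 0 then 0 else f $ (k - 1) $ j $ i)"
  by (simp_all add: x1_def x2_def x3_def)

lemma fil_0 [simp]: "fil 0 = UNIV" and zero_fil [simp]: "0 \<in> fil n"
  by (simp_all add: fil_def)

lemma fil_add: "f \<in> fil n \<Longrightarrow> g \<in> fil n \<Longrightarrow> f + g \<in> fil n"
  and fil_diff: "f \<in> fil n \<Longrightarrow> g \<in> fil n \<Longrightarrow> f - g \<in> fil n"
  and fil_uminus: "f \<in> fil n \<Longrightarrow> - f \<in> fil n"
  by (simp_all add: fil_def)

lemma fil_antimono: "m \<le> n \<Longrightarrow> f \<in> fil n \<Longrightarrow> f \<in> fil m"
  by (simp add: fil_def)

lemma fil_mult:
  assumes "f \<in> fil m" "g \<in> fil n"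
  shows "f * g \<in> fil (m + n)"
proof (rule filI)
  fix i j k assume d: "i + j + k < m + n"
  have "f $ c $ b $ a * g $ (k - c) $ (j - b) $ (i - a) = 0" if "c \<le> k" "b \<le> j" "a \<le> i" for a b c
  proof -
    have "a + b + c < m \<or> (i - a) + (j - b) + (k - c) < n" using d that by linarith
    then show ?thesis using assms by (auto simp: fil_def)
  qed
  then show "(f * g) $ k $ j $ i = 0"
    unfolding fps_mult_nth fps_sum_nth by (intro sum.neutral ballI) simp
qed

lemma fil_mult_le: "f \<in> fil m \<Longrightarrow> g \<in> fil n \<Longrightarrow> l \<le> m + n \<Longrightarrow> f * g \<in> fil l"
  using fil_mult fil_antimono by blast

lemma fil_Suc_split:
  assumes "f \<in> fil (Suc n)"
  obtains f1 f2 f3 where "f1 \<in> fil n" "f2 \<in> fil n" "f3 \<in> fil n" "f = f1 * x1 + f2 * x2 + f3 * x3"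
proof
  \<comment> \<open>Each monomial is divided by the third variable if possible, otherwise by the
    second, otherwise by the first.\<close>
  define f1 where "f1 = Abs_fps (\<lambda>k. Abs_fps (\<lambda>j. Abs_fps (\<lambda>i. if k = 0 \<and> j = 0 then f $ 0 $ 0 $ Suc i else 0)))"
  define f2 where "f2 = Abs_fps (\<lambda>k. Abs_fps (\<lambda>j. Abs_fps (\<lambda>i. if k = 0 then f $ 0 $ Suc j $ i else 0)))"
  define f3 where "f3 = Abs_fps (\<lambda>k. Abs_fps (\<lambda>j. Abs_fps (\<lambda>i. f $ Suc k $ j $ i)))"
  show "f1 \<in> fil n" "f2 \<in> fil n" "f3 \<in> fil n"
    using assms by (auto intro!: filI filD [of f "Suc n"] simp: f1_def f2_def f3_def)
  show "f = f1 * x1 + f2 * x2 + f3 * x3"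
  proof (intro fps_ext)
    fix k j i
    show "f $ k $ j $ i = (f1 * x1 + f2 * x2 + f3 * x3) $ k $ j $ i"
      using filD [OF assms, of 0 0 0]
      by (cases k; cases j; cases i) (simp_all add: mult.commute [of _ x1] mult.commute [of _ x2]
          mult.commute [of _ x3] x_mult_nth f1_def f2_def f3_def)
  qed
qed

lemma fil_all_zero: "(\<And>n. f \<in> fil n) \<Longrightarrow> f = 0"
proof (intro fps_ext)
  fix k j i assume "\<And>n. f \<in> fil n"
  then have "f \<in> fil (Suc (i + j + k))" by blast
  then show "f $ k $ j $ i = 0 $ k $ j $ i" by (simp add: fil_def)
qed

lemma fil_series:
  assumes "\<And>n. f n \<in> fil (n - r)"
  obtains g where "\<And>n. g - (\<Sum>k<n. f k) \<in> fil (n - r)"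
proof
  fix n
  \<comment> \<open>In a coefficient of degree i + j + k the summands of index at least i + j + k +
    r + 1 vanish, so this finite sum is already the limit.\<close>
  define g where "g = Abs_fps (\<lambda>k. Abs_fps (\<lambda>j. Abs_fps (\<lambda>i. \<Sum>l<i + j + k + r + 1. f l $ k $ j $ i)))"
  show "Abs_fps (\<lambda>k. Abs_fps (\<lambda>j. Abs_fps (\<lambda>i. \<Sum>l<i + j + k + r + 1. f l $ k $ j $ i))) - (\<Sum>k<n. f k) \<in> fil (n - r)"
    unfolding g_def [symmetric]
  proof (rule filI)
    fix i j k assume d: "i + j + k < n - r"
    have "(\<Sum>l<n. f l $ k $ j $ i) = (\<Sum>l<i + j + k + r + 1. f l $ k $ j $ i)"
      using d by (intro sum.mono_neutral_right) (auto intro!: filD [OF assms])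
    then show "(g - (\<Sum>k<n. f k)) $ k $ j $ i = 0"
      by (simp add: g_def fps_sum_nth)
  qed
qed

text \<open>
  The relation module has generators \<open>(t\<^sub>1, t\<^sub>2)\<close> and \<open>(t\<^sub>2t\<^sub>3, -t\<^sub>1)\<close>. A combination of order \<open>n + 1\<close>
  has coefficients of order \<open>n\<close>, which makes the module closed in the adic topology.
\<close>

lemma relation_module_order:
  assumes "u * x1 + v * (x2 * x3) \<in> fil (Suc n)" "u * x2 - v * x1 \<in> fil (Suc n)"
  shows "u \<in> fil n" "v \<in> fil n"
proof -
  have 1: "(u * x1 + v * (x2 * x3)) $ k $ j $ i =
      (if i = 0 then 0 else u $ k $ j $ (i - 1)) + (if j = 0 \<or> k = 0 then 0 else v $ (k - 1) $ (j - 1) $ i)" for i j k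
    by (simp add: mult.commute [of u] mult.commute [of v] mult.assoc x_mult_nth)
  have 2: "(u * x2 - v * x1) $ k $ j $ i =
      (if j = 0 then 0 else u $ k $ (j - 1) $ i) - (if i = 0 then 0 else v $ k $ j $ (i - 1))" for i j k
    by (simp add: mult.commute [of u] mult.commute [of v] x_mult_nth)
  have "i + j + k < n \<Longrightarrow> u $ k $ j $ i = 0 \<and> v $ k $ j $ i = 0" for i j k
  \<comment> \<open>At exponent i + 1 of the first variable, the two hypotheses express the
    coefficients of u and v at (i, j, k) through coefficients whose second exponent is j - 1 and
    whose total degree is no larger.\<close>
  proof (induction j arbitrary: i k)
    case 0
    then show ?case
      using filD [OF assms(1), of "Suc i" 0 k] filD [OF assms(2), of "Suc i" 0 k] unfolding 1 2 by simp
  next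
    case (Suc j)
    have "u $ k $ j $ Suc i = 0" using Suc by simp
    moreover have "k \<noteq> 0 \<Longrightarrow> v $ (k - 1) $ j $ Suc i = 0" using Suc by simp
    ultimately show ?case
      using Suc.prems filD [OF assms(1), of "Suc i" "Suc j" k] filD [OF assms(2), of "Suc i" "Suc j" k]
      unfolding 1 2 by (simp split: if_splits)
  qed
  then show "u \<in> fil n" "v \<in> fil n" by (auto intro!: filI)
qed

text \<open>Approximations to order l have coefficients that agree to order l - 1, by
  \<open>relation_module_order\<close>. They stabilise degree by degree, and the limiting
  coefficients solve the equations exactly.\<close>

lemma relation_module_closed:
  assumes "\<And>n. \<exists>u v. b - (u * x1 + v * (x2 * x3)) \<in> fil n \<and> c - (u * x2 - v * x1) \<in> fil n"
  obtains u v where "b = u * x1 + v * (x2 * x3)" "c = u * x2 - v * x1"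
proof -
  obtain U V where UV: "b - (U n * x1 + V n * (x2 * x3)) \<in> fil n" "c - (U n * x2 - V n * x1) \<in> fil n" for n
    using assms by metis
  \<comment> \<open>A coefficient of degree i + j + k is stable once this degree is below l - 1,
    that is from l = i + j + k + 2 on.\<close>
  define u where "u = Abs_fps (\<lambda>k. Abs_fps (\<lambda>j. Abs_fps (\<lambda>i. U (i + j + k + 2) $ k $ j $ i)))"
  define v where "v = Abs_fps (\<lambda>k. Abs_fps (\<lambda>j. Abs_fps (\<lambda>i. V (i + j + k + 2) $ k $ j $ i)))"
  have stable: "U m - U l \<in> fil (l - 1)" "V m - V l \<in> fil (l - 1)" if "l \<le> m" "1 \<le> l" for l m
  proof -
    have m: "b - (U m * x1 + V m * (x2 * x3)) \<in> fil l" "c - (U m * x2 - V m * x1) \<in> fil l"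
      using UV [of m] fil_antimono [OF that(1)] by blast+
    have "(U m - U l) * x1 + (V m - V l) * (x2 * x3) \<in> fil l" "(U m - U l) * x2 - (V m - V l) * x1 \<in> fil l"
      using fil_diff [OF UV(1) m(1)] fil_diff [OF UV(2) m(2)] by (simp_all add: algebra_simps)
    then show "U m - U l \<in> fil (l - 1)" "V m - V l \<in> fil (l - 1)"
      using relation_module_order [of "U m - U l" "V m - V l" "l - 1"] that by simp_all
  qed
  have u: "u - U m \<in> fil (m - 1)" and v: "v - V m \<in> fil (m - 1)" for m
  proof -
    have "U (i + j + k + 2) $ k $ j $ i = U m $ k $ j $ i \<and> V (i + j + k + 2) $ k $ j $ i = V m $ k $ j $ i"
      if "i + j + k < m - 1" for i j k
    proof -
      have "i + j + k + 2 \<le> m" using that by simp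
      then show ?thesis
        using filD [OF stable(1), of "i + j + k + 2" m i j k] filD [OF stable(2), of "i + j + k + 2" m i j k] by simp
    qed
    then show "u - U m \<in> fil (m - 1)" "v - V m \<in> fil (m - 1)"
      by (auto intro!: filI simp: u_def v_def)
  qed
  have x: "x1 \<in> fil 0" "x2 \<in> fil 0" "x2 * x3 \<in> fil 0" by simp_all
  have "b - (u * x1 + v * (x2 * x3)) \<in> fil n" "c - (u * x2 - v * x1) \<in> fil n" for n
  proof -
    let ?m = "Suc n"
    have m: "b - (U ?m * x1 + V ?m * (x2 * x3)) \<in> fil n" "c - (U ?m * x2 - V ?m * x1) \<in> fil n"
      using UV [of ?m] fil_antimono [of n ?m] by simp_all
    have p: "(u - U ?m) * f \<in> fil n" "(v - V ?m) * f \<in> fil n" for f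
      using u [of ?m] v [of ?m] fil_mult_le [of _ n f 0 n] by simp_all
    have "b - (u * x1 + v * (x2 * x3)) = b - (U ?m * x1 + V ?m * (x2 * x3)) - ((u - U ?m) * x1 + (v - V ?m) * (x2 * x3))"
      "c - (u * x2 - v * x1) = c - (U ?m * x2 - V ?m * x1) - ((u - U ?m) * x2 - (v - V ?m) * x1)"
      by (simp_all add: algebra_simps)
    then show "b - (u * x1 + v * (x2 * x3)) \<in> fil n" "c - (u * x2 - v * x1) \<in> fil n"
      using m p by (simp_all only: fil_diff fil_add)
  qed
  then have "b - (u * x1 + v * (x2 * x3)) = 0" "c - (u * x2 - v * x1) = 0"
    by (blast intro: fil_all_zero)+
  then show ?thesis by (intro that [of u v]) simp_all
qed


section \<open>The base of the deformation is a formal base\<close>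

lemmas gr_ops = zero_gr_def one_gr_def plus_gr_def uminus_gr_def minus_gr_def times_gr_def

text \<open>Both generators are odd. Their multiples by even scalars form the module in the
  theta-components, while multiplying the first generator by \<open>ps_\<theta>2\<close> and
  \<open>ps_\<theta>1\<close> gives t1 and - t2 times theta1 theta2; products with the second
  generator add nothing to the ideal (t1, t2).\<close>

lemma relation_ideal_eq:
  "relation_ideal = {Gr 0 (u * x1 + v * (x2 * x3)) (u * x2 - v * x1) (p * x1 + q * x2) | u v p q. True}"
  (is "_ = ?R")
proof
  let ?g1 = "ps_t1 * ps_\<theta>1 + ps_t2 * ps_\<theta>2" and ?g2 = "- (ps_t1 * ps_\<theta>2) + ps_t2 * ps_t3 * ps_\<theta>1"
  have g: "?g1 = Gr 0 x1 x2 0" "?g2 = Gr 0 (x2 * x3) (- x1) 0"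
    by (simp_all add: gr_ops ps_t1_def ps_t2_def ps_t3_def ps_\<theta>1_def ps_\<theta>2_def x1_def x2_def x3_def)
  have "two_sided_ideal ?R"
    unfolding two_sided_ideal_def
  proof (intro conjI ballI allI)
    have "0 = Gr 0 (0 * x1 + 0 * (x2 * x3)) (0 * x2 - 0 * x1) (0 * x1 + 0 * x2)" by (simp add: gr_ops)
    then show "0 \<in> ?R" by blast
  next
    fix y z assume "y \<in> ?R" "z \<in> ?R"
    then obtain u v p q u' v' p' q' where
      "y = Gr 0 (u * x1 + v * (x2 * x3)) (u * x2 - v * x1) (p * x1 + q * x2)"
      "z = Gr 0 (u' * x1 + v' * (x2 * x3)) (u' * x2 - v' * x1) (p' * x1 + q' * x2)" by blast
    then have "y + z = Gr 0 ((u + u') * x1 + (v + v') * (x2 * x3)) ((u + u') * x2 - (v + v') * x1)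
      ((p + p') * x1 + (q + q') * x2)" by (simp add: gr_ops algebra_simps)
    then show "y + z \<in> ?R" by blast
  next
    fix y a :: pser assume "y \<in> ?R"
    then obtain u v p q where
      y: "y = Gr 0 (u * x1 + v * (x2 * x3)) (u * x2 - v * x1) (p * x1 + q * x2)" by blast
    obtain a0 a1 a2 a12 where a: "a = Gr a0 a1 a2 a12" by (cases a)
    have "a * y = Gr 0 ((a0 * u) * x1 + (a0 * v) * (x2 * x3)) ((a0 * u) * x2 - (a0 * v) * x1)
      ((a0 * p - a1 * v - a2 * u) * x1 + (a0 * q + a1 * u - a2 * v * x3) * x2)"
      by (simp add: y a gr_ops algebra_simps)
    then show "a * y \<in> ?R" by blast
    have "y * a = Gr 0 ((a0 * u) * x1 + (a0 * v) * (x2 * x3)) ((a0 * u) * x2 - (a0 * v) * x1)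
      ((a0 * p + u * a2 + v * a1) * x1 + (a0 * q + v * x3 * a2 - u * a1) * x2)"
      by (simp add: y a gr_ops algebra_simps)
    then show "y * a \<in> ?R" by blast
  qed
  moreover have "?g1 \<in> ?R"
    unfolding g by (intro CollectI exI [of _ 1] exI [of _ 0]) simp
  moreover have "?g2 \<in> ?R"
    unfolding g by (intro CollectI exI [of _ 0] exI [of _ 1] exI [of _ 0]) simp
  ultimately show "relation_ideal \<subseteq> ?R"
    unfolding relation_ideal_def ideal_generated_def by blast
  have gen: "?g1 \<in> relation_ideal" "?g2 \<in> relation_ideal"
    unfolding relation_ideal_def ideal_generated_def by blast+
  show "?R \<subseteq> relation_ideal"
  proof
    fix y assume "y \<in> ?R"
    then obtain u v p q where
      y: "y = Gr 0 (u * x1 + v * (x2 * x3)) (u * x2 - v * x1) (p * x1 + q * x2)" by blast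
    have "y = Gr u 0 0 0 * ?g1 + Gr v 0 0 0 * ?g2 + (Gr p 0 0 0 * (?g1 * Gr 0 0 1 0) + Gr (- q) 0 0 0 * (?g1 * Gr 0 1 0 0))"
      unfolding g by (simp add: y gr_ops algebra_simps)
    then show "y \<in> relation_ideal"
      using gen by (simp only: relation_ideal_add relation_ideal_left relation_ideal_right)
  qed
qed

lemma cls_eq_iff: "cls x = cls y \<longleftrightarrow> x - y \<in> relation_ideal"
  by (simp add: base_alg.abs_eq_iff relation_rel_def)

lemmas cls_ops = plus_base_alg.abs_eq minus_base_alg.abs_eq uminus_base_alg.abs_eq times_base_alg.abs_eq
  zero_base_alg.abs_eq one_base_alg.abs_eq

lemma cls_surj: obtains y where "x = cls y"
  by (induction x rule: base_alg.abs_induct) blast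

lemma base_A_simps [simp]:
  "scal base_A z = cls (ps_scal z)" "homog base_A p = cls ` ps_homog p" "aug base_A (cls x) = ps_aug x"
  by (simp_all add: base_A_def base_alg_aug.abs_eq)

lemma ps_homog_iff: "x \<in> ps_homog 0 \<longleftrightarrow> co_\<theta>1 x = 0 \<and> co_\<theta>2 x = 0" "x \<in> ps_homog 1 \<longleftrightarrow> co_1 x = 0 \<and> co_\<theta>12 x = 0"
  by (simp_all add: ps_homog_def)

lemma ser3_unit:
  assumes "a $ 0 $ 0 $ 0 \<noteq> (0::complex)"
  obtains b where "a * b = 1"
proof -
  have "a $ 0 $ 0 * inverse (a $ 0 $ 0) = 1" using assms by (rule inverse_mult_eq_1')
  then have "a $ 0 * fps_right_inverse (a $ 0) (inverse (a $ 0 $ 0)) = 1" by (rule fps_right_inverse)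
  then have "a * fps_right_inverse a (fps_right_inverse (a $ 0) (inverse (a $ 0 $ 0))) = 1" by (rule fps_right_inverse)
  then show ?thesis by (rule that)
qed

lemma base_A_algebra: "augmented_local_algebra base_A"
proof
  show "scal base_A 1 = 1" by (simp add: ps_scal_def cls_ops gr_ops)
  show "scal base_A (y + z) = scal base_A y + scal base_A z" for y z
    by (simp add: ps_scal_def cls_ops gr_ops)
  show "scal base_A (y * z) = scal base_A y * scal base_A z" for y z
    by (simp add: ps_scal_def cls_ops gr_ops)
  show "scal base_A z \<in> homog base_A 0" for z
    by (auto simp: ps_scal_def ps_homog_iff)
  show "0 \<in> homog base_A p" for p
    by (auto simp: cls_ops ps_homog_def gr_ops)
  show "x + y \<in> homog base_A p" if "x \<in> homog base_A p" "y \<in> homog base_A p" for p x y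
    using that by (auto simp: cls_ops ps_homog_def gr_ops intro!: imageI)
  show "- x \<in> homog base_A p" if "x \<in> homog base_A p" for p x
    using that by (auto simp: cls_ops ps_homog_def gr_ops intro!: imageI)
  show "\<exists>!y. y \<in> homog base_A 0 \<and> x - y \<in> homog base_A 1" for x
  proof -
    obtain a b c e where x: "x = cls (Gr a b c e)" by (metis cls_surj gr.exhaust)
    show ?thesis
    proof (rule ex1I [of _ "cls (Gr a 0 0 e)"])
      show "cls (Gr a 0 0 e) \<in> homog base_A 0 \<and> x - cls (Gr a 0 0 e) \<in> homog base_A 1"
        unfolding x cls_ops by (auto simp: gr_ops ps_homog_iff intro!: imageI)
    next
      fix y assume y: "y \<in> homog base_A 0 \<and> x - y \<in> homog base_A 1"
      then obtain Y Z where Y: "y = cls Y" "Y \<in> ps_homog 0" and Z: "x - y = cls Z" "Z \<in> ps_homog 1" by auto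
      have "cls (Gr a b c e - Y) = cls Z" using Z(1) unfolding x Y(1) cls_ops by simp
      then have "Gr a b c e - Y - Z \<in> relation_ideal" by (simp add: cls_eq_iff)
      then obtain u v p q where e: "Gr a b c e - Y - Z =
          Gr 0 (u * x1 + v * (x2 * x3)) (u * x2 - v * x1) (p * x1 + q * x2)"
        unfolding relation_ideal_eq by blast
      \<comment> \<open>Homogeneous parts of relations are relations: dropping the odd components of
        \<open>e\<close> leaves its theta1 theta2 part, which is a relation by itself.\<close>
      have "Y - Gr a 0 0 e = Gr 0 (0 * x1 + 0 * (x2 * x3)) (0 * x2 - 0 * x1) ((- p) * x1 + (- q) * x2)"
        using e Y(2) Z(2) by (cases Y; cases Z) (simp add: gr_ops ps_homog_iff algebra_simps)
      then have "Y - Gr a 0 0 e \<in> relation_ideal" unfolding relation_ideal_eq by blast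
      then show "y = cls (Gr a 0 0 e)" by (simp add: Y(1) cls_eq_iff)
    qed
  qed
  show "x * y \<in> homog base_A (p + q)" if xy: "x \<in> homog base_A p" "y \<in> homog base_A q" for p q x y
  proof -
    obtain X Y where "x = cls X" "X \<in> ps_homog p" "y = cls Y" "Y \<in> ps_homog q" using xy by auto
    then show ?thesis
      by (cases p; cases q) (auto simp: cls_ops ps_homog_def gr_ops intro!: imageI)
  qed
  show "x * y = ksign (p * q) * (y * x)" if xy: "x \<in> homog base_A p" "y \<in> homog base_A q" for p q x y
  proof -
    obtain X Y where X: "x = cls X" "X \<in> ps_homog p" and Y: "y = cls Y" "Y \<in> ps_homog q" using xy by auto
    have "X * Y = (if p * q = 1 then - (Y * X) else Y * X)"
      using X(2) Y(2) by (cases p; cases q) (auto simp: ps_homog_def gr_ops algebra_simps)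
    then show ?thesis by (simp add: X Y ksign_def cls_ops)
  qed
  show "aug base_A (x + y) = aug base_A x + aug base_A y" for x y
    by (cases x rule: cls_surj; cases y rule: cls_surj) (simp add: cls_ops ps_aug_def gr_ops)
  show "aug base_A (x * y) = aug base_A x * aug base_A y" for x y
    by (cases x rule: cls_surj; cases y rule: cls_surj) (simp add: cls_ops ps_aug_def gr_ops fps_mult_nth_0)
  show "aug base_A (scal base_A z) = z" for z
    by (simp add: ps_scal_def ps_aug_def)
  show "aug base_A x = 0" if "x \<in> homog base_A 1" for x
    using that by (auto simp: ps_aug_def ps_homog_iff)
  show "{x. \<not> (\<exists>y. x * y = 1 \<and> y * x = 1)} = max_ideal base_A"
  proof -
    have "(\<exists>y. x * y = 1 \<and> y * x = 1) \<longleftrightarrow> aug base_A x \<noteq> 0" for x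
    proof -
      obtain a b c e where x: "x = cls (Gr a b c e)" by (metis cls_surj gr.exhaust)
      show ?thesis
      proof
        assume "\<exists>y. x * y = 1 \<and> y * x = 1"
        then obtain Y where "x * cls Y = 1" by (metis cls_surj)
        then have "aug base_A (x * cls Y) = aug base_A 1" by simp
        then show "aug base_A x \<noteq> 0"
          by (auto simp: x cls_ops ps_aug_def gr_ops fps_mult_nth_0)
      next
        assume "aug base_A x \<noteq> 0"
        then have "a $ 0 $ 0 $ 0 \<noteq> 0" by (simp add: x ps_aug_def)
        then obtain i where i: "a * i = 1" by (rule ser3_unit)
        let ?y = "Gr i (- (i * i * b)) (- (i * i * c)) (- (i * i * e))"
        have "a * (i * z) = z" for z using i by (simp flip: mult.assoc)
        then have "Gr a b c e * ?y = 1" "?y * Gr a b c e = 1"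
          using i by (simp_all add: gr_ops algebra_simps)
        then have "x * cls ?y = 1 \<and> cls ?y * x = 1"
          by (simp add: x cls_ops)
        then show "\<exists>y. x * y = 1 \<and> y * x = 1" by blast
      qed
    qed
    then show ?thesis by (auto simp: max_ideal_def)
  qed
qed

interpretation A: augmented_local_algebra base_A
  by (rule base_A_algebra)

text \<open>Order in all five parameters: each theta counts as one, so its coefficient needs order n
  - 1, and that of theta1 theta2 only n - 2.\<close>

definition ps_fil :: "nat \<Rightarrow> pser set" where
  "ps_fil n = {x. co_1 x \<in> fil n \<and> co_\<theta>1 x \<in> fil (n - 1) \<and> co_\<theta>2 x \<in> fil (n - 1) \<and> co_\<theta>12 x \<in> fil (n - 2)}"

lemma ps_fil_Suc_split:
  assumes "x \<in> ps_fil (Suc n)"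
  obtains a1 a2 a3 b1 b2 where "a1 \<in> ps_fil n" "a2 \<in> ps_fil n" "a3 \<in> ps_fil n" "b1 \<in> ps_fil n" "b2 \<in> ps_fil n"
    "cls x = cls a1 * t1 + cls a2 * t2 + cls a3 * t3 + cls b1 * \<theta>1 + cls b2 * \<theta>2"
proof -
  obtain a b c e where x: "x = Gr a b c e" by (cases x)
  have f: "a \<in> fil (Suc n)" "b \<in> fil n" "c \<in> fil n" "e \<in> fil (n - 1)"
    using assms by (simp_all add: x ps_fil_def)
  obtain a1 a2 a3 where a: "a1 \<in> fil n" "a2 \<in> fil n" "a3 \<in> fil n" "a = a1 * x1 + a2 * x2 + a3 * x3"
    by (rule fil_Suc_split [OF f(1)])
  show ?thesis
  \<comment> \<open>The theta1 theta2 term is written as (e theta1) theta2 and joins the coefficient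
    of theta2.\<close>
  proof (rule that [of "Gr a1 0 0 0" "Gr a2 0 0 0" "Gr a3 0 0 0" "Gr b 0 0 0" "Gr c e 0 0"])
    show "cls x = cls (Gr a1 0 0 0) * t1 + cls (Gr a2 0 0 0) * t2 + cls (Gr a3 0 0 0) * t3
        + cls (Gr b 0 0 0) * \<theta>1 + cls (Gr c e 0 0) * \<theta>2"
      unfolding t1_def t2_def t3_def \<theta>1_def \<theta>2_def cls_ops ps_t1_def ps_t2_def ps_t3_def ps_\<theta>1_def ps_\<theta>2_def
        x1_def [symmetric] x2_def [symmetric] x3_def [symmetric]
      by (simp add: x a gr_ops)
  qed (use a f in \<open>simp_all add: ps_fil_def\<close>)
qed

lemma t_max_ideal: "t1 \<in> max_ideal base_A" "t2 \<in> max_ideal base_A" "t3 \<in> max_ideal base_A"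
    "\<theta>1 \<in> max_ideal base_A" "\<theta>2 \<in> max_ideal base_A"
  by (simp_all add: max_ideal_def t1_def t2_def t3_def \<theta>1_def \<theta>2_def ps_aug_def ps_t1_def ps_t2_def
      ps_t3_def ps_\<theta>1_def ps_\<theta>2_def)

lemma t_homog: "t1 \<in> homog base_A 0" "t2 \<in> homog base_A 0" "t3 \<in> homog base_A 0"
    "\<theta>1 \<in> homog base_A 1" "\<theta>2 \<in> homog base_A 1"
  by (auto simp: t1_def t2_def t3_def \<theta>1_def \<theta>2_def ps_homog_iff ps_t1_def ps_t2_def
      ps_t3_def ps_\<theta>1_def ps_\<theta>2_def intro!: imageI)

lemma base_relations: "t1 * \<theta>1 + t2 * \<theta>2 = 0" "- (t1 * \<theta>2) + t2 * t3 * \<theta>1 = 0"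
  unfolding t1_def t2_def t3_def \<theta>1_def \<theta>2_def cls_ops cls_eq_iff diff_0_right
    relation_ideal_def ideal_generated_def by blast+

text \<open>Powers of the maximal ideal become order conditions on representatives, so separation
  and completeness of the base can be studied coefficientwise.\<close>

lemma mp_base_A: "A.mp n = cls ` ps_fil n"
proof
  show "A.mp n \<subseteq> cls ` ps_fil n"
  proof (induction n)
    case 0
    show ?case by (auto simp: ps_fil_def image_iff) (metis cls_surj)
  next
    case (Suc n)
    show ?case
    proof
      fix x assume "x \<in> A.mp (Suc n)"
      then show "x \<in> cls ` ps_fil (Suc n)"
      proof (induction x rule: A.mp_induct)
        case zero
        show ?case by (auto simp: cls_ops ps_fil_def gr_ops)
      next
        case (add x y)
        then obtain X Y where "x = cls X" "X \<in> ps_fil (Suc n)" "y = cls Y" "Y \<in> ps_fil (Suc n)" by auto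
        then show ?case by (auto simp: cls_ops ps_fil_def gr_ops intro!: imageI fil_add)
      next
        case (mult x y)
        then obtain X where X: "x = cls X" "X \<in> ps_fil n" using Suc by auto
        obtain Y where Y: "y = cls Y" by (rule cls_surj)
        have "co_1 Y \<in> fil 1" using mult(2) by (auto simp: Y max_ideal_def ps_aug_def fil_def)
        then have "X * Y \<in> ps_fil (Suc n)"
          using X(2) unfolding ps_fil_def times_gr_def
          by (auto intro!: fil_add fil_diff intro: fil_mult_le [of _ n _ 1] fil_mult_le [of _ n _ 0]
              fil_mult_le [of _ "n - 1" _ 1] fil_mult_le [of _ "n - 1" _ 0] fil_mult_le [of _ "n - 2" _ 1])
        then show ?case by (simp add: X Y cls_ops)
      qed
    qed
  qed
  show "cls ` ps_fil n \<subseteq> A.mp n"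
  proof (induction n)
    case (Suc n)
    show ?case
    proof
      fix y assume "y \<in> cls ` ps_fil (Suc n)"
      then obtain x where x: "x \<in> ps_fil (Suc n)" "y = cls x" by blast
      obtain a1 a2 a3 b1 b2 where
        "a1 \<in> ps_fil n" "a2 \<in> ps_fil n" "a3 \<in> ps_fil n" "b1 \<in> ps_fil n" "b2 \<in> ps_fil n"
        "cls x = cls a1 * t1 + cls a2 * t2 + cls a3 * t3 + cls b1 * \<theta>1 + cls b2 * \<theta>2"
        by (rule ps_fil_Suc_split [OF x(1)])
      then show "y \<in> A.mp (Suc n)"
        using Suc unfolding x(2) by (auto intro!: A.mp_add A.mp_Suc_mult t_max_ideal)
    qed
  qed simp
qed

text \<open>Separation says that the ideal of relations is closed. For the theta-components this is
  \<open>relation_module_closed\<close>, and the theta1 theta2 component lies in a monomial ideal.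
  Completeness lifts to representatives, where series of increasing order converge.\<close>

lemma formal_algebra_base_A: "formal_algebra base_A"
proof
  show "(\<Inter>n. A.mp n) = {0}"
  proof
    show "(\<Inter>n. A.mp n) \<subseteq> {0}"
    proof
      fix x assume x: "x \<in> (\<Inter>n. A.mp n)"
      obtain a b c e where X: "x = cls (Gr a b c e)" by (metis cls_surj gr.exhaust)
      have appr: "\<exists>u v p q. a \<in> fil n \<and> b - (u * x1 + v * (x2 * x3)) \<in> fil n \<and> c - (u * x2 - v * x1) \<in> fil n
        \<and> e - (p * x1 + q * x2) \<in> fil n" for n
      proof -
        \<comment> \<open>Order n + 2 ensures order n in all four components, including the theta1
          theta2 one.\<close>
        obtain Y where Y: "cls (Gr a b c e) = cls Y" "Y \<in> ps_fil (n + 2)"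
          using x unfolding X mp_base_A by blast
        obtain a' b' c' e' where Y': "Y = Gr a' b' c' e'" by (cases Y)
        have "Gr a b c e - Y \<in> relation_ideal" using Y(1) by (simp add: cls_eq_iff)
        then obtain u v p q where E: "Gr a b c e - Y =
          Gr 0 (u * x1 + v * (x2 * x3)) (u * x2 - v * x1) (p * x1 + q * x2)"
          unfolding relation_ideal_eq by blast
        have D: "a - a' = 0" "b - b' = u * x1 + v * (x2 * x3)" "c - c' = u * x2 - v * x1" "e - e' = p * x1 + q * x2"
          using E by (simp_all add: Y' gr_ops)
        have "a = a'" "b - (u * x1 + v * (x2 * x3)) = b'" "c - (u * x2 - v * x1) = c'" "e - (p * x1 + q * x2) = e'"
          unfolding D [symmetric] using D(1) by simp_all
        moreover have "a' \<in> fil n" "b' \<in> fil n" "c' \<in> fil n" "e' \<in> fil n"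
          using Y(2) by (auto simp: Y' ps_fil_def intro: fil_antimono [of n "n + 2"] fil_antimono [of n "n + 1"])
        ultimately show ?thesis by metis
      qed
      have "a = 0" using appr by (blast intro: fil_all_zero)
      moreover obtain u v where uv: "b = u * x1 + v * (x2 * x3)" "c = u * x2 - v * x1"
        by (rule relation_module_closed [of b c]) (use appr in blast)
      \<comment> \<open>A series lies in (t1, t2) as soon as all its coefficients free of t1 and t2
        vanish.\<close>
      moreover have "e $ k $ 0 $ 0 = 0" for k
      proof -
        obtain p q where "e - (p * x1 + q * x2) \<in> fil (Suc k)" using appr by blast
        from filD [OF this, of 0 0 k] show ?thesis
          by (simp add: mult.commute [of p] mult.commute [of q] x_mult_nth)
      qed
      then have "e = Abs_fps (\<lambda>k. Abs_fps (\<lambda>j. Abs_fps (\<lambda>i. if j = 0 then e $ k $ 0 $ Suc i else 0))) * x1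
          + Abs_fps (\<lambda>k. Abs_fps (\<lambda>j. Abs_fps (\<lambda>i. e $ k $ Suc j $ i))) * x2"
        by (intro fps_ext) (simp add: mult.commute [of _ x1] mult.commute [of _ x2] x_mult_nth)
      ultimately have "Gr a b c e \<in> relation_ideal"
        unfolding relation_ideal_eq by blast
      then show "x \<in> {0}" by (simp add: X cls_ops cls_eq_iff)
    qed
  qed (auto simp: A.mp_zero)
next
  fix s :: "nat \<Rightarrow> base_alg"
  assume s: "\<And>n. s (Suc n) - s n \<in> A.mp n"
  obtain x0 where x0: "s 0 = cls x0" by (rule cls_surj)
  have "\<exists>d. d \<in> ps_fil n \<and> s (Suc n) - s n = cls d" for n
    using s [of n] unfolding mp_base_A by blast
  then obtain d where d: "d n \<in> ps_fil n" "s (Suc n) - s n = cls (d n)" for n by metis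
  have f: "co_1 (d n) \<in> fil (n - 0)" "co_\<theta>1 (d n) \<in> fil (n - 1)" "co_\<theta>2 (d n) \<in> fil (n - 1)"
    "co_\<theta>12 (d n) \<in> fil (n - 2)" for n using d(1) [of n] by (simp_all add: ps_fil_def)
  obtain g0 where g0: "\<And>n. g0 - (\<Sum>k<n. co_1 (d k)) \<in> fil (n - 0)" by (rule fil_series [OF f(1)]) blast
  obtain g1 where g1: "\<And>n. g1 - (\<Sum>k<n. co_\<theta>1 (d k)) \<in> fil (n - 1)" by (rule fil_series [OF f(2)]) blast
  obtain g2 where g2: "\<And>n. g2 - (\<Sum>k<n. co_\<theta>2 (d k)) \<in> fil (n - 1)" by (rule fil_series [OF f(3)]) blast
  obtain g3 where g3: "\<And>n. g3 - (\<Sum>k<n. co_\<theta>12 (d k)) \<in> fil (n - 2)" by (rule fil_series [OF f(4)]) blast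
  define D where "D n = Gr (\<Sum>k<n. co_1 (d k)) (\<Sum>k<n. co_\<theta>1 (d k)) (\<Sum>k<n. co_\<theta>2 (d k)) (\<Sum>k<n. co_\<theta>12 (d k))" for n
  have sn: "s n = cls (x0 + D n)" for n
  proof (induction n)
    case 0
    have "D 0 = 0" by (simp add: D_def gr_ops)
    then show ?case by (simp add: x0)
  next
    case (Suc n)
    have "D (Suc n) = D n + d n" by (simp add: D_def gr_ops)
    moreover have "s (Suc n) = s n + cls (d n)" using d(2) [of n] by (simp add: algebra_simps)
    ultimately show ?case using Suc by (simp add: cls_ops add.assoc)
  qed
  have "cls (x0 + Gr g0 g1 g2 g3) - s n \<in> A.mp n" for n
  proof -
    have "x0 + Gr g0 g1 g2 g3 - (x0 + D n) = Gr g0 g1 g2 g3 - D n" by simp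
    moreover have "Gr g0 g1 g2 g3 - D n \<in> ps_fil n"
      using g0 [of n] g1 [of n] g2 [of n] g3 [of n] by (simp add: D_def gr_ops ps_fil_def)
    ultimately show ?thesis unfolding sn cls_ops mp_base_A by (metis imageI)
  qed
  then show "\<exists>x. \<forall>n. x - s n \<in> A.mp n" by blast
qed

text \<open>If m^2 = 0 in the target, a product a t with t in the maximal ideal is mapped to the
  augmentation of a times the image of t. Every element is a scalar plus a combination of the five
  generators, so their images determine the homomorphism.\<close>

lemma base_hom_unique:
  assumes B: "infinitesimal_base B" and f: "base_hom base_A B f" and g: "base_hom base_A B g"
    and eq: "f t1 = g t1" "f t2 = g t2" "f t3 = g t3" "f \<theta>1 = g \<theta>1" "f \<theta>2 = g \<theta>2"
  shows "f = g"
proof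
  interpret B: augmented_local_algebra B using B by (simp add: infinitesimal_base_def)
  have small: "F (a * t) = scal B (aug base_A a) * F t" if F: "base_hom base_A B F" and t: "t \<in> max_ideal base_A" for F a t
  proof -
    have "F a - scal B (aug base_A a) \<in> max_ideal B" "F t \<in> max_ideal B"
      using F t by (simp_all add: base_hom_def max_ideal_def B.aug_diff B.aug_scal)
    then have "(F a - scal B (aug base_A a)) * F t = 0" by (rule infinitesimal_mult [OF B])
    then show ?thesis using F by (simp add: base_hom_def left_diff_distrib)
  qed
  fix x
  obtain y where y: "x = cls y" by (rule cls_surj)
  have "y - ps_scal (ps_aug y) \<in> ps_fil (Suc 0)"
    by (auto simp: ps_fil_def gr_ops ps_scal_def ps_aug_def fil_def)
  then obtain a1 a2 a3 b1 b2 where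
    "cls (y - ps_scal (ps_aug y)) = cls a1 * t1 + cls a2 * t2 + cls a3 * t3 + cls b1 * \<theta>1 + cls b2 * \<theta>2"
    by (rule ps_fil_Suc_split) blast
  then have e: "x = scal base_A (ps_aug y) + (cls a1 * t1 + cls a2 * t2 + cls a3 * t3 + cls b1 * \<theta>1 + cls b2 * \<theta>2)"
    by (simp add: y cls_ops [symmetric] algebra_simps)
  have F: "F x = scal B (ps_aug y) + (scal B (aug base_A (cls a1)) * F t1 + scal B (aug base_A (cls a2)) * F t2
      + scal B (aug base_A (cls a3)) * F t3 + scal B (aug base_A (cls b1)) * F \<theta>1 + scal B (aug base_A (cls b2)) * F \<theta>2)"
    if F: "base_hom base_A B F" for F
  proof -
    have add: "F (p + q) = F p + F q" for p q using F by (simp add: base_hom_def)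
    show ?thesis
      unfolding e add small [OF F t_max_ideal(1)] small [OF F t_max_ideal(2)] small [OF F t_max_ideal(3)]
        small [OF F t_max_ideal(4)] small [OF F t_max_ideal(5)]
      using F unfolding base_hom_def by simp
  qed
  show "f x = g x" by (simp only: F [OF f] F [OF g] eq)
qed


section \<open>Evaluation of power series in a formal base\<close>

context formal_algebra
begin

text \<open>Substitution of \<open>t\<close> for the variable: the partial sums converge because t^k
  lies in the k-th power of the maximal ideal. It is applied once for each of the three nested power
  series rings.\<close>

lemma extend_hom:
  fixes h :: "'r::comm_ring_1 \<Rightarrow> 'a"
  assumes h: "h 1 = 1" "\<And>x y. h (x + y) = h x + h y" "\<And>x y. h (x * y) = h x * h y" "\<And>x. h x \<in> homog B 0"
    and t: "t \<in> homog B 0" "t \<in> max_ideal B"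
  obtains H :: "'r fps \<Rightarrow> 'a" where "H 1 = 1" "\<And>x y. H (x + y) = H x + H y" "\<And>x y. H (x * y) = H x * H y"
    "\<And>x. H x \<in> homog B 0" "\<And>r. H (fps_const r) = h r" "H fps_X = t" "\<And>f. aug B (H f) = aug B (h (f $ 0))"
proof -
  define S where "S f n = (\<Sum>k<n. h (f $ k) * t ^ k)" for f :: "'r fps" and n
  have tn: "t ^ n \<in> mp n" for n
    by (induction n) (simp_all add: mp_Suc_mult_left t)
  have "\<exists>x. \<forall>n. x - S f n \<in> mp n" for f
    by (rule complete) (simp add: S_def mp_left tn)
  then obtain H where H: "H f - S f n \<in> mp n" for f n by metis
  have uniq: "H f = y" if "\<And>n. y - S f n \<in> mp n" for f y
  proof -
    have "H f - y \<in> mp n" for n using mp_diff [OF H [of f n] that [of n]] by simp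
    then have "H f - y = 0" by (rule mp_all_zero)
    then show ?thesis by simp
  qed
  have h0: "h 0 = 0" using h(2) [of 0 0] by simp
  have add: "H (f + g) = H f + H g" for f g
  proof (rule uniq)
    fix n
    have e: "H f + H g - S (f + g) n = (H f - S f n) + (H g - S g n)"
      by (simp add: S_def h distrib_right sum.distrib)
    show "H f + H g - S (f + g) n \<in> mp n" unfolding e by (intro mp_add H)
  qed
  have cmult: "H (fps_const r * f) = h r * H f" for r f
  proof (rule uniq)
    fix n
    have "h r * H f - S (fps_const r * f) n = h r * (H f - S f n)"
      by (simp add: S_def h right_diff_distrib sum_distrib_left mult.assoc)
    then show "h r * H f - S (fps_const r * f) n \<in> mp n" using H by (simp add: mp_left)
  qed
  have Xmult: "H (fps_X * f) = t * H f" for f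
  proof (rule uniq)
    fix n
    show "t * H f - S (fps_X * f) n \<in> mp n"
    proof (cases n)
      case (Suc m)
      have "S (fps_X * f) n = t * S f m"
        unfolding S_def Suc sum.lessThan_Suc_shift
        using even_commute [OF t(1)] by (simp add: h0 sum_distrib_left mult.assoc)
      then have "t * H f - S (fps_X * f) n = t * (H f - S f m)" by (simp add: right_diff_distrib)
      then show ?thesis using H [of f m] t unfolding Suc by (simp only: mp_Suc_mult_left)
    qed simp
  qed
  have one: "H 1 = 1"
  proof (rule uniq)
    fix n
    show "1 - S 1 n \<in> mp n"
    proof (cases n)
      case (Suc m)
      have "S 1 n = 1" unfolding S_def Suc sum.lessThan_Suc_shift by (simp add: h h0)
      then show ?thesis by simp
    qed simp
  qed
  have const: "H (fps_const r) = h r" for r using cmult [of r 1] one by simp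
  have split: "f = fps_const (f $ 0) + fps_X * fps_shift 1 f" for f :: "'r fps"
    by (rule fps_ext) auto
  \<comment> \<open>Writing f = f_0 + X f', the defect of multiplicativity for f is \<open>t\<close>
    times that for f'. Iterating, it lies in every power of the maximal ideal.\<close>
  have mult: "H (f * g) = H f * H g" for f g
  proof -
    have "H (f * g) - H f * H g \<in> mp n" for n
    proof (induction n arbitrary: f)
      case (Suc n)
      let ?f = "fps_shift 1 f"
      have "f * g = fps_const (f $ 0) * g + fps_X * (?f * g)"
        by (subst split [of f]) (simp add: distrib_right mult.assoc)
      then have "H (f * g) = h (f $ 0) * H g + t * H (?f * g)" by (simp only: add cmult Xmult)
      moreover have "H f = h (f $ 0) + t * H ?f"
        by (subst split [of f]) (simp only: add const Xmult)
      ultimately have "H (f * g) - H f * H g = t * (H (?f * g) - H ?f * H g)"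
        by (simp add: distrib_right right_diff_distrib mult.assoc)
      then show ?case using Suc [of ?f] t by (simp only: mp_Suc_mult_left)
    qed simp
    then have "H (f * g) - H f * H g = 0" by (rule mp_all_zero)
    then show ?thesis by simp
  qed
  have pow: "t ^ k \<in> homog B 0" for k
  proof (induction k)
    case (Suc k)
    then show ?case using homog_mult [OF t(1) Suc] by simp
  qed simp
  have even: "H f \<in> homog B 0" for f
  proof (rule homog_closed)
    fix n
    have "S f n \<in> homog B 0"
      unfolding S_def using homog_mult [OF h(4) pow] by (intro homog_sum) simp
    then show "\<exists>y\<in>homog B 0. H f - y \<in> mp n" using H by blast
  qed
  have "aug B (H f) = aug B (h (f $ 0))" for f
    using H [of f 1] by (simp add: S_def max_ideal_iff aug_diff)
  moreover have "H fps_X = t" using Xmult [of 1] one by simp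
  ultimately show ?thesis using one add mult even const by (intro that [of H])
qed

text \<open>Three substitutions for the even variables, then linear expansion in the thetas. As
  \<open>\<phi>\<close> is multiplicative, its kernel is a two-sided ideal, so the relations need to
  be checked on the two generators only.\<close>

lemma base_hom_exists:
  assumes t: "s1 \<in> homog B 0" "s2 \<in> homog B 0" "s3 \<in> homog B 0" and h: "h1 \<in> homog B 1" "h2 \<in> homog B 1"
    and m: "s1 \<in> max_ideal B" "s2 \<in> max_ideal B" "s3 \<in> max_ideal B"
    and rel: "s1 * h1 + s2 * h2 = 0" "- (s1 * h2) + s2 * s3 * h1 = 0"
  obtains f where "base_hom base_A B f" "f t1 = s1" "f t2 = s2" "f t3 = s3" "f \<theta>1 = h1" "f \<theta>2 = h2"
proof -
  obtain H1 :: "complex fps \<Rightarrow> 'a" where H1: "H1 1 = 1" "\<And>x y. H1 (x + y) = H1 x + H1 y" "\<And>x y. H1 (x * y) = H1 x * H1 y"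
    "\<And>x. H1 x \<in> homog B 0" "\<And>r. H1 (fps_const r) = scal B r" "H1 fps_X = s1" "\<And>f. aug B (H1 f) = f $ 0"
    by (rule extend_hom [OF scal_one scal_add scal_mult scal_even t(1) m(1)]) (simp add: aug_scal)
  obtain H2 :: "complex fps fps \<Rightarrow> 'a" where H2: "H2 1 = 1" "\<And>x y. H2 (x + y) = H2 x + H2 y" "\<And>x y. H2 (x * y) = H2 x * H2 y"
    "\<And>x. H2 x \<in> homog B 0" "\<And>r. H2 (fps_const r) = H1 r" "H2 fps_X = s2" "\<And>f. aug B (H2 f) = f $ 0 $ 0"
    by (rule extend_hom [OF H1(1-4) t(2) m(2)]) (simp add: H1)
  obtain H where H: "H 1 = 1" "\<And>x y. H (x + y) = H x + H y" "\<And>x y. H (x * y) = H x * H y"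
    "\<And>x. H x \<in> homog B 0" "\<And>r. H (fps_const r) = H2 r" "H fps_X = s3" "\<And>f :: ser3. aug B (H f) = f $ 0 $ 0 $ 0"
    by (rule extend_hom [OF H2(1-4) t(3) m(3)]) (simp add: H2)
  have H0: "H 0 = 0" using H(2) [of 0 0] by simp
  have Hneg: "H (- x) = - H x" for x using H(2) [of x "- x"] H0 by (simp add: eq_neg_iff_add_eq_0 add.commute)
  have Hneg1: "H1 (- x) = - H1 x" for x
    using H1(2) [of x "- x"] H1(2) [of 0 0] by (simp add: eq_neg_iff_add_eq_0 add.commute)
  have Hneg2: "H2 (- x) = - H2 x" for x
    using H2(2) [of x "- x"] H2(2) [of 0 0] by (simp add: eq_neg_iff_add_eq_0 add.commute)
  have Hdiff: "H (x - y) = H x - H y" for x y using H(2) [of x "- y"] Hneg by simp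
  define \<phi> where "\<phi> x = H (co_1 x) + H (co_\<theta>1 x) * h1 + H (co_\<theta>2 x) * h2 + H (co_\<theta>12 x) * (h1 * h2)" for x
  have add: "\<phi> (x + y) = \<phi> x + \<phi> y" for x y
    by (simp add: \<phi>_def plus_gr_def H distrib_right algebra_simps)
  have comm: "h1 * H z = H z * h1" "h2 * H z = H z * h2" "h1 * (H z * w) = H z * (h1 * w)" "h2 * (H z * w) = H z * (h2 * w)" for z w
    using even_commute [OF H(4)] by (metis mult.assoc)+
  have sq: "h1 * h1 = 0" "h2 * h2 = 0" "h2 * h1 = - (h1 * h2)" "h1 * (h1 * w) = 0" "h2 * (h2 * w) = 0"
      "h2 * (h1 * w) = - (h1 * (h2 * w))" for w
    using odd_square [OF h(1)] odd_square [OF h(2)] graded_commute [OF h(2,1)]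
    by (simp_all flip: mult.assoc)
  have HH: "H z * H w = H w * H z" "H z * (H w * v) = H w * (H z * v)" for z w v
    using even_commute [OF H(4)] by (metis mult.assoc)+
  have mult: "\<phi> (x * y) = \<phi> x * \<phi> y" for x y
    by (simp add: \<phi>_def times_gr_def H Hdiff distrib_left distrib_right left_diff_distrib comm sq HH mult.assoc algebra_simps)
  have zero: "\<phi> x = 0" if "x \<in> relation_ideal" for x
  proof -
    have "two_sided_ideal {x. \<phi> x = 0}"
      unfolding two_sided_ideal_def by (auto simp: add mult) (simp add: \<phi>_def zero_gr_def H0)
    moreover have "\<phi> (ps_t1 * ps_\<theta>1 + ps_t2 * ps_\<theta>2) = 0" "\<phi> (- (ps_t1 * ps_\<theta>2) + ps_t2 * ps_t3 * ps_\<theta>1) = 0"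
      using rel by (simp_all add: \<phi>_def gr_ops ps_t1_def ps_t2_def ps_t3_def ps_\<theta>1_def ps_\<theta>2_def H0 Hneg Hneg1 Hneg2 H H2 H1
          del: fps_const_mult)
    ultimately show ?thesis
      using that unfolding relation_ideal_def ideal_generated_def by blast
  qed
  define f where "f x = \<phi> (rep_base_alg x)" for x
  have f: "f (cls x) = \<phi> x" for x
  proof -
    have "rep_base_alg (cls x) - x \<in> relation_ideal"
      using Quotient_base_alg Quotient_rel_rep base_alg.abs_eq_iff cls_eq_iff
      by (metis Quotient_abs_rep)
    then have "\<phi> ((rep_base_alg (cls x) - x) + x) = \<phi> x" unfolding add by (simp add: zero)
    then show ?thesis by (simp add: f_def)
  qed
  have "base_hom base_A B f"
    unfolding base_hom_def
  proof (intro conjI allI ballI)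
    show "f 1 = 1" unfolding one_base_alg.abs_eq f by (simp add: \<phi>_def one_gr_def H H0)
    show "f (x + y) = f x + f y" for x y
      by (cases x rule: cls_surj; cases y rule: cls_surj) (simp add: cls_ops f add)
    show "f (x * y) = f x * f y" for x y
      by (cases x rule: cls_surj; cases y rule: cls_surj) (simp add: cls_ops f mult)
    show "f (scal base_A z) = scal B z" for z
      by (simp add: f \<phi>_def ps_scal_def H H0 H1 H2)
    show "aug B (f x) = aug base_A x" for x
      using aug_odd [OF h(1)] aug_odd [OF h(2)]
      by (cases x rule: cls_surj) (simp add: f \<phi>_def ps_aug_def aug_add aug_mult H)
    fix p x assume "x \<in> homog base_A p"
    then obtain y where y: "x = cls y" "y \<in> ps_homog p" by auto
    have "H z * h1 \<in> homog B 1" "H z * h2 \<in> homog B 1" "H z * (h1 * h2) \<in> homog B 0" for z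
      using homog_mult [OF H(4) h(1), of z] homog_mult [OF H(4) h(2), of z]
        homog_mult [OF H(4) homog_mult [OF h], of z] by simp_all
    then show "f x \<in> homog B p"
      using y by (cases p) (auto simp: f \<phi>_def ps_homog_iff H H0 intro!: homog_add)
  qed
  moreover have "f t1 = s1" "f t2 = s2" "f t3 = s3" "f \<theta>1 = h1" "f \<theta>2 = h2"
    unfolding t1_def t2_def t3_def \<theta>1_def \<theta>2_def f
    by (simp_all add: \<phi>_def ps_t1_def ps_t2_def ps_t3_def ps_\<theta>1_def ps_\<theta>2_def H H0 H1 H2)
  ultimately show ?thesis by (rule that)
qed

end


section \<open>Base change\<close>

lemma base_hom_zero: "base_hom A B f \<Longrightarrow> f 0 = 0"
proof -
  assume "base_hom A B f"
  then have "f (0 + 0) = f 0 + f 0" unfolding base_hom_def by blast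
  then show ?thesis by simp
qed

lemma base_hom_uminus: "base_hom A B f \<Longrightarrow> f (- x) = - f x"
proof -
  assume f: "base_hom A B f"
  then have "f (x + - x) = f x + f (- x)" unfolding base_hom_def by blast
  then show ?thesis using base_hom_zero [OF f] by (simp add: eq_neg_iff_add_eq_0 add.commute)
qed

lemma base_hom_sum: "base_hom A B f \<Longrightarrow> f (sum g S) = (\<Sum>i\<in>S. f (g i))"
  by (induction S rule: infinite_finite_induct) (simp_all add: base_hom_zero, simp add: base_hom_def)

lemma base_hom_ksign: "base_hom A B f \<Longrightarrow> f (ksign p) = ksign p"
  using base_hom_uminus [of A B f 1] by (simp add: ksign_def base_hom_def)

lemma base_hom_twist:
  assumes "augmented_local_algebra A" "augmented_local_algebra B" "base_hom A B f"
  shows "f (twist A p x) = twist B p (f x)"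
proof -
  interpret A: augmented_local_algebra A by fact
  interpret B: augmented_local_algebra B by fact
  obtain y0 y1 where y: "y0 \<in> homog A 0" "y1 \<in> homog A 1" "x = y0 + y1" by (rule A.homog_split)
  have h: "f y0 \<in> homog B 0" "f y1 \<in> homog B 1" using assms(3) y by (auto simp: base_hom_def)
  have "f (twist A p x) = f y0 + ksign p * f y1"
    unfolding y(3) A.twist_split [OF y(1,2)] using assms(3) base_hom_ksign [OF assms(3)] by (simp add: base_hom_def)
  also have "\<dots> = twist B p (f x)"
    unfolding y(3) using B.twist_split [OF h] assms(3) by (simp add: base_hom_def)
  finally show ?thesis .
qed

lemma dcf_push:
  assumes "augmented_local_algebra A" "augmented_local_algebra B" "base_hom A B f"
  shows "augmented_local_algebra.dcf B (push f F) P I = f (augmented_local_algebra.dcf A F P I)"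
proof -
  interpret A: augmented_local_algebra A by fact
  interpret B: augmented_local_algebra B by fact
  show ?thesis
    using assms(3) base_hom_zero [OF assms(3)] by (simp add: A.dcf_def B.dcf_def ent_push base_hom_def)
qed

lemma push_comp:
  assumes "base_hom A B f" "right_linear F"
  shows "push f (F \<circ> G) = push f F \<circ> push f G"
proof (rule right_linear_ext)
  note f0 = base_hom_zero [OF assms(1)]
  fix J I
  let ?S = "Poly_Mapping.keys (G (Poly_Mapping.single I 1))"
  have "Poly_Mapping.keys (push f G (Poly_Mapping.single I 1)) \<subseteq> ?S"
  proof
    fix K assume "K \<in> Poly_Mapping.keys (push f G (Poly_Mapping.single I 1))"
    then have "ent (push f G) K I \<noteq> 0" by (simp add: ent_def in_keys_iff)
    then have "ent G K I \<noteq> 0" using f0 by (auto simp: ent_push)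
    then show "K \<in> ?S" by (simp add: ent_def in_keys_iff)
  qed
  then have "ent (push f F \<circ> push f G) J I = (\<Sum>K\<in>?S. ent (push f F) J K * ent (push f G) K I)"
    by (intro ent_comp right_linear_push) simp_all
  also have "\<dots> = f (\<Sum>K\<in>?S. ent F J K * ent G K I)"
    using assms(1) f0 by (simp add: base_hom_sum [OF assms(1)] ent_push) (simp add: base_hom_def)
  also have "(\<Sum>K\<in>?S. ent F J K * ent G K I) = ent (F \<circ> G) J I"
    by (rule ent_comp [symmetric]) (simp_all add: assms(2))
  finally show "ent (push f (F \<circ> G)) J I = ent (push f F \<circ> push f G) J I"
    by (simp only: ent_push [where f = f, OF f0])
qed (intro right_linear_comp right_linear_push)+

lemma push_id: "base_hom A B f \<Longrightarrow> push f id = id"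
proof (rule right_linear_ext)
  assume f: "base_hom A B f"
  fix J I
  show "ent (push f id) J I = ent id J I"
    using f base_hom_zero [OF f] by (simp add: ent_push ent_id when_def base_hom_def)
qed (simp_all add: right_linear_push right_linear_id)

lemma coderivation_push:
  assumes A: "augmented_local_algebra A" and B: "augmented_local_algebra B" and f: "base_hom A B f"
    and D: "coderivation A p D"
  shows "coderivation B p (push f D)"
proof -
  interpret A: augmented_local_algebra A by fact
  interpret B: augmented_local_algebra B by fact
  have d: "right_linear D" "has_parity A p D" using D by (simp_all add: coderivation_def)
  have fh: "f x \<in> homog B q" if "x \<in> homog A q" for q x using f that by (simp add: base_hom_def)
  have "has_parity B p (push f D)"
    unfolding B.dcf_parity_iff [OF right_linear_push] dcf_push [OF A B f]
    using fh A.dcf_homog [OF d] by blast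
  moreover have "B.dcf (push f D) (P + Q) I = (if Q \<le> I then twist B (tpar Q) (B.dcf (push f D) P (I - Q)) else 0)
        + (if P \<le> I then ksign (p * tpar P) * B.dcf (push f D) Q (I - P) else 0)"
    if v: "valid P" "valid Q" "valid I" for P Q I
  proof -
    have add: "f (x + y) = f x + f y" and mult: "f (x * y) = f x * f y" for x y using f by (simp_all add: base_hom_def)
    show ?thesis
      unfolding dcf_push [OF A B f] A.dcf_coderivation [OF D v] add
      by (simp add: base_hom_zero [OF f] base_hom_twist [OF A B f] mult base_hom_ksign [OF f])
  qed
  ultimately show ?thesis unfolding B.coderivation_iff using right_linear_push by blast
qed

text \<open>Makes reduction to the ground field a case of base change, so that general facts on
  \<open>push\<close> apply to \<open>push (aug B)\<close>.\<close>

lemma base_hom_aug: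
  assumes "augmented_local_algebra B"
  shows "base_hom B field_base (aug B)"
proof -
  interpret augmented_local_algebra B by fact
  show ?thesis
    by (auto simp: base_hom_def field_base_def aug_add aug_mult aug_scal aug_odd)
qed


section \<open>The family of coderivations\<close>

text \<open>The family with parameters in any base is closed under base change: it contains
  \<open>d_sharp\<close>, with all parameters zero, as well as every
  \<open>push f d2\<close>.\<close>

definition dt_cochain :: "('a::ring_1) base \<Rightarrow> 'a \<Rightarrow> 'a \<Rightarrow> 'a \<Rightarrow> 'a \<Rightarrow> 'a \<Rightarrow> 'a sym \<Rightarrow> 'a sym" where
  "dt_cochain B s1 s2 s3 h1 h2 x =
     sharp_cochain B x
     + cochain B (mi 1 0 0) W2 s1 x
     + cochain B (mi 1 0 0) W3 s2 x
     + cochain B (mi 0 1 0) W3 h1 x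
     + (cochain B (mi 0 1 0) W2 h2 x + cochain B (mi 0 0 1) W3 h2 x)
     - cochain B (mi 1 0 1) W2 s3 x
     - cochain B (mi 0 0 1) W2 (s3 * h1) x"

fun gexp :: "gen \<Rightarrow> nat \<times> nat \<times> nat" where
  "gexp W1 = (1, 0, 0)" | "gexp W2 = (0, 1, 0)" | "gexp W3 = (0, 0, 1)"

lemma mi_mk: "mi a b c = mk_midx (a, b, c)"
  by (simp add: mi_def)

lemma gen_idx_gexp: "gen_idx g = mk_midx (gexp g)"
  by (cases g) (simp_all add: mi_mk)

lemma valid_gexp [simp]: "valid (gexp g)"
  by (cases g) (simp_all add: valid_iff)

lemma midx_length_tlen: "midx_length I = tlen (exps I)"
  by (cases "exps I") (simp add: midx_length_def tlen_def)

lemma midx_fact_tfact: "midx_fact I = tfact (exps I)"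
  by (cases "exps I") (simp add: midx_fact_def tfact_def)

lemma tlen_1_cases:
  assumes "tlen P = 1" obtains "P = (1, 0, 0)" | "P = (0, 1, 0)" | "P = (0, 0, 1)"
proof -
  obtain a b c where P: "P = (a, b, c)" by (cases P)
  then have "a + b + c = 1" using assms by (simp add: tlen_def)
  then have "(a = 1 \<and> b = 0 \<and> c = 0) \<or> (a = 0 \<and> b = 1 \<and> c = 0) \<or> (a = 0 \<and> b = 0 \<and> c = 1)" by linarith
  then show ?thesis using that P by blast
qed

context augmented_local_algebra
begin

lemma right_linear_cochain: "right_linear (cochain B J g a)"
  unfolding right_linear_def
  by (intro conjI allI; rule poly_mapping_eqI)
    (auto simp: cochain_def lookup_single lookup_add when_def distrib_left mult.assoc)

lemma dcf_cochain:
  assumes "valid Q"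
  shows "dcf (cochain B (mk_midx Q) g a) P I = (if P = gexp g \<and> I = Q then twist B (tpar Q) a else 0)"
proof (cases "valid P \<and> valid I")
  case True
  have g1: "tfact (gexp g) = 1" by (cases g) simp_all
  have e: "mk_midx (gexp g) = mk_midx P \<longleftrightarrow> gexp g = P" "mk_midx I = mk_midx Q \<longleftrightarrow> I = Q"
    using True assms by (metis exps_mk valid_gexp)+
  have "scal B (inverse (of_nat (tfact Q))) * (of_nat (tfact Q) * x) = x" for x
    using scal_inverse [of "of_nat (tfact Q)" x] by simp
  then show ?thesis
    using True assms g1 by (auto simp: dcf_def ent_def cochain_def lookup_single when_def gen_idx_gexp e
        midx_fact_tfact inverse_eq_divide mult.assoc)
next
  case False
  then show ?thesis using assms by auto
qed

lemma dcf_add: "dcf (\<lambda>x. F x + G x) P I = dcf F P I + dcf G P I"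
  and dcf_minus: "dcf (\<lambda>x. F x - G x) P I = dcf F P I - dcf G P I"
  by (simp_all add: dcf_def ent_def lookup_add lookup_minus distrib_left right_diff_distrib)

lemma right_linear_dt_cochain: "right_linear (dt_cochain B s1 s2 s3 h1 h2)"
  using right_linear_cochain
  by (simp add: right_linear_def dt_cochain_def sharp_cochain_def smul_add poly_mapping_eq_iff fun_eq_iff
      lookup_add lookup_minus distrib_right left_diff_distrib)

lemma dcf_dt_cochain:
  assumes "s1 \<in> homog B 0" "s2 \<in> homog B 0" "s3 \<in> homog B 0"
  shows "dcf (dt_cochain B s1 s2 s3 h1 h2) P I =
    (if P = (0, 1, 0) then
       (if I = (1, 1, 0) then 1 else if I = (1, 0, 0) then s1 else if I = (1, 0, 1) then - s3
        else if I = (0, 1, 0) then h2 else if I = (0, 0, 1) then - (s3 * h1) else 0)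
     else if P = (0, 0, 1) then
       (if I = (1, 1, 0) then 1 else if I = (1, 0, 1) then 1 else if I = (1, 0, 0) then s2
        else if I = (0, 1, 0) then h1 else if I = (0, 0, 1) then h2 else 0)
     else 0)"
proof -
  have v: "valid (1, 1, 0)" "valid (1, 0, 1)" "valid (1, 0, 0)" "valid (0, 1, 0)" "valid (0, 0, 1)"
    by (simp_all add: valid_iff)
  have t: "twist B p 1 = 1" "twist B p s1 = s1" "twist B p s2 = s2" "twist B p s3 = s3" for p
    using assms by (simp_all add: twist_even)
  show ?thesis
    unfolding dt_cochain_def sharp_cochain_def mi_mk dcf_add dcf_minus
    by (simp only: dcf_cochain v t gexp.simps tpar_simps twist_zero_parity) auto
qed

lemma right_linear_corestrict: "right_linear D \<Longrightarrow> right_linear (corestrict D)"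
  and dcf_corestrict: "dcf (corestrict D) P I = (if tlen P = 1 then dcf D P I else 0)"
proof -
  have l: "Poly_Mapping.lookup (corestrict D x) J = (if midx_length J = 1 then Poly_Mapping.lookup (D x) J else 0)" for x J
  proof -
    have "Poly_Mapping.lookup (corestrict D x) J =
      (\<Sum>I\<in>{I \<in> Poly_Mapping.keys (D x). midx_length I = 1}. if I = J then Poly_Mapping.lookup (D x) J else 0)"
      unfolding corestrict_def lookup_sum by (intro sum.cong refl) (auto simp: lookup_single when_def)
    then show ?thesis by (simp add: in_keys_iff)
  qed
  show "right_linear D \<Longrightarrow> right_linear (corestrict D)"
    unfolding right_linear_def by (auto intro!: poly_mapping_eqI simp: l lookup_add)
  show "dcf (corestrict D) P I = (if tlen P = 1 then dcf D P I else 0)"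
    by (simp add: dcf_def ent_def l midx_length_tlen)
qed

definition dt :: "'a \<Rightarrow> 'a \<Rightarrow> 'a \<Rightarrow> 'a \<Rightarrow> 'a \<Rightarrow> 'a sym \<Rightarrow> 'a sym" where
  "dt s1 s2 s3 h1 h2 = coder B 1 (dt_cochain B s1 s2 s3 h1 h2)"

text \<open>\<open>coder\<close> is a definite description, so it has to be shown that exactly one
  coderivation has this corestriction. Existence uses explicit rows, with zero on the odd
  coordinate; uniqueness is determination by the coordinates.\<close>

lemma
  assumes s: "s1 \<in> homog B 0" "s2 \<in> homog B 0" "s3 \<in> homog B 0" and h: "h1 \<in> homog B 1" "h2 \<in> homog B 1"
  shows coderivation_dt: "coderivation B 1 (dt s1 s2 s3 h1 h2)"
    and dcf_dt: "tlen P = 1 \<Longrightarrow> dcf (dt s1 s2 s3 h1 h2) P I = dcf (dt_cochain B s1 s2 s3 h1 h2) P I"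
proof -
  let ?l = "dt_cochain B s1 s2 s3 h1 h2"
  let ?X0 = "cc h2 * mon 1 0 - cc (s3 * h1) * mon 0 1" and ?X1 = "mon 1 0 + cc s1 - cc s3 * mon 0 1"
  let ?Y0 = "cc h1 * mon 1 0 + cc h2 * mon 0 1" and ?Y1 = "mon 1 0 + mon 0 1 + cc s2"
  have sh: "s3 * h1 \<in> homog B 1" using homog_mult [OF s(3) h(1)] by simp
  have "series_homog 1 ?X0" "series_homog (1 + 1) ?X1" "series_homog 1 ?Y0" "series_homog (1 + 1) ?Y1"
    "series_homog (1 + 1) 0" "series_homog 1 0"
    using s h sh by (auto intro!: series_homog_add series_homog_diff series_homog_mon series_homog_const
        series_homog_mult_even_right series_homog_0)
  moreover have "?X0 $ 0 $ 0 = 0" "?Y0 $ 0 $ 0 = 0" "(0 :: 'a fps fps) $ 0 $ 0 = 0"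
    by (simp_all add: mon_nth)
  ultimately obtain D where D: "coderivation B 1 D"
    and r: "row D (0, 1, 0) 0 = ?X0" "row D (0, 1, 0) 1 = ?X1" "row D (0, 0, 1) 0 = ?Y0" "row D (0, 0, 1) 1 = ?Y1"
      "row D (1, 0, 0) 0 = 0" "row D (1, 0, 0) 1 = 0"
    by (rule coderivation_exists)
  have lin: "right_linear D" using D by (simp add: coderivation_def)
  have gen: "dcf D P I = dcf ?l P I" if "tlen P = 1" for P I
  proof (cases "valid I")
    case True
    obtain k i j where I: "I = (k, i, j)" by (cases I)
    have k: "k = 0 \<or> k = 1" using True by (auto simp: I valid_iff)
    have "dcf D P I = row D P k $ j $ i" by (simp add: I)
    from that show ?thesis
    proof (cases rule: tlen_1_cases)
      case 1
      then show ?thesis using k r(5,6) \<open>dcf D P I = row D P k $ j $ i\<close> by (auto simp: dcf_dt_cochain [OF s] simp del: row_nth)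
    next
      case 2
      then show ?thesis using k \<open>dcf D P I = row D P k $ j $ i\<close> r(1,2)
        by (auto simp: dcf_dt_cochain [OF s] I mon_nth simp del: row_nth)
    next
      case 3
      then show ?thesis using k \<open>dcf D P I = row D P k $ j $ i\<close> r(3,4)
        by (auto simp: dcf_dt_cochain [OF s] I mon_nth simp del: row_nth)
    qed
  qed simp
  have c: "corestrict D = ?l"
  proof (rule dcf_ext [OF right_linear_corestrict [OF lin] right_linear_dt_cochain])
    fix P I
    show "dcf (corestrict D) P I = dcf ?l P I"
      using gen [of P I] by (auto simp: dcf_corestrict dcf_dt_cochain [OF s] tlen_def)
  qed
  have uniq: "E = D" if "coderivation B 1 E \<and> corestrict E = ?l" for E
  proof (rule coderivation_eqI)
    show "coderivation B 1 E" "coderivation B 1 D" using that D by simp_all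
    fix P I :: "nat \<times> nat \<times> nat" assume "P \<in> {(1, 0, 0), (0, 1, 0), (0, 0, 1)}"
    then have "tlen P = 1" by (auto simp: tlen_def)
    then show "dcf E P I = dcf D P I"
      using gen [of P I] dcf_corestrict [of E P I] that by simp
  qed
  have "dt s1 s2 s3 h1 h2 = D"
    unfolding dt_def coder_def by (rule the_equality) (rule conjI [OF D c], rule uniq)
  then show "coderivation B 1 (dt s1 s2 s3 h1 h2)" "tlen P = 1 \<Longrightarrow> dcf (dt s1 s2 s3 h1 h2) P I = dcf ?l P I"
    using D gen by simp_all
qed

lemma rows_dt:
  assumes s: "s1 \<in> homog B 0" "s2 \<in> homog B 0" "s3 \<in> homog B 0" and h: "h1 \<in> homog B 1" "h2 \<in> homog B 1"
  shows "row (dt s1 s2 s3 h1 h2) (0, 1, 0) 0 = cc h2 * mon 1 0 - cc s3 * cc h1 * mon 0 1"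
    "row (dt s1 s2 s3 h1 h2) (0, 1, 0) 1 = mon 1 0 + cc s1 - cc s3 * mon 0 1"
    "row (dt s1 s2 s3 h1 h2) (0, 0, 1) 0 = cc h1 * mon 1 0 + cc h2 * mon 0 1"
    "row (dt s1 s2 s3 h1 h2) (0, 0, 1) 1 = mon 1 0 + mon 0 1 + cc s2"
    "row (dt s1 s2 s3 h1 h2) (1, 0, 0) k = 0"
proof -
  have g: "tlen (0, 1, 0) = 1" "tlen (0, 0, 1) = 1" "tlen (1, 0, 0) = 1" by (simp_all add: tlen_def)
  show "row (dt s1 s2 s3 h1 h2) (0, 1, 0) 0 = cc h2 * mon 1 0 - cc s3 * cc h1 * mon 0 1"
    by (intro fps_ext, unfold row_nth dcf_dt [OF s h g(1)] dcf_dt_cochain [OF s]) (auto simp: mon_nth)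
  show "row (dt s1 s2 s3 h1 h2) (0, 1, 0) 1 = mon 1 0 + cc s1 - cc s3 * mon 0 1"
    by (intro fps_ext, unfold row_nth dcf_dt [OF s h g(1)] dcf_dt_cochain [OF s]) (auto simp: mon_nth)
  show "row (dt s1 s2 s3 h1 h2) (0, 0, 1) 0 = cc h1 * mon 1 0 + cc h2 * mon 0 1"
    by (intro fps_ext, unfold row_nth dcf_dt [OF s h g(2)] dcf_dt_cochain [OF s]) (auto simp: mon_nth)
  show "row (dt s1 s2 s3 h1 h2) (0, 0, 1) 1 = mon 1 0 + mon 0 1 + cc s2"
    by (intro fps_ext, unfold row_nth dcf_dt [OF s h g(2)] dcf_dt_cochain [OF s]) (auto simp: mon_nth)
  show "row (dt s1 s2 s3 h1 h2) (1, 0, 0) k = 0"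
    by (intro fps_ext, unfold row_nth dcf_dt [OF s h g(3)] dcf_dt_cochain [OF s]) auto
qed

text \<open>The square is an even coderivation, so it vanishes once its rows on the three
  coordinates do. There the chain rule leaves polynomials of degree at most one, whose cancellation
  needs the two relations only in the constant terms.\<close>

lemma dt_square:
  assumes s: "s1 \<in> homog B 0" "s2 \<in> homog B 0" "s3 \<in> homog B 0" and h: "h1 \<in> homog B 1" "h2 \<in> homog B 1"
    and rel: "s1 * h1 + s2 * h2 = 0" "- (s1 * h2) + s2 * s3 * h1 = 0"
  shows "dt s1 s2 s3 h1 h2 \<circ> dt s1 s2 s3 h1 h2 = (\<lambda>x. 0)"
proof (rule coderivation_eqI)
  let ?D = "dt s1 s2 s3 h1 h2"
  note D = coderivation_dt [OF s h]
  have lin: "right_linear ?D" using D by (simp add: coderivation_def)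
  show "coderivation B 0 (?D \<circ> ?D)" by (rule coderivation_square [OF D])
  have z: "dcf (\<lambda>x. 0) P I = 0" for P I by (simp add: dcf_def ent_def)
  have "right_linear (\<lambda>x :: 'a sym. 0 :: 'a sym)" by (simp add: right_linear_def)
  then show "coderivation B 0 (\<lambda>x. 0)"
    by (simp add: coderivation_iff dcf_parity_iff z homog_zero)
  define S1 where "S1 = cc s1"
  define S2 where "S2 = cc s2"
  define S3 where "S3 = cc s3"
  define H1 where "H1 = cc h1"
  define H2 where "H2 = cc h2"
  have hs: "series_homog 0 S1" "series_homog 0 S2" "series_homog 0 S3" "series_homog 1 H1" "series_homog 1 H2"
    using s h by (simp_all add: S1_def S2_def S3_def H1_def H2_def series_homog_const)
  have dxc: "dx S1 = 0" "dx S2 = 0" "dx S3 = 0" "dx H1 = 0" "dx H2 = 0"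
      "dy S1 = 0" "dy S2 = 0" "dy S3 = 0" "dy H1 = 0" "dy H2 = 0"
    by (simp_all add: S1_def S2_def S3_def H1_def H2_def)
  have sq: "H1 * H1 = 0" "H2 * H2 = 0" "H2 * H1 = - (H1 * H2)" "H1 * (H1 * w) = 0" "H2 * (H2 * w) = 0"
      "H2 * (H1 * w) = - (H1 * (H2 * w))" for w
    using series_odd_square [OF hs(4)] series_odd_square [OF hs(5)] series_odd_anticommute [OF hs(5,4)]
    by (simp_all flip: mult.assoc)
  have c3: "H1 * S3 = S3 * H1" "H2 * S3 = S3 * H2" "H1 * (S3 * w) = S3 * (H1 * w)" "H2 * (S3 * w) = S3 * (H2 * w)" for w
    using series_even_commute [OF hs(3)] by (metis mult.assoc)+
  have c12: "H1 * S1 = S1 * H1" "H2 * S1 = S1 * H2" "H1 * S2 = S2 * H1" "H2 * S2 = S2 * H2"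
    using series_even_commute [OF hs(1)] series_even_commute [OF hs(2)] by metis+
  have "cc (s1 * h1 + s2 * h2) = 0" "cc (s1 * h2) = cc (s2 * (s3 * h1))"
    using rel by (simp_all add: mult.assoc)
  then have "S1 * H1 + S2 * H2 = 0" "S1 * H2 = S2 * (S3 * H1)"
    by (simp_all add: S1_def S2_def S3_def H1_def H2_def)
  then have R: "S2 * H2 = - (S1 * H1)" "S1 * H2 = S2 * (S3 * H1)"
    by (simp_all add: eq_neg_iff_add_eq_0 add.commute)
  have c32: "S3 * (S2 * H1) = S2 * (S3 * H1)"
    using series_even_commute [OF hs(3)] by (metis mult.assoc)
  note rows = rows_dt [OF s h, folded S1_def S2_def S3_def H1_def H2_def]
  have X: "row (?D \<circ> ?D) (0, 1, 0) 0 = 0" "row (?D \<circ> ?D) (0, 1, 0) 1 = 0"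
    unfolding row_comp_coderivation [OF lin D] rows dx_add dx_diff dx_mult fps_deriv_add fps_deriv_sub fps_deriv_mult dxc dx_mon
    by (simp_all add: algebra_simps sq c3 c12 c32 R)
  have Y: "row (?D \<circ> ?D) (0, 0, 1) 0 = 0" "row (?D \<circ> ?D) (0, 0, 1) 1 = 0"
    unfolding row_comp_coderivation [OF lin D] rows dx_add dx_diff dx_mult fps_deriv_add fps_deriv_sub fps_deriv_mult dxc dx_mon
    by (simp_all add: algebra_simps sq c3 c12 c32 R)
  have Z: "row (?D \<circ> ?D) (1, 0, 0) 0 = 0" "row (?D \<circ> ?D) (1, 0, 0) 1 = 0"
    unfolding row_comp_coderivation [OF lin D] rows by simp_all
  fix P I :: "nat \<times> nat \<times> nat" assume P: "P \<in> {(1, 0, 0), (0, 1, 0), (0, 0, 1)}"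
  show "dcf (?D \<circ> ?D) P I = dcf (\<lambda>x. 0) P I"
  proof (cases "valid I")
    case True
    obtain k i j where I: "I = (k, i, j)" by (cases I)
    have k: "k = 0 \<or> k = 1" using True by (auto simp: I valid_iff)
    have "row (?D \<circ> ?D) P k = 0" using P k X Y Z by auto
    then have "row (?D \<circ> ?D) P k $ j $ i = 0" by simp
    then show ?thesis by (simp add: I z)
  qed simp
qed

text \<open>For odd D the graded commutator [D, D] is 2 D^2, and 2 is invertible.\<close>

lemma linf_structure_iff: "linf_structure B D \<longleftrightarrow> coderivation B 1 D \<and> D \<circ> D = (\<lambda>x. 0)"
proof -
  have "smul x (- 1) = - x" for x :: "'a sym" by (rule poly_mapping_eqI) simp
  moreover have "x + x = 0 \<longleftrightarrow> x = 0" for x :: "'a sym"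
  proof
    assume "x + x = 0"
    then have "Poly_Mapping.lookup x J + Poly_Mapping.lookup x J = 0" for J
      by (metis lookup_add lookup_zero)
    then have "Poly_Mapping.lookup x J = 0" for J by (rule double_zero)
    then show "x = 0" by (intro poly_mapping_eqI) simp
  qed simp
  ultimately have "graded_commutator 1 1 D D x = 0 \<longleftrightarrow> D (D x) = 0" for x
    unfolding graded_commutator_def mult_1 ksign_1 by simp
  then show ?thesis
    unfolding linf_structure_def fun_eq_iff comp_apply by simp
qed

end

lemma push_dt:
  assumes A: "augmented_local_algebra A" and B: "augmented_local_algebra B" and f: "base_hom A B f"
    and s: "s1 \<in> homog A 0" "s2 \<in> homog A 0" "s3 \<in> homog A 0" and h: "h1 \<in> homog A 1" "h2 \<in> homog A 1"
  shows "push f (augmented_local_algebra.dt A s1 s2 s3 h1 h2) =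
    augmented_local_algebra.dt B (f s1) (f s2) (f s3) (f h1) (f h2)"
proof -
  interpret A: augmented_local_algebra A by fact
  interpret B: augmented_local_algebra B by fact
  have s': "f s1 \<in> homog B 0" "f s2 \<in> homog B 0" "f s3 \<in> homog B 0" and h': "f h1 \<in> homog B 1" "f h2 \<in> homog B 1"
    using f s h by (simp_all add: base_hom_def)
  show ?thesis
  proof (rule B.coderivation_eqI)
    show "coderivation B 1 (push f (A.dt s1 s2 s3 h1 h2))"
      by (rule coderivation_push [OF A B f A.coderivation_dt [OF s h]])
    show "coderivation B 1 (B.dt (f s1) (f s2) (f s3) (f h1) (f h2))"
      by (rule B.coderivation_dt [OF s' h'])
    fix P I :: "nat \<times> nat \<times> nat" assume "P \<in> {(1, 0, 0), (0, 1, 0), (0, 0, 1)}"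
    then have P: "tlen P = 1" by (auto simp: tlen_def)
    have "f 1 = 1" "f (s3 * h1) = f s3 * f h1" using f by (simp_all add: base_hom_def)
    then show "B.dcf (push f (A.dt s1 s2 s3 h1 h2)) P I = B.dcf (B.dt (f s1) (f s2) (f s3) (f h1) (f h2)) P I"
      unfolding dcf_push [OF A B f] A.dcf_dt [OF s h P] B.dcf_dt [OF s' h' P]
        A.dcf_dt_cochain [OF s] B.dcf_dt_cochain [OF s']
      by (simp add: base_hom_zero [OF f] base_hom_uminus [OF f])
  qed
qed

interpretation field: augmented_local_algebra field_base
  by (rule field_base_algebra)

lemma d_sharp_dt: "d_sharp = field.dt 0 0 0 0 0"
proof -
  have "cochain field_base I j 0 x = 0" for I j x
    by (rule poly_mapping_eqI) (simp add: cochain_def)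
  then have "dt_cochain field_base 0 0 0 0 0 = sharp_cochain field_base"
    by (simp add: fun_eq_iff dt_cochain_def)
  then show ?thesis by (simp add: d_sharp_def field.dt_def)
qed

lemma d2_dt: "d2 = A.dt t1 t2 t3 \<theta>1 \<theta>2"
proof -
  have "dt_cochain base_A t1 t2 t3 \<theta>1 \<theta>2 = d2_cochain"
    by (simp add: fun_eq_iff dt_cochain_def d2_cochain_def)
  then show ?thesis by (simp add: d2_def A.dt_def)
qed

lemma push_d2:
  assumes "augmented_local_algebra B" "base_hom base_A B f"
  shows "push f d2 = augmented_local_algebra.dt B (f t1) (f t2) (f t3) (f \<theta>1) (f \<theta>2)"
  unfolding d2_dt by (rule push_dt [OF base_A_algebra assms t_homog])

lemma deformation_d2: "deformation base_A d_sharp d2"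
proof -
  have "linf_structure base_A d2"
    unfolding A.linf_structure_iff d2_dt
    using A.coderivation_dt [OF t_homog] A.dt_square [OF t_homog base_relations] by simp
  moreover have "push (aug base_A) d2 = d_sharp"
    using push_d2 [OF field_base_algebra base_hom_aug [OF base_A_algebra]] t_max_ideal
    by (simp add: d_sharp_dt max_ideal_def del: base_A_simps)
  ultimately show ?thesis by (simp add: deformation_def)
qed


section \<open>Invertibility and conjugation\<close>

context formal_algebra
begin

text \<open>\<open>G\<close> is the identity modulo the maximal ideal, so it can be inverted by
  m-adic approximation. Such limits could have infinite support; \<open>len\<close> prevents this,
  since \<open>G\<close> preserves the span of the finitely many monomials of bounded
  length.\<close>

lemma bij_of_unipotent:
  assumes lin: "right_linear G"
    and len: "\<And>P I. dcf G P I \<noteq> 0 \<Longrightarrow> tlen P \<le> tlen I"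
    and aug: "\<And>P I. valid P \<Longrightarrow> valid I \<Longrightarrow> aug B (dcf G P I) = (if P = I then 1 else 0)"
  shows "bij G"
proof -
  define len where "len J = tlen (exps J)" for J
  have ent_len: "ent G J I = 0" if "len I < len J" for J I
  proof (rule ccontr)
    assume "ent G J I \<noteq> 0"
    then have "dcf G (exps J) (exps I) \<noteq> 0" by (auto simp: ent_dcf)
    then show False using assms(2) [of "exps J" "exps I"] that by (simp add: len_def)
  qed
  have small: "ent G J I - ent id J I \<in> max_ideal B" for J I
  proof (cases "J = I")
    case True
    then show ?thesis
      using aug [of "exps I" "exps I"] by (simp add: max_ideal_iff aug_diff ent_dcf [of G] ent_id aug_mult aug_scal)
  next
    case False
    then have "exps J \<noteq> exps I" by (simp add: exps_inject)
    then show ?thesis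
      using False aug [of "exps J" "exps I"] by (simp add: max_ideal_iff aug_diff ent_dcf [of G] ent_id aug_mult when_def)
  qed
  define S where "S M = {J. len J \<le> M}" for M
  have fin: "finite (S M)" for M
  proof (rule finite_subset)
    show "S M \<subseteq> mk_midx ` {P. P \<le> (M, M, M)}"
    proof
      fix J assume "J \<in> S M"
      then have "exps J \<le> (M, M, M)" by (cases "exps J") (simp add: S_def len_def tlen_def)
      then show "J \<in> mk_midx ` {P. P \<le> (M, M, M)}" by (intro image_eqI [of _ _ "exps J"]) simp_all
    qed
  qed simp
  have keysG: "Poly_Mapping.keys (G z) \<subseteq> S M" if z: "Poly_Mapping.keys z \<subseteq> S M" for z M
  proof
    fix J assume "J \<in> Poly_Mapping.keys (G z)"
    then have "Poly_Mapping.lookup (G z) J \<noteq> 0" by (simp add: in_keys_iff)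
    then have "(\<Sum>I\<in>S M. ent G J I * Poly_Mapping.lookup z I) \<noteq> 0"
      using right_linear_lookup [OF lin fin z] by simp
    then obtain I where I: "I \<in> S M" "ent G J I * Poly_Mapping.lookup z I \<noteq> 0"
      by (rule sum.not_neutral_contains_not_neutral)
    then have "ent G J I \<noteq> 0" by auto
    then have "\<not> len I < len J" using ent_len by blast
    then show "J \<in> S M" using I(1) by (simp add: S_def)
  qed
  have contr: "Poly_Mapping.lookup (G z - z) J \<in> mp (Suc k)"
    if z: "\<And>I. Poly_Mapping.lookup z I \<in> mp k" for z J k
  proof -
    let ?K = "Poly_Mapping.keys z"
    have 1: "Poly_Mapping.lookup (G z) J = (\<Sum>I\<in>?K. ent G J I * Poly_Mapping.lookup z I)"
      by (rule right_linear_lookup [OF lin]) simp_all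
    have 2: "Poly_Mapping.lookup z J = (\<Sum>I\<in>?K. ent id J I * Poly_Mapping.lookup z I)"
      using right_linear_lookup [OF right_linear_id, of ?K z J] by simp
    show ?thesis
      unfolding lookup_minus 1 by (subst 2, unfold sum_subtractf [symmetric] left_diff_distrib [symmetric])
        (intro mp_sum mp_Suc_mult_left z small)
  qed
  have diff: "G (x - y) = G x - G y" for x y
    using right_linear_add [OF lin, of "x - y" y] by (simp add: eq_diff_eq)
  have "inj G"
  proof (rule injI)
    fix x y assume "G x = G y"
    define z where "z = x - y"
    have Gz: "G z = 0" using \<open>G x = G y\<close> by (simp add: z_def diff)
    have "\<forall>J. Poly_Mapping.lookup z J \<in> mp k" for k
    proof (induction k)
      case (Suc k)
      then have "Poly_Mapping.lookup (G z - z) J \<in> mp (Suc k)" for J by (intro contr) blast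
      then show ?case by (simp add: Gz)
    qed simp
    then have "Poly_Mapping.lookup z J = 0" for J by (intro mp_all_zero) blast
    then have "z = 0" by (intro poly_mapping_eqI) simp
    then show "x = y" by (simp add: z_def)
  qed
  moreover have "\<exists>z. G z = y" for y
  proof -
    obtain M where M: "Poly_Mapping.keys y \<subseteq> S M"
    proof
      show "Poly_Mapping.keys y \<subseteq> S (\<Sum>J\<in>Poly_Mapping.keys y. len J)"
        by (auto simp: S_def intro: member_le_sum)
    qed
    \<comment> \<open>The iteration z := y - (G z - z), whose fixed points are the preimages of
      \<open>y\<close>. All iterates are supported in the finite set \<open>S M\<close>, hence so is
      the limit.\<close>
    define q where "q k = ((\<lambda>z. y - (G z - z)) ^^ k) 0" for k
    have q: "q 0 = 0" "q (Suc k) = y - (G (q k) - q k)" for k by (simp_all add: q_def)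
    have keys: "Poly_Mapping.keys (q k) \<subseteq> S M" for k
    proof (induction k)
      case (Suc k)
      have "Poly_Mapping.keys (a - b) \<subseteq> S M" if "Poly_Mapping.keys a \<subseteq> S M" "Poly_Mapping.keys b \<subseteq> S M" for a b :: "'a sym"
        using that Poly_Mapping.keys_diff [of a b] by blast
      then show ?case unfolding q(2) using M Suc keysG [OF Suc] by blast
    qed (simp add: q)
    have step: "\<forall>J. Poly_Mapping.lookup (q (Suc k) - q k) J \<in> mp k" for k
    proof (induction k)
      case (Suc k)
      have "q (Suc (Suc k)) - q (Suc k) = - (G (q (Suc k) - q k) - (q (Suc k) - q k))"
        unfolding q(2) [of "Suc k"] diff by (subst q(2)) simp
      then show ?case using contr Suc by (metis lookup_uminus mp_uminus)
    qed simp
    have "\<exists>x. \<forall>k. x - Poly_Mapping.lookup (q k) J \<in> mp k" for J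
      by (rule complete) (use step in \<open>simp add: lookup_minus\<close>)
    then obtain lim where lim: "lim J - Poly_Mapping.lookup (q k) J \<in> mp k" for J k by metis
    have out: "lim J = 0" if "J \<notin> S M" for J
    proof (rule mp_all_zero)
      fix k
      have "J \<notin> Poly_Mapping.keys (q k)" using keys [of k] that by blast
      then show "lim J \<in> mp k" using lim [of J k] by (simp add: in_keys_iff)
    qed
    define z where "z = Abs_poly_mapping lim"
    have "finite {J. lim J \<noteq> 0}" by (rule finite_subset [OF _ fin [of M]]) (use out in auto)
    then have z: "Poly_Mapping.lookup z J = lim J" for J by (simp add: z_def lookup_Abs_poly_mapping)
    have "Poly_Mapping.lookup (G z - y) J \<in> mp k" for J k
    proof -
      have zq: "Poly_Mapping.lookup (z - q k) J \<in> mp k" for J using lim by (simp add: lookup_minus z)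
      have "G z - y = (G (z - q k) - (z - q k)) + (z - q k) - (q (Suc k) - q k)"
        unfolding q(2) diff by simp
      then have "Poly_Mapping.lookup (G z - y) J = Poly_Mapping.lookup (G (z - q k) - (z - q k)) J
          + Poly_Mapping.lookup (z - q k) J - Poly_Mapping.lookup (q (Suc k) - q k) J"
        by (simp only: lookup_add lookup_minus)
      moreover have "Poly_Mapping.lookup (G (z - q k) - (z - q k)) J \<in> mp k"
        using contr [OF zq] mp_Suc_subset by blast
      ultimately show ?thesis using zq [of J] step [of k] by (simp only: mp_add mp_diff)
    qed
    then have "Poly_Mapping.lookup (G z - y) J = 0" for J by (intro mp_all_zero)
    then have "G z - y = 0" by (intro poly_mapping_eqI) simp
    then show ?thesis by auto
  qed
  ultimately show ?thesis by (metis bijI surjI)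
qed

end

context augmented_local_algebra
begin

text \<open>A row of a composite depends only on the same row of the left factor; the rows may be
  infinite, but the column of \<open>M\<close> is finite.\<close>

lemma dcf_comp_cong:
  assumes "right_linear E" "right_linear E'" "\<And>J. dcf E P J = dcf E' P J"
  shows "dcf (E \<circ> M) P I = dcf (E' \<circ> M) P I"
proof -
  let ?S = "exps ` Poly_Mapping.keys (M (Poly_Mapping.single (mk_midx I) 1))"
  have S: "J \<in> ?S" if "valid J" "dcf M J I \<noteq> 0" for J
    using that by (intro image_eqI [of _ _ "mk_midx J"]) (auto simp: dcf_def in_keys_iff ent_def split: if_splits)
  have "dcf (E \<circ> M) P I = (\<Sum>J\<in>?S. dcf E P J * dcf M J I)"
  proof (rule dcf_comp [OF assms(1)])
    fix J assume "valid J" "dcf E P J * dcf M J I \<noteq> 0"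
    then show "J \<in> ?S" using S [of J] by (metis mult_zero_right)
  qed simp
  also have "\<dots> = dcf (E' \<circ> M) P I"
    unfolding assms(3)
  proof (rule dcf_comp [OF assms(2), symmetric])
    fix J assume "valid J" "dcf E' P J * dcf M J I \<noteq> 0"
    then show "J \<in> ?S" using S [of J] by (metis mult_zero_right)
  qed simp
  finally show ?thesis .
qed

lemma push_aug_inv:
  assumes "right_linear G" "bij G" "push (aug B) G = id"
  shows "push (aug B) (inv G) = id"
proof -
  note h = base_hom_aug [OF augmented_local_algebra_axioms]
  have "G \<circ> inv G = id" using assms(2) by (simp add: fun_eq_iff bij_is_surj surj_f_inv_f)
  then have "push (aug B) G \<circ> push (aug B) (inv G) = id"
    using push_comp [OF h assms(1), of "inv G"] push_id [OF h] by simp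
  then show ?thesis by (simp add: assms(3))
qed

lemma aug_dcf:
  "field.dcf (push (aug B) F) P I = aug B (dcf F P I)"
  by (rule dcf_push [OF augmented_local_algebra_axioms field_base_algebra base_hom_aug [OF augmented_local_algebra_axioms]])

lemma aug_dcf_deformation:
  assumes "push (aug B) D = d_sharp" "tlen P = 1"
  shows "aug B (dcf D P I) = (if P = (0, 1, 0) \<and> I = (1, 1, 0) \<or> P = (0, 0, 1) \<and> (I = (1, 1, 0) \<or> I = (1, 0, 1)) then 1 else 0)"
proof -
  have f: "(0 :: complex) \<in> homog field_base p" for p by (rule field.homog_zero)
  have "aug B (dcf D P I) = field.dcf d_sharp P I"
    using aug_dcf [of D P I] assms(1) by simp
  then show ?thesis
    unfolding d_sharp_dt field.dcf_dt [OF f f f f f assms(2)] field.dcf_dt_cochain [OF f f f] by auto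
qed

lemma series_mp_power:
  assumes "series_mp 1 (f - g)" shows "series_mp 1 (f ^ n - g ^ n)"
proof (induction n)
  case (Suc n)
  have "f ^ Suc n - g ^ Suc n = f * (f ^ n - g ^ n) + (f - g) * g ^ n"
    by (simp add: algebra_simps)
  then show ?case using Suc assms by (simp only: series_mp_add series_mp_left series_mp_right)
qed (simp add: series_mp_0)

end

lemma mon_power: "mon 1 0 ^ m * mon 0 1 ^ n = (mon m n :: 'a::ring_1 fps fps)"
proof -
  have "mon 1 0 ^ m = (mon m 0 :: 'a fps fps)" by (induction m) (simp_all add: mon_mult)
  moreover have "mon 0 1 ^ n = (mon 0 n :: 'a fps fps)" by (induction n) (simp_all add: mon_mult)
  ultimately show ?thesis by (simp add: mon_mult)
qed


section \<open>Versality\<close>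

context formal_algebra
begin

text \<open>\<open>normal_form\<close> supplies the parameters, hence the homomorphism, and the new
  coordinates, hence a morphism \<open>G\<close>. Its equations say that \<open>E \<circ> G\<close>
  and \<open>G \<circ> D\<close> agree on the coordinates, where \<open>E\<close> is the family at
  these parameters.\<close>

lemma d2_versal:
  assumes def: "deformation B d_sharp D"
  obtains f where "base_hom base_A B f" "equivalent B (push f d2) D"
proof -
  have D: "coderivation B 1 D" and D2: "D \<circ> D = (\<lambda>x. 0)" and push: "push (aug B) D = d_sharp"
    using def by (simp_all add: deformation_def linf_structure_iff)
  have lin: "right_linear D" and par: "has_parity B 1 D" using D by (simp_all add: coderivation_def)
  define X0 where "X0 = row D (0, 1, 0) 0"
  define X1 where "X1 = row D (0, 1, 0) 1"
  define Y0 where "Y0 = row D (0, 0, 1) 0"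
  define Y1 where "Y1 = row D (0, 0, 1) 1"
  define Z0 where "Z0 = row D (1, 0, 0) 0"
  define Z1 where "Z1 = row D (1, 0, 0) 1"
  note defs = X0_def X1_def Y0_def Y1_def Z0_def Z1_def
  have pr: "series_homog (1 + tpar P + of_nat k) (row D P k)" for P k
  proof -
    have "dcf D P (k, i, j) \<in> homog B (1 + tpar P + tpar (k, i, j))" for i j
      by (rule dcf_homog [OF lin par])
    then show ?thesis by (simp add: series_homog_def tpar_def)
  qed
  have hs: "series_homog 1 X0" "series_homog 0 X1" "series_homog 1 Y0" "series_homog 0 Y1"
      "series_homog 0 Z0" "series_homog 1 Z1"
    using pr [of "(0, 1, 0)" 0] pr [of "(0, 1, 0)" 1] pr [of "(0, 0, 1)" 0] pr [of "(0, 0, 1)" 1]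
      pr [of "(1, 0, 0)" 0] pr [of "(1, 0, 0)" 1] by (simp_all add: defs)
  have const: "X0 $ 0 $ 0 = 0" "Y0 $ 0 $ 0 = 0" "Z0 $ 0 $ 0 = 0"
    by (simp_all add: defs valid_iff)
  have g: "tlen (0, 1, 0) = 1" "tlen (0, 0, 1) = 1" "tlen (1, 0, 0) = 1" by (simp_all add: tlen_def)
  have small: "series_mp 1 (X1 - mon 1 0)" "series_mp 1 (Y1 - (mon 1 0 + mon 0 1))" "series_mp 1 Z1"
    using aug_dcf_deformation [OF push g(1)] aug_dcf_deformation [OF push g(2)] aug_dcf_deformation [OF push g(3)]
    by (auto simp: series_mp_def defs max_ideal_iff aug_diff aug_add mon_nth)
  have square: "vf X1 Y1 (vf X0 Y0 f0 + f1 * Z0) + (vf X1 Y1 f0 + f1 * Z1 - vf X0 Y0 f1) * Z1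
        - vf X0 Y0 (vf X1 Y1 f0 + f1 * Z1 - vf X0 Y0 f1) = 0" if f0: "f0 $ 0 $ 0 = 0" for f0 f1
  proof -
    \<comment> \<open>A test map with the single nonzero row f0 + f1 xi. Followed by D twice it is
      zero, and the xi-part of this row is the identity wanted.\<close>
    define A where "A P I = (if P = (0, 1, 0) then (case I of (k, i, j) \<Rightarrow> (if k = 0 then f0 else f1) $ j $ i) else 0)"
      for P I :: "nat \<times> nat \<times> nat"
    define E where "E = of_dcf A"
    have fin: "finite {P. valid P \<and> A P I \<noteq> 0}" for I
      by (rule finite_subset [of _ "{(0, 1, 0)}"]) (auto simp: A_def)
    have linE: "right_linear E" unfolding E_def by (rule right_linear_of_dcf) (rule fin)
    have e: "dcf E (0, 1, 0) I = A (0, 1, 0) I" if "valid I" for I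
      unfolding E_def by (rule dcf_of_dcf [where A = A, OF fin _ that]) (simp add: valid_iff)
    have r0: "row E (0, 1, 0) 0 = f0"
    proof (intro fps_ext)
      fix i j show "row E (0, 1, 0) 0 $ j $ i = f0 $ j $ i"
        using e [of "(0, i, j)"] f0 by (cases "i = 0"; cases "j = 0") (simp_all add: A_def valid_iff)
    qed
    have r1: "row E (0, 1, 0) 1 = f1"
    proof (intro fps_ext)
      fix i j show "row E (0, 1, 0) 1 $ j $ i = f1 $ j $ i"
        using e [of "(1, i, j)"] by (simp add: A_def valid_iff)
    qed
    have "row ((E \<circ> D) \<circ> D) (0, 1, 0) 1 = 0"
    proof -
      have "(E \<circ> D) \<circ> D = (\<lambda>x. 0)"
        using D2 right_linear_zero [OF linE] by (simp add: fun_eq_iff)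
      then show ?thesis by (intro fps_ext) (simp add: dcf_def ent_def)
    qed
    then show ?thesis
      unfolding row_comp_coderivation(2) [OF right_linear_comp [OF linE lin] D] row_comp_coderivation [OF linE D]
        r0 r1 defs [symmetric] vf_def by (simp only:)
  qed
  obtain x y c0 a t1 t2 t3 h1 h2 where
    hx: "series_homog 0 x" "series_homog 0 y" "series_homog 1 c0" and
    sx: "series_mp 1 (x - mon 1 0)" "series_mp 1 (y - mon 0 1)" "series_mp 1 c0" and
    x0: "x $ 0 $ 0 = 0" "y $ 0 $ 0 = 0" "c0 $ 0 $ 0 = 0" and
    ha: "a \<in> homog B 0" and ht: "t1 \<in> homog B 0" "t2 \<in> homog B 0" "t3 \<in> homog B 0" and
    hh: "h1 \<in> homog B 1" "h2 \<in> homog B 1" and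
    ma: "a \<in> max_ideal B" and mt: "t1 \<in> max_ideal B" "t2 \<in> max_ideal B" "t3 \<in> max_ideal B" and
    eqs: "vf X0 Y0 x = cc h2 * x - cc t3 * cc h1 * y + (x + cc t1 - cc t3 * y) * c0"
    "vf X0 Y0 y = cc h1 * x + cc h2 * y + (x + y + cc t2) * c0"
    "vf X1 Y1 x = (1 + cc a) * (x + cc t1 - cc t3 * y)"
    "vf X1 Y1 y = (1 + cc a) * (x + y + cc t2)"
    "vf X0 Y0 c0 + (1 + cc a) * Z0 = 0" "vf X1 Y1 c0 + (1 + cc a) * Z1 = 0" and
    rel: "t1 * h1 + t2 * h2 = 0" "- (t1 * h2) + t2 * t3 * h1 = 0"
    by (rule normal_form [OF hs const small square])
  obtain f where f: "base_hom base_A B f"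
    and ft: "f Defs.t1 = t1" "f Defs.t2 = t2" "f Defs.t3 = t3" "f \<theta>1 = h1" "f \<theta>2 = h2"
    by (rule base_hom_exists [OF ht hh mt rel])
  define E where "E = dt t1 t2 t3 h1 h2"
  have pushE: "push f d2 = E"
    using push_d2 [OF augmented_local_algebra_axioms f] by (simp add: ft E_def)
  have cE: "coderivation B 1 E" unfolding E_def by (rule coderivation_dt [OF ht hh])
  have linE: "right_linear E" using cE by (simp add: coderivation_def)
  define c where "c = 1 + cc a"
  have hc: "series_homog 0 c" using ha unfolding c_def by (intro series_homog_add series_homog_1 series_homog_const)
  obtain G where G: "right_linear G" "has_parity B 0 G" "\<And>x. comult (G x) = tens_map B 0 G G (comult x)"
    and rG: "\<And>m n. m + n \<noteq> 0 \<Longrightarrow> row G (0, m, n) 0 = x ^ m * y ^ n"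
      "\<And>m n. m + n \<noteq> 0 \<Longrightarrow> row G (0, m, n) 1 = 0"
      "\<And>m n. row G (1, m, n) 0 = x ^ m * y ^ n * c0"
      "\<And>m n. row G (1, m, n) 1 = x ^ m * y ^ n * c"
    and len: "\<And>P I. dcf G P I \<noteq> 0 \<Longrightarrow> tlen P \<le> tlen I"
  proof (rule morphism_exists [OF hx(1,2,3) hc x0], goal_cases)
    case (1 L)
    show ?case by (rule that; fact 1)
  qed
  have xy: "series_mp 1 (x ^ m * y ^ n - mon m n)" for m n
  proof -
    have "x ^ m * y ^ n - mon m n = x ^ m * (y ^ n - mon 0 1 ^ n) + (x ^ m - mon 1 0 ^ m) * mon 0 1 ^ n"
      unfolding mon_power [of m n, symmetric] by (simp add: algebra_simps)
    then show ?thesis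
      using series_mp_power [OF sx(1), of m] series_mp_power [OF sx(2), of n]
      by (simp only: series_mp_add series_mp_left series_mp_right)
  qed
  have augG: "aug B (dcf G P I) = (if P = I then 1 else 0)" if v: "valid P" "valid I" for P I
  proof -
    obtain b m n where P: "P = (b, m, n)" by (cases P)
    obtain k i j where I: "I = (k, i, j)" by (cases I)
    have bk: "b = 0 \<or> b = 1" "k = 0 \<or> k = 1" using v by (auto simp: P I valid_iff)
    have dr: "dcf G P I = row G P k $ j $ i" by (simp add: I)
    have m1: "aug B ((x ^ m * y ^ n) $ j $ i) = (if m = i \<and> n = j then 1 else 0)"
      using xy [of m n] by (auto simp: series_mp_def max_ideal_iff aug_diff mon_nth split: if_splits)
    have m2: "aug B ((x ^ m * y ^ n * c0) $ j $ i) = 0"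
      using series_mp_left [OF sx(3), of "x ^ m * y ^ n"] by (simp add: series_mp_def max_ideal_iff)
    have m3: "aug B ((x ^ m * y ^ n * c) $ j $ i) = (if m = i \<and> n = j then 1 else 0)"
    proof -
      have "series_mp 1 (x ^ m * y ^ n * cc a)" using ma by (intro series_mp_left) (simp add: series_mp_const)
      then show ?thesis using m1 by (simp add: c_def distrib_left aug_add series_mp_def max_ideal_iff)
    qed
    consider "b = 0" "k = 0" | "b = 0" "k = 1" | "b = 1" "k = 0" | "b = 1" "k = 1" using bk by blast
    then show ?thesis
    proof cases
      case 1
      then have "m + n \<noteq> 0" using v by (auto simp: P valid_iff)
      then show ?thesis using 1 m1 unfolding dr by (simp add: P I rG del: row_nth)
    next
      case 2
      then have "m + n \<noteq> 0" using v by (auto simp: P valid_iff)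
      then show ?thesis using 2 rG(2) unfolding dr by (simp add: P I del: row_nth)
    next
      case 3
      then show ?thesis using m2 rG(3) unfolding dr by (simp add: P I del: row_nth)
    next
      case 4
      then show ?thesis using m3 rG(4) unfolding dr by (simp add: P I del: row_nth)
    qed
  qed
  have bij: "bij G" by (rule bij_of_unipotent [OF G(1) len augG])
  have autG: "coalgebra_aut B G" using G bij by (simp add: coalgebra_aut_def)
  have pushG: "push (aug B) G = id"
  proof (rule field.dcf_ext)
    fix P I assume "valid P" "valid I"
    then show "field.dcf (push (aug B) G) P I = field.dcf id P I"
      by (simp add: aug_dcf augG field.dcf_id)
  qed (simp_all add: right_linear_push right_linear_id)
  have rEG: "row (E \<circ> G) P k = row (G \<circ> D) P k" if P: "P \<in> {(1, 0, 0), (0, 1, 0), (0, 0, 1)}" and k: "k \<le> 1" for P k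
  proof -
    have tP: "tlen P = 1" using P by (auto simp: tlen_def)
    \<comment> \<open>The columns in which a coordinate row of \<open>E\<close> can be
      nonzero.\<close>
    let ?S = "{(1, 1, 0), (1, 0, 1), (1, 0, 0), (0, 1, 0), (0, 0, 1)} :: (nat \<times> nat \<times> nat) set"
    have dE: "dcf E P J = dcf (dt_cochain B t1 t2 t3 h1 h2) P J" for J
      unfolding E_def by (rule dcf_dt [OF ht hh tP])
    have s: "dcf (E \<circ> G) P I = (\<Sum>J\<in>?S. dcf E P J * dcf G J I)" for I
    proof (rule dcf_comp [OF linE])
      fix J assume "dcf E P J * dcf G J I \<noteq> 0"
      then have "dcf E P J \<noteq> 0" by auto
      then show "J \<in> ?S" unfolding dE dcf_dt_cochain [OF ht] by (auto split: if_splits)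
    qed simp
    have sS: "sum F ?S = F (1, 1, 0) + (F (1, 0, 1) + (F (1, 0, 0) + (F (0, 1, 0) + F (0, 0, 1))))"
      for F :: "nat \<times> nat \<times> nat \<Rightarrow> 'a" by simp
    have r: "row (E \<circ> G) P l =
        cc (dcf E P (1, 1, 0)) * row G (1, 1, 0) l + (cc (dcf E P (1, 0, 1)) * row G (1, 0, 1) l
        + (cc (dcf E P (1, 0, 0)) * row G (1, 0, 0) l + (cc (dcf E P (0, 1, 0)) * row G (0, 1, 0) l
        + cc (dcf E P (0, 0, 1)) * row G (0, 0, 1) l)))" for l
      by (intro fps_ext) (simp only: row_nth s sS fps_add_nth fps_mult_left_const_nth)
    have g0: "row G (0, 1, 0) 0 = x" "row G (0, 0, 1) 0 = y" "row G (0, 1, 0) 1 = 0" "row G (0, 0, 1) 1 = 0"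
        "row G (1, 1, 0) 0 = x * c0" "row G (1, 0, 1) 0 = y * c0" "row G (1, 0, 0) 0 = c0"
        "row G (1, 1, 0) 1 = x * c" "row G (1, 0, 1) 1 = y * c" "row G (1, 0, 0) 1 = c"
      using rG(1) [of 1 0] rG(1) [of 0 1] rG(2) [of 1 0] rG(2) [of 0 1] rG(3) [of 1 0] rG(3) [of 0 1] rG(3) [of 0 0]
        rG(4) [of 1 0] rG(4) [of 0 1] rG(4) [of 0 0] by simp_all
    have cz: "cc (0 :: 'a) = 0" "cc (1 :: 'a) = 1" by simp_all
    have dc: "dx c = 0" "dy c = 0" by (simp_all add: c_def dx_add)
    have eqs': "dx x * X0 + dy x * Y0 = cc h2 * x - cc t3 * cc h1 * y + (x + cc t1 - cc t3 * y) * c0"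
      "dx y * X0 + dy y * Y0 = cc h1 * x + cc h2 * y + (x + y + cc t2) * c0"
      "dx x * X1 + dy x * Y1 = (x + cc t1 - cc t3 * y) * c"
      "dx y * X1 + dy y * Y1 = (x + y + cc t2) * c"
      "dx c0 * X0 + dy c0 * Y0 + c * Z0 = 0" "dx c0 * X1 + dy c0 * Y1 + c * Z1 = 0"
      using eqs series_even_commute [OF hc] unfolding vf_def c_def [symmetric] by metis+
    have k01: "k = 0 \<or> k = 1" using k by auto
    have cases: "P = (1, 0, 0) \<or> P = (0, 1, 0) \<or> P = (0, 0, 1)" using P by auto
    note dd = dE dcf_dt_cochain [OF ht]
    have Dr: "row (G \<circ> D) P 0 = dx (row G P 0) * X0 + dy (row G P 0) * Y0 + row G P 1 * Z0"
      "row (G \<circ> D) P 1 = dx (row G P 0) * X1 + dy (row G P 0) * Y1 + row G P 1 * Z1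
        - (dx (row G P 1) * X0 + dy (row G P 1) * Y0)"
      unfolding defs by (rule row_comp_coderivation [OF G(1) D])+
    from cases show ?thesis
    proof (elim disjE)
      assume P1: "P = (1, 0, 0)"
      have "dcf E P J = 0" for J unfolding dd unfolding P1 by simp
      then have "row (E \<circ> G) P k = 0" unfolding r by simp
      moreover have "row (G \<circ> D) P k = 0"
        using k01 Dr [unfolded P1 g0 dc] eqs'(5,6) unfolding P1 by auto
      ultimately show ?thesis by simp
    next
      assume P1: "P = (0, 1, 0)"
      have e: "dcf E P (1, 1, 0) = 1" "dcf E P (1, 0, 1) = - t3" "dcf E P (1, 0, 0) = t1" "dcf E P (0, 1, 0) = h2"
          "dcf E P (0, 0, 1) = - (t3 * h1)" unfolding dd unfolding P1 by simp_all
      have n: "cc (- t3) = - cc t3" "cc (- (t3 * h1)) = - (cc t3 * cc h1)" by simp_all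
      have "row (E \<circ> G) P k = row (G \<circ> D) P k" if "k = 0"
        unfolding that r Dr e n unfolding P1 g0 eqs' cz
        by (simp add: algebra_simps del: fps_const_mult fps_const_neg)
      moreover have "row (E \<circ> G) P k = row (G \<circ> D) P k" if "k = 1"
        unfolding that r Dr e n unfolding P1 g0 eqs' cz
        by (simp add: algebra_simps del: fps_const_mult fps_const_neg)
      ultimately show ?thesis using k01 by blast
    next
      assume P1: "P = (0, 0, 1)"
      have e: "dcf E P (1, 1, 0) = 1" "dcf E P (1, 0, 1) = 1" "dcf E P (1, 0, 0) = t2" "dcf E P (0, 1, 0) = h1"
          "dcf E P (0, 0, 1) = h2" unfolding dd unfolding P1 by simp_all
      have "row (E \<circ> G) P k = row (G \<circ> D) P k" if "k = 0"
        unfolding that r Dr e unfolding P1 g0 eqs' cz by (simp add: algebra_simps)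
      moreover have "row (E \<circ> G) P k = row (G \<circ> D) P k" if "k = 1"
        unfolding that r Dr e unfolding P1 g0 eqs' cz by (simp add: algebra_simps)
      ultimately show ?thesis using k01 by blast
    qed
  qed
  have GD: "coderivation B 1 (G \<circ> D \<circ> inv G)" by (rule coderivation_conj [OF autG D])
  have "E = G \<circ> D \<circ> inv G"
  proof (rule coderivation_eqI [OF cE GD])
    fix P I :: "nat \<times> nat \<times> nat" assume P: "P \<in> {(1, 0, 0), (0, 1, 0), (0, 0, 1)}"
    have "dcf (E \<circ> G) P J = dcf (G \<circ> D) P J" for J
    proof (cases "valid J")
      case True
      obtain k i j where J: "J = (k, i, j)" by (cases J)
      have "row (E \<circ> G) P k $ j $ i = row (G \<circ> D) P k $ j $ i"
        using True by (subst rEG [OF P]) (simp_all add: J valid_iff)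
      then show ?thesis by (simp add: J)
    qed simp
    \<comment> \<open>\<open>E \<circ> G\<close> is not a coderivation, so agreement of three rows
      with \<open>G \<circ> D\<close> would not suffice. Composing with \<open>inv G\<close> gives a
      comparison of two coderivations, which are determined by these rows.\<close>
    then have "dcf (E \<circ> G \<circ> inv G) P I = dcf (G \<circ> D \<circ> inv G) P I"
      by (intro dcf_comp_cong right_linear_comp linE G(1) lin)
    moreover have "E \<circ> G \<circ> inv G = E" using bij by (simp add: fun_eq_iff bij_is_surj surj_f_inv_f)
    ultimately show "dcf E P I = dcf (G \<circ> D \<circ> inv G) P I" by simp
  qed
  then have "D = inv G \<circ> E \<circ> inv (inv G)"
    using bij by (simp add: fun_eq_iff inv_inv_eq bij_is_inj)
  then have "equivalent B E D"
    unfolding equivalent_def using coalgebra_aut_inv [OF autG] push_aug_inv [OF G(1) bij pushG] by blast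
  then show ?thesis using that [OF f] pushE by simp
qed

end


section \<open>Uniqueness over infinitesimal bases\<close>

lemma tlen_diff: "R \<le> I \<Longrightarrow> tlen (I - R) = tlen I - tlen R"
  by (cases R; cases I) (simp add: tlen_def)

lemma tlen_pos: "valid P \<Longrightarrow> 1 \<le> tlen P"
  by (cases P) (simp add: tlen_def valid_iff)

lemma valid_split:
  assumes "valid J" "2 \<le> tlen J"
  obtains Q R where "valid Q" "valid R" "J = Q + R"
proof -
  obtain a b c where J: "J = (a, b, c)" by (cases J)
  have abc: "a \<le> 1" "2 \<le> a + b + c" using assms by (simp_all add: J valid_iff tlen_def)
  consider "a = 1" | "a = 0" "b \<noteq> 0" | "a = 0" "b = 0" using abc by linarith
  then show ?thesis
  proof cases
    case 1
    then show ?thesis using abc by (intro that [of "(1, 0, 0)" "(0, b, c)"]) (simp_all add: J valid_iff)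
  next
    case 2
    then show ?thesis using abc by (intro that [of "(0, 1, 0)" "(0, b - 1, c)"]) (simp_all add: J valid_iff)
  next
    case 3
    then show ?thesis using abc by (intro that [of "(0, 0, 1)" "(0, 0, c - 1)"]) (simp_all add: J valid_iff)
  qed
qed

context augmented_local_algebra
begin

text \<open>A row of length at least two splits as a product, and the Leibniz rule then asks for
  columns of length zero or less, which are not monomials.\<close>

lemma coderivation_length_one:
  assumes E: "coderivation B p E" and gen: "\<And>P I. tlen P = 1 \<Longrightarrow> tlen I = 1 \<Longrightarrow> dcf E P I \<in> max_ideal B"
    and I: "tlen I = 1"
  shows "dcf E J I \<in> max_ideal B"
proof (cases "valid J \<and> valid I \<and> 2 \<le> tlen J")
  case True
  then obtain Q R where QR: "valid Q" "valid R" "J = Q + R" using valid_split by blast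
  have z: "dcf E P (I - R') = 0" if "valid R'" "R' \<le> I" for P R'
  proof -
    have "tlen (I - R') = 0" using tlen_diff [OF that(2)] tlen_pos [OF that(1)] I by simp
    then have "\<not> valid (I - R')" using tlen_pos by fastforce
    then show ?thesis by simp
  qed
  show ?thesis
    unfolding QR(3) using dcf_coderivation [OF E QR(1,2), of I] z QR True by (simp add: max_ideal_iff)
next
  case False
  then consider "\<not> valid J" | "\<not> valid I" | "tlen J = 1" using tlen_pos [of J] by linarith
  then show ?thesis using gen I by cases (simp_all add: max_ideal_iff)
qed

text \<open>The Leibniz rule reduces a column of length two to columns of length at most one, which
  the previous lemma covers.\<close>

lemma coderivation_length_two:
  assumes E: "coderivation B p E" and gen: "\<And>P I. tlen P = 1 \<Longrightarrow> tlen I = 1 \<Longrightarrow> dcf E P I \<in> max_ideal B"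
    and J: "2 \<le> tlen J" and I: "tlen I = 2"
  shows "dcf E J I \<in> max_ideal B"
proof (cases "valid J \<and> valid I")
  case True
  then obtain Q R where QR: "valid Q" "valid R" "J = Q + R" using valid_split J by blast
  have m: "dcf E P (I - R') \<in> max_ideal B" if "valid R'" "R' \<le> I" for P R'
  proof -
    have "tlen (I - R') \<le> 1" using tlen_diff [OF that(2)] tlen_pos [OF that(1)] I by simp
    then consider "\<not> valid (I - R')" | "tlen (I - R') = 1" using tlen_pos [of "I - R'"] by linarith
    then show ?thesis
      by cases (simp_all add: max_ideal_iff coderivation_length_one [OF E gen, unfolded max_ideal_iff])
  qed
  show ?thesis
    unfolding QR(3) using dcf_coderivation [OF E QR(1,2), of I] m [OF QR(1)] m [OF QR(2)] True
    by (auto simp: max_ideal_iff aug_add aug_mult aug_twist)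
next
  case False
  then show ?thesis by (auto simp: max_ideal_iff)
qed

text \<open>To first order, conjugation by an automorphism that is the identity modulo m changes the
  family by a coboundary. The five entries are those in which the parameters stand and to which
  coboundaries do not contribute; this is read off from
  \<open>D \<circ> L = L \<circ> E\<close>.\<close>

lemma parameters_determined:
  assumes B: "infinitesimal_base B" and push: "push (aug B) D = d_sharp"
    and f: "base_hom base_A B f" and eq: "equivalent B (push f d2) D"
  shows "f t1 = dcf D (0, 1, 0) (1, 0, 0)" "f t2 = dcf D (0, 0, 1) (1, 0, 0)"
    "f t3 = - dcf D (0, 1, 0) (1, 0, 1)"
    "f \<theta>1 = dcf D (0, 0, 1) (0, 1, 0)" "f \<theta>2 = dcf D (0, 1, 0) (0, 1, 0)"
proof -
  define E where "E = dt (f t1) (f t2) (f t3) (f \<theta>1) (f \<theta>2)"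
  have ht: "f t1 \<in> homog B 0" "f t2 \<in> homog B 0" "f t3 \<in> homog B 0" and hh: "f \<theta>1 \<in> homog B 1" "f \<theta>2 \<in> homog B 1"
    using f t_homog unfolding base_hom_def by blast+
  have mt: "f t \<in> max_ideal B" if "t \<in> max_ideal base_A" for t
    using f that by (simp add: base_hom_def max_ideal_def)
  have mf: "f t1 \<in> max_ideal B" "f t2 \<in> max_ideal B" "f t3 \<in> max_ideal B" "f \<theta>1 \<in> max_ideal B" "f \<theta>2 \<in> max_ideal B"
    by (intro mt t_max_ideal)+
  have pushE: "push f d2 = E"
    using push_d2 [OF augmented_local_algebra_axioms f] by (simp add: E_def)
  have cE: "coderivation B 1 E" unfolding E_def by (rule coderivation_dt [OF ht hh])
  then have linE: "right_linear E" by (simp add: coderivation_def)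
  obtain L where autL: "coalgebra_aut B L" and pushL: "push (aug B) L = id" and DL: "D = L \<circ> E \<circ> inv L"
    using eq unfolding equivalent_def pushE by blast
  have linL: "right_linear L" and bij: "bij L" and multL: "\<And>x. comult (L x) = tens_map B 0 L L (comult x)"
    using autL by (simp_all add: coalgebra_aut_def)
  have linD: "right_linear D"
    using coderivation_conj [OF autL cE] by (simp add: DL coderivation_def)
  have comm: "D \<circ> L = L \<circ> E"
    unfolding DL using bij by (simp add: fun_eq_iff bij_is_inj)
  have mm: "u * v = 0" if "u \<in> max_ideal B" "v \<in> max_ideal B" for u v
    using infinitesimal_mult [OF B that] .
  have one: "u * v = u" "v * u = u" if "u \<in> max_ideal B" "aug B v = 1" for u v
  proof -
    have "v - 1 \<in> max_ideal B" using that by (simp add: max_ideal_iff aug_diff)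
    then have "u * (v - 1) = 0" "(v - 1) * u = 0" using mm that by blast+
    then show "u * v = u" "v * u = u" by (simp_all add: algebra_simps)
  qed
  have aL: "aug B (dcf L P I) = (if P = I \<and> valid P then 1 else 0)" for P I
    using aug_dcf [of L P I] pushL by (simp add: field.dcf_id)
  have mL: "dcf L P I \<in> max_ideal B" if "P \<noteq> I" for P I using that by (simp add: max_ideal_iff aL)
  have g: "tlen (0, 1, 0) = 1" "tlen (0, 0, 1) = 1" by (simp_all add: tlen_def)
  note aD = aug_dcf_deformation [OF push]
  \<comment> \<open>Off the diagonal \<open>L\<close> has entries in m, and products of two elements
    of m vanish. So besides the diagonal term only the columns \<open>S\<close> survive, where
    \<open>D\<close> has augmentation one.\<close>
  have left: "dcf (D \<circ> L) P I = dcf D P I + (\<Sum>J\<in>S. dcf L J I)"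
    if P: "tlen P = 1" and S: "finite S" "I \<notin> S" "\<And>J. aug B (dcf D P J) = (if J \<in> S then 1 else 0)" and I: "valid I" for P I S
  proof -
    have "dcf (D \<circ> L) P I = (\<Sum>J\<in>insert I S. dcf D P J * dcf L J I)"
    proof (rule dcf_comp [OF linD])
      fix J assume nz: "dcf D P J * dcf L J I \<noteq> 0"
      show "J \<in> insert I S"
      proof (rule ccontr)
        assume "J \<notin> insert I S"
        then have "dcf D P J \<in> max_ideal B" "dcf L J I \<in> max_ideal B" using S(3) mL by (auto simp: max_ideal_iff)
        then show False using mm nz by blast
      qed
    qed (use S in simp)
    also have "\<dots> = dcf D P I * dcf L I I + (\<Sum>J\<in>S. dcf D P J * dcf L J I)" using S by simp
    also have "dcf D P I * dcf L I I = dcf D P I"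
      using S I by (intro one) (simp_all add: max_ideal_iff aL)
    also have "(\<Sum>J\<in>S. dcf D P J * dcf L J I) = (\<Sum>J\<in>S. dcf L J I)"
      using S by (intro sum.cong refl one mL) auto
    finally show ?thesis .
  qed
  have dE: "dcf E P I = dcf (dt_cochain B (f t1) (f t2) (f t3) (f \<theta>1) (f \<theta>2)) P I" if "tlen P = 1" for P I
    unfolding E_def by (rule dcf_dt [OF ht hh that])
  note dE' = dE [unfolded dcf_dt_cochain [OF ht]]
  have aE: "aug B (dcf E P I) = (if P = (0, 1, 0) \<and> I = (1, 1, 0) \<or> P = (0, 0, 1) \<and> (I = (1, 1, 0) \<or> I = (1, 0, 1)) then 1 else 0)"
    if "tlen P = 1" for P I
    unfolding dE' [OF that] using mf by (auto simp: max_ideal_iff aug_uminus aug_mult)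
  have gen: "dcf E P I \<in> max_ideal B" if "tlen P = 1" "tlen I = 1" for P I
    using aE [OF that(1), of I] that(2) by (auto simp: max_ideal_iff tlen_def)
  have right: "dcf (L \<circ> E) P I = dcf E P I" if P: "tlen P = 1" "valid P" and I: "tlen I = 1" for P I
  proof -
    have mE: "dcf E J I \<in> max_ideal B" for J by (rule coderivation_length_one [OF cE gen I])
    have "dcf (L \<circ> E) P I = (\<Sum>J\<in>{P}. dcf L P J * dcf E J I)"
    proof (rule dcf_comp [OF linL])
      fix J assume nz: "dcf L P J * dcf E J I \<noteq> 0"
      have "dcf L P J * dcf E J I = 0" if "P \<noteq> J" using that by (intro mm mL mE)
      then show "J \<in> {P}" using nz by auto
    qed simp
    also have "\<dots> = dcf E P I" using one(2) [OF mE, of "dcf L P P"] aL P by simp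
    finally show ?thesis .
  qed
  \<comment> \<open>For \<open>t3\<close> the column has length two, and the entry of
    \<open>E\<close> in the row of y with value one contributes an off-diagonal entry of
    \<open>L\<close>. By \<open>z2\<close> the same entry appears on the left, so it
    cancels.\<close>
  have right2: "dcf (L \<circ> E) (0, 1, 0) (1, 0, 1) = dcf E (0, 1, 0) (1, 0, 1) + dcf L (0, 1, 0) (0, 0, 1)"
  proof -
    have "dcf (L \<circ> E) (0, 1, 0) (1, 0, 1) =
      (\<Sum>J\<in>{(0, 1, 0), (0, 0, 1)}. dcf L (0, 1, 0) J * dcf E J (1, 0, 1))"
    proof (rule dcf_comp [OF linL])
      fix J assume v: "valid J" and nz: "dcf L (0, 1, 0) J * dcf E J (1, 0, 1) \<noteq> 0"
      show "J \<in> {(0, 1, 0), (0, 0, 1)}"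
      proof (rule ccontr)
        assume J: "J \<notin> {(0, 1, 0), (0, 0, 1)}"
        have "dcf E J (1, 0, 1) \<in> max_ideal B"
        proof (cases "tlen J = 1")
          case True
          then show ?thesis using aE [OF True, of "(1, 0, 1)"] J by (auto simp: max_ideal_iff)
        next
          case False
          then have "2 \<le> tlen J" using tlen_pos [OF v] by simp
          moreover have "tlen (1, 0, 1) = 2" by (simp add: tlen_def)
          ultimately show ?thesis using coderivation_length_two [OF cE gen] by blast
        qed
        moreover have "dcf L (0, 1, 0) J \<in> max_ideal B" using J by (intro mL) auto
        ultimately show False using mm nz by blast
      qed
    qed simp
    also have "\<dots> = dcf L (0, 1, 0) (0, 1, 0) * dcf E (0, 1, 0) (1, 0, 1) + dcf L (0, 1, 0) (0, 0, 1) * dcf E (0, 0, 1) (1, 0, 1)"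
      by simp
    also have "dcf L (0, 1, 0) (0, 1, 0) * dcf E (0, 1, 0) (1, 0, 1) = dcf E (0, 1, 0) (1, 0, 1)"
      by (rule one(2)) (use aE [OF g(1), of "(1, 0, 1)"] in \<open>simp_all add: max_ideal_iff aL valid_iff\<close>)
    also have "dcf L (0, 1, 0) (0, 0, 1) * dcf E (0, 0, 1) (1, 0, 1) = dcf L (0, 1, 0) (0, 0, 1)"
      by (rule one(1)) (use aE [OF g(2), of "(1, 0, 1)"] in \<open>simp_all add: mL\<close>)
    finally show ?thesis .
  qed
  have v: "valid (1, 0, 0)" "valid (0, 1, 0)" "valid (0, 0, 1)" "valid (1, 0, 1)" by (simp_all add: valid_iff)
  have nv: "\<not> valid (0, 0, 0)" by (simp add: valid_iff)
  have Lmult: "dcf L ((1, 0, 0) + Q) I = (\<Sum>J\<in>{J. J \<le> I}. dcf L (1, 0, 0) J * dcf L Q (I - J))"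
    if "Q = (0, 1, 0) \<or> Q = (0, 0, 1)" "valid I" for Q I
  proof -
    have "valid Q" "tpar Q = 0" using that v by auto
    then show ?thesis
      using comultiplicative_iff [OF linL, THEN iffD1, rule_format, OF _ v(1) \<open>valid Q\<close> that(2)] multL by simp
  qed
  \<comment> \<open>A column of length one splits only with an empty part, and the empty index
    carries the coefficient zero.\<close>
  have z1: "dcf L (1, 1, 0) I = 0" "dcf L (1, 0, 1) I = 0" if "I = (1, 0, 0) \<or> I = (0, 1, 0)" for I
  proof -
    have "(\<Sum>J\<in>{J. J \<le> I}. dcf L (1, 0, 0) J * dcf L Q (I - J)) = 0" for Q
    proof (rule sum.neutral, rule ballI)
      fix J assume J: "J \<in> {J. J \<le> I}"
      have "J = (0, 0, 0) \<or> I - J = (0, 0, 0)" using that J by (cases J) (auto simp: zero_prod_def le_Suc_eq)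
      then show "dcf L (1, 0, 0) J * dcf L Q (I - J) = 0" using nv by auto
    qed
    then show "dcf L (1, 1, 0) I = 0" "dcf L (1, 0, 1) I = 0"
      using Lmult [of "(0, 1, 0)" I] Lmult [of "(0, 0, 1)" I] that v by auto
  qed
  \<comment> \<open>Of the four terms of the convolution, two contain the empty index and one is a
    product of two elements of m.\<close>
  have z2: "dcf L (1, 1, 0) (1, 0, 1) = dcf L (0, 1, 0) (0, 0, 1)"
  proof -
    have S: "{J. J \<le> (1, 0, 1)} = ({(0, 0, 0), (0, 0, 1), (1, 0, 0), (1, 0, 1)} :: (nat \<times> nat \<times> nat) set)"
      by (auto simp: le_Suc_eq zero_prod_def)
    have "dcf L (1, 1, 0) (1, 0, 1) = dcf L (1, 0, 0) (0, 0, 1) * dcf L (0, 1, 0) (1, 0, 0)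
        + dcf L (1, 0, 0) (1, 0, 0) * dcf L (0, 1, 0) (0, 0, 1)"
      using Lmult [of "(0, 1, 0)" "(1, 0, 1)"] v nv unfolding S by (simp add: zero_prod_def)
    moreover have "dcf L (1, 0, 0) (0, 0, 1) * dcf L (0, 1, 0) (1, 0, 0) = 0"
      by (intro mm mL) simp_all
    moreover have "dcf L (1, 0, 0) (1, 0, 0) * dcf L (0, 1, 0) (0, 0, 1) = dcf L (0, 1, 0) (0, 0, 1)"
      by (intro one(2) mL) (simp_all add: aL valid_iff)
    ultimately show ?thesis by simp
  qed
  have Sx: "aug B (dcf D (0, 1, 0) J) = (if J \<in> {(1, 1, 0)} then 1 else 0)" for J
    using aD [OF g(1)] by simp
  have Sy: "aug B (dcf D (0, 0, 1) J) = (if J \<in> {(1, 1, 0), (1, 0, 1)} then 1 else 0)" for J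
    using aD [OF g(2)] by simp
  have leftx: "dcf (D \<circ> L) (0, 1, 0) I = dcf D (0, 1, 0) I + dcf L (1, 1, 0) I" if "I \<noteq> (1, 1, 0)" "valid I" for I
    using left [OF g(1) _ _ Sx that(2)] that(1) by simp
  have lefty: "dcf (D \<circ> L) (0, 0, 1) I = dcf D (0, 0, 1) I + (dcf L (1, 1, 0) I + dcf L (1, 0, 1) I)"
    if "I \<noteq> (1, 1, 0)" "I \<noteq> (1, 0, 1)" "valid I" for I
    using left [OF g(2) _ _ Sy that(3)] that(1,2) by simp
  have t: "tlen (1, 0, 0) = 1" by (simp add: tlen_def)
  have e: "dcf E (0, 1, 0) (1, 0, 0) = f t1" "dcf E (0, 0, 1) (1, 0, 0) = f t2"
      "dcf E (0, 1, 0) (1, 0, 1) = - f t3" "dcf E (0, 0, 1) (0, 1, 0) = f \<theta>1"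
      "dcf E (0, 1, 0) (0, 1, 0) = f \<theta>2"
    using dE' [OF g(1), of "(1, 0, 0)"] dE' [OF g(2), of "(1, 0, 0)"] dE' [OF g(1), of "(1, 0, 1)"]
      dE' [OF g(2), of "(0, 1, 0)"] dE' [OF g(1), of "(0, 1, 0)"] by simp_all
  show "f t1 = dcf D (0, 1, 0) (1, 0, 0)"
    using leftx [of "(1, 0, 0)"] right [OF g(1) v(2) t] z1 [of "(1, 0, 0)"] e v comm by simp
  show "f t2 = dcf D (0, 0, 1) (1, 0, 0)"
    using lefty [of "(1, 0, 0)"] right [OF g(2) v(3) t] z1 [of "(1, 0, 0)"] e v comm by simp
  have "- f t3 = dcf D (0, 1, 0) (1, 0, 1)"
    using leftx [of "(1, 0, 1)"] right2 z2 e v comm by simp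
  then show "f t3 = - dcf D (0, 1, 0) (1, 0, 1)"
    by (metis minus_minus)
  show "f \<theta>1 = dcf D (0, 0, 1) (0, 1, 0)"
    using lefty [of "(0, 1, 0)"] right [OF g(2) v(3) g(1)] z1 [of "(0, 1, 0)"] e v comm by simp
  show "f \<theta>2 = dcf D (0, 1, 0) (0, 1, 0)"
    using leftx [of "(0, 1, 0)"] right [OF g(1) v(2) g(1)] z1 [of "(0, 1, 0)"] e v comm by simp
qed

end

theorem mainTheorem8:
  shows "miniversal TYPE('b::ring_1) base_A d_sharp d2
    \<and> t1 * \<theta>1 + t2 * \<theta>2 = 0
    \<and> - (t1 * \<theta>2) + t2 * t3 * \<theta>1 = 0"
proof (intro conjI base_relations)
  show "miniversal TYPE('b) base_A d_sharp d2"
    unfolding miniversal_def versal_def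
  proof (intro conjI allI impI)
    show "formal_base base_A" by (simp add: formal_base_iff formal_algebra_base_A)
    show "deformation base_A d_sharp d2" by (rule deformation_d2)
  next
    fix B :: "'b base" and D
    assume BD: "formal_base B \<and> deformation B d_sharp D"
    then interpret formal_algebra B by (simp add: formal_base_iff)
    show "\<exists>f. base_hom base_A B f \<and> equivalent B (push f d2) D"
      using d2_versal BD by blast
  next
    fix B :: "'b base" and D f g
    assume BD: "infinitesimal_base B \<and> deformation B d_sharp D"
      and fg: "base_hom base_A B f \<and> equivalent B (push f d2) D \<and> base_hom base_A B g \<and> equivalent B (push g d2) D"
    interpret augmented_local_algebra B using BD by (simp add: infinitesimal_base_def)
    have B: "infinitesimal_base B" and push: "push (aug B) D = d_sharp"
      using BD by (simp_all add: deformation_def)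
    have f: "base_hom base_A B f" "equivalent B (push f d2) D"
      and g: "base_hom base_A B g" "equivalent B (push g d2) D" using fg by simp_all
    show "f = g"
      by (rule base_hom_unique [OF B f(1) g(1)])
        (simp_all only: parameters_determined [OF B push f] parameters_determined [OF B push g])
  qed
qed

end
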